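(* Let $0<2\alpha<1$, let $D,X,\Gamma$ be as in the context, and let $\mu_2$ be a continuous function on $\overline\Gamma$, written $\mu_2(s,t)$ in terms of the parameters. Let $$w^{(2)}(x,y,z)=\iint_\Gamma\mu_2(\theta,\vartheta)\,B_\nu^\alpha\left[q_2(\xi,\eta,\zeta;x,y,z)\right]d\Gamma ,$$ and denote by $w_i^{(2)}(s,t)$ and $w_e^{(2)}(s,t)$ the limits of $w^{(2)}(x,y,z)$ as $(x,y,z)$ tends to the point $(x(s,t),y(s,t),z(s,t))\in\Gamma$ from inside and from outside $D$ respectively. Then $$w_i^{(2)}(s,t)=-\frac12\mu_2(s,t)+\iint_\Gamma\mu_2(\theta,\vartheta)K_2(s,t;\theta,\vartheta)\,d\Gamma,$$ $$w_e^{(2)}(s,t)=\frac12\mu_2(s,t)+\iint_\Gamma\mu_2(\theta,\vartheta)K_2(s,t;\theta,\vartheta)\,d\Gamma,$$ where $$K_2(s,t;\theta,\vartheta)=B_\nu^\alpha\left[q_2\left(\xi(\theta,\vartheta),\eta(\theta,\vartheta),\zeta(\theta,\vartheta);x(s,t),y(s,t),z(s,t)\right)\right].$$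
   Context: Domain. $X$ is a simply connected open region of the plane $x=0$ (the $yOz$-plane), $\Gamma$ is a Lyapunov surface lying in $x>0$ (it has a normal at every point; there is $d>0$ such that lines parallel to the normal at $N\in\Gamma$ meet the part of $\Gamma$ inside the ball of radius $d$ about $N$ at most once; the angle between the normals at two points at distance $\rho$ is at most $A\rho^{\lambda}$ with constants $A>0$, $0<\lambda\le1$), and $D$ is the domain bounded by $X$ and $\Gamma$; $\gamma$ is the common boundary curve of $X$ and $\Gamma$. $\Gamma$ is parametrized by $x=x(s,t)$, $y=y(s,t)$, $z=z(s,t)$, $(s,t)\in\overline\Phi$, $\Phi=(s_1,s_2)\times(t_1,t_2)$, and $\gamma$ by $y=y(s,t_0)$, $z=z(s,t_0)$, where $t_0\in[t_1,t_2]$ is fixed with $x(s,t_0)=0$ for all $s\in[s_1,s_2]$. It is assumed that: 1) $x(s,t),y(s,t),z(s,t)$ have continuous first partial derivatives on $\overline\Phi$ with $x_s^2+y_s^2+z_s^2\ne0$ and $x_t^2+y_t^2+z_t^2\ne0$; 2) as points of $\Gamma$ approach $\gamma$, $\Gamma$ forms a right angle with the plane $x=0$. The variable (integration) point of $\Gamma$ is $(\xi,\eta,\zeta)=(\xi(\theta,\vartheta),\eta(\theta,\vartheta),\zeta(\theta,\vartheta))$ in the same parametrization, $(\theta,\vartheta)\in\overline\Phi$; $d\Gamma$ is the surface area element at this point; $\nu$ is the outer (with respect to $D$) unit normal to $\Gamma$ there. Fundamental solution of $u_{xx}+u_{yy}+u_{zz}+\frac{2\alpha}{x}u_x=0$: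 with $F$ the (analytically continued) Gauss hypergeometric function, $$q_2(x,y,z;\xi,\eta,\zeta)=\frac1{2\pi}r^{2\alpha-3}x^{1-2\alpha}\xi^{1-2\alpha}F\left(\tfrac32-\alpha,1-\alpha;2-2\alpha;1-\tfrac{r_1^2}{r^2}\right),$$ $r^2=(x-\xi)^2+(y-\eta)^2+(z-\zeta)^2$, $r_1^2=(x+\xi)^2+(y-\eta)^2+(z-\zeta)^2$ (symmetric in the two points). Conormal derivative (acting in the integration point): $B_\nu^\alpha=\xi^{2\alpha}\left(\cos(\nu,\xi)\partial_\xi+\cos(\nu,\eta)\partial_\eta+\cos(\nu,\zeta)\partial_\zeta\right)$. *)

theory Defs
  imports "HOL-Complex_Analysis.Complex_Analysis"
begin

unbundle no fps_syntax

text \<open>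
  The Gauss hypergeometric function, continued analytically from the unit disc to the plane
  cut along the real half-line from 1 to infinity. That domain is connected, so the continuation
  is unique; on the cut itself the value is unspecified.
\<close>

definition hypergeo_F :: "complex \<Rightarrow> complex \<Rightarrow> complex \<Rightarrow> complex \<Rightarrow> complex" where
  "hypergeo_F a b c z = (THE w. \<exists>f. f holomorphic_on - {u. Im u = 0 \<and> 1 \<le> Re u} \<and>
      (\<forall>u. norm u < 1 \<longrightarrow> f u = eval_fps (fps_hypergeo [a, b] [c] 1) u) \<and> w = f z)"

text \<open>
  The fundamental solution, for points with positive first coordinate. The argument of the
  hypergeometric function is then at most 0, hence off the cut, and the value is real.
\<close>

definition q2 :: "real \<Rightarrow> real^3 \<Rightarrow> real^3 \<Rightarrow> real" where
  "q2 \<alpha> P Q =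
    (let r = sqrt ((P$1 - Q$1)\<^sup>2 + (P$2 - Q$2)\<^sup>2 + (P$3 - Q$3)\<^sup>2);
         r1 = sqrt ((P$1 + Q$1)\<^sup>2 + (P$2 - Q$2)\<^sup>2 + (P$3 - Q$3)\<^sup>2)
     in 1 / (2 * pi) * r powr (2 * \<alpha> - 3) * (P$1) powr (1 - 2 * \<alpha>) * (Q$1) powr (1 - 2 * \<alpha>) *
        Re (hypergeo_F (of_real (3 / 2 - \<alpha>)) (of_real (1 - \<alpha>)) (of_real (2 - 2 * \<alpha>))
              (of_real (1 - r1\<^sup>2 / r\<^sup>2))))"

definition partial_deriv :: "3 \<Rightarrow> (real^3 \<Rightarrow> real) \<Rightarrow> real^3 \<Rightarrow> real" where
  "partial_deriv i f Q = deriv (\<lambda>h. f (Q + h *\<^sub>R axis i 1)) 0"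

text \<open>The components of the unit vector \<open>n\<close> are its direction cosines.\<close>

definition conormal_deriv :: "real \<Rightarrow> real^3 \<Rightarrow> (real^3 \<Rightarrow> real) \<Rightarrow> real^3 \<Rightarrow> real" where
  "conormal_deriv \<alpha> n f Q = (Q$1) powr (2 * \<alpha>) *
     (n$1 * partial_deriv 1 f Q + n$2 * partial_deriv 2 f Q + n$3 * partial_deriv 3 f Q)"

definition vec_angle :: "real^3 \<Rightarrow> real^3 \<Rightarrow> real" where
  "vec_angle u v = arccos (u \<bullet> v / (norm u * norm v))"

definition topological_surface :: "(real^3) set \<Rightarrow> bool" where
  "topological_surface S \<longleftrightarrow>
     (\<forall>N\<in>S. \<exists>U. openin (top_of_set S) U \<and> N \<in> U \<and> U homeomorphic (UNIV :: (real^2) set))"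

text \<open>The plane through \<open>N\<close> orthogonal to \<open>n\<close> is tangent to \<open>S\<close> at \<open>N\<close>.\<close>

definition unit_normal_at :: "(real^3) set \<Rightarrow> real^3 \<Rightarrow> real^3 \<Rightarrow> bool" where
  "unit_normal_at S N n \<longleftrightarrow>
     norm n = 1 \<and> ((\<lambda>Q. ((Q - N) \<bullet> n) / norm (Q - N)) \<longlongrightarrow> 0) (at N within S)"

definition lyapunov_surface :: "(real^3) set \<Rightarrow> (real^3 \<Rightarrow> real^3) \<Rightarrow> bool" where
  "lyapunov_surface S \<nu> \<longleftrightarrow>
     topological_surface S \<and>
     (\<forall>N\<in>S. unit_normal_at S N (\<nu> N)) \<and>
     (\<exists>d>0. \<forall>N\<in>S. \<forall>P\<in>S \<inter> ball N d. \<forall>Q\<in>S \<inter> ball N d. (\<exists>h. Q = P + h *\<^sub>R \<nu> N) \<longrightarrow> Q = P) \<and>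
     (\<exists>A>0. \<exists>l. 0 < l \<and> l \<le> 1 \<and>
        (\<forall>N\<in>S. \<forall>Q\<in>S. vec_angle (\<nu> N) (\<nu> Q) \<le> A * dist N Q powr l))"

definition points_outward :: "(real^3) set \<Rightarrow> real^3 \<Rightarrow> real^3 \<Rightarrow> bool" where
  "points_outward D Q n \<longleftrightarrow>
     (\<forall>\<^sub>F h in at_right 0. Q - h *\<^sub>R n \<in> D \<and> Q + h *\<^sub>R n \<notin> closure D)"

text \<open>
  A parametrization \<open>r\<close> over a rectangle need not be injective (closed coordinate lines, for
  instance, identify opposite sides). In the surface integral every point of \<open>\<Gamma>\<close> has to be
  counted once, so the integral runs over the lexicographically least parameter of each point.
  By the area formula any other measurable choice of representatives gives the same value; if
  \<open>r\<close> is injective, all parameters of points of \<open>\<Gamma>\<close> are used.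
\<close>

definition param_reps ::
  "(real \<Rightarrow> real \<Rightarrow> real^3) \<Rightarrow> (real \<times> real) set \<Rightarrow> (real^3) set \<Rightarrow> (real \<times> real) set" where
  "param_reps r R \<Gamma> = {(a, b) \<in> R. r a b \<in> \<Gamma> \<and>
     (\<forall>(a', b') \<in> R. r a' b' = r a b \<longrightarrow> a < a' \<or> (a = a' \<and> b \<le> b'))}"

text \<open>In the following, \<open>rs\<close> and \<open>rt\<close> are the partial derivatives of \<open>r\<close>.\<close>

definition surface_integrable ::
  "(real \<Rightarrow> real \<Rightarrow> real^3) \<Rightarrow> (real \<Rightarrow> real \<Rightarrow> real^3) \<Rightarrow> (real \<Rightarrow> real \<Rightarrow> real^3) \<Rightarrow>
   (real \<times> real) set \<Rightarrow> (real^3) set \<Rightarrow> (real \<Rightarrow> real \<Rightarrow> real) \<Rightarrow> bool" where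
  "surface_integrable r rs rt R \<Gamma> f \<longleftrightarrow>
     set_integrable lborel (param_reps r R \<Gamma>) (\<lambda>(a, b). f a b * norm (cross3 (rs a b) (rt a b)))"

definition surface_integral ::
  "(real \<Rightarrow> real \<Rightarrow> real^3) \<Rightarrow> (real \<Rightarrow> real \<Rightarrow> real^3) \<Rightarrow> (real \<Rightarrow> real \<Rightarrow> real^3) \<Rightarrow>
   (real \<times> real) set \<Rightarrow> (real^3) set \<Rightarrow> (real \<Rightarrow> real \<Rightarrow> real) \<Rightarrow> real" where
  "surface_integral r rs rt R \<Gamma> f =
     set_lebesgue_integral lborel (param_reps r R \<Gamma>)
       (\<lambda>(a, b). f a b * norm (cross3 (rs a b) (rt a b)))"

text \<open>The conormal derivative of \<open>q2\<close> in the surface point \<open>r a b\<close>, with the other point \<open>P\<close> fixed.\<close>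

definition dl_kernel ::
  "real \<Rightarrow> (real^3 \<Rightarrow> real^3) \<Rightarrow> (real \<Rightarrow> real \<Rightarrow> real^3) \<Rightarrow> real^3 \<Rightarrow> real \<Rightarrow> real \<Rightarrow> real" where
  "dl_kernel \<alpha> \<nu> r P a b = conormal_deriv \<alpha> (\<nu> (r a b)) (\<lambda>Q. q2 \<alpha> Q P) (r a b)"

definition K2 ::
  "real \<Rightarrow> (real^3 \<Rightarrow> real^3) \<Rightarrow> (real \<Rightarrow> real \<Rightarrow> real^3) \<Rightarrow> real \<Rightarrow> real \<Rightarrow> real \<Rightarrow> real \<Rightarrow> real" where
  "K2 \<alpha> \<nu> r s t a b = dl_kernel \<alpha> \<nu> r (r s t) a b"

end

theory Submission
  imports Defs
begin

text \<open>
  Write \<open>e = 1 - 2 * \<alpha>\<close>. An Euler integral continues the hypergeometric function, and a Pfaff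
  transformation turns it into an integral that stays regular as the two points merge. Hence the
  conormal derivative of \<open>q2\<close> at \<open>Q\<close> is \<open>a(P,Q) * ((P - Q) \<bullet> \<nu> Q) / norm (Q - P) ^ 3\<close> plus a term
  of order \<open>1 / norm (Q - P)\<close>, where \<open>a(P,Q)\<close> tends to \<open>1 / (4 * pi)\<close> at the diagonal.

  Near a point \<open>N\<close> the surface is a graph over its tangent plane by invariance of domain. For
  \<open>P\<close> at signed height \<open>h\<close> above the foot point \<open>P'\<close> on the graph, split \<open>P - Q\<close> into \<open>P' - Q\<close> and
  the vertical part. The first contributes a weakly singular kernel, because the Hoelder condition
  on the normals makes \<open>(P' - Q) \<bullet> \<nu> Q\<close> of order \<open>1 + l\<close>; it passes to the limit by dominated
  convergence. The second is a Poisson-type kernel \<open>h / norm (Q - P) ^ 3\<close>; rescaling by \<open>h\<close> shows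
  that it contributes \<open>sgn h / (4 * pi)\<close> times the density times the integral \<open>2 * pi\<close> of
  \<open>(1 + norm w ^ 2) powr (- 3 / 2)\<close> over the plane, that is, half the density. The domain lies
  below the graph, so \<open>h < 0\<close> inside and \<open>h > 0\<close> outside. The argument is local and needs no
  divergence theorem.
\<close>

section \<open>The hypergeometric function as an Euler integral\<close>

text \<open>\<open>hypergeo_F\<close> is given by unique description, so only the identity theorem
  can identify it; this calls for a formula on the whole cut plane. The next obstacle is that its
  argument \<open>1 - r1^2 / r^2\<close> runs to minus infinity as the points merge. The Pfaff form
  replaces it by \<open>K = r^2 / r1^2\<close> in (0, 1], where the integral stays bounded and only
  its derivative grows, like \<open>1 / sqrt K = r1 / r\<close>; a factor of order \<open>r\<close>
  in the conormal derivative absorbs this growth. The integral of \<open>sin t powr e\<close>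
  normalises the Euler integral and also gives the limit at \<open>K = 0\<close>, so it cancels and
  the constant \<open>1 / (4 * pi)\<close> appears without values of the Gamma function.

  Two difficulties shape the local part. The singularity sits near the foot point of
  \<open>P\<close>, which moves as \<open>P\<close> approaches \<open>N\<close>; only after
  translating or rescaling about the foot point does one integrable bound serve all
  \<open>P\<close>. And the parametrization may fail to be injective and its partial derivatives may
  be parallel, so the charts come from the tangent planes, and the parametrization enters only
  through a change of variables.\<close>

definition sin_moment :: "real \<Rightarrow> nat \<Rightarrow> real" where
  "sin_moment e n = integral {0..pi} (\<lambda>t. sin t powr e * ((1 - cos t) / 2) ^ n)"

lemma continuous_on_sin_powr:
  assumes "0 < e"
  shows "continuous_on {0..pi} (\<lambda>t. sin t powr e)"
  using assms by (intro continuous_on_powr' continuous_intros) (auto simp: sin_ge_zero)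

lemma sin_moment_integrable:
  assumes "0 < e"
  shows "(\<lambda>t. sin t powr e * ((1 - cos t) / 2) ^ n) integrable_on {0..pi}"
  by (intro integrable_continuous_real continuous_intros continuous_on_sin_powr assms) auto

text \<open>Integration by parts: the difference of the two integrands is the derivative of
  \<open>sin t powr (1 + e) * ((1 - cos t) / 2) ^ n\<close>, which vanishes at 0 and at
  \<open>pi\<close>.\<close>

lemma sin_moment_Suc:
  assumes "0 < e"
  shows "(1 + e + 2 * real n) * sin_moment e n = (2 + 2 * e + 2 * real n) * sin_moment e (Suc n)"
proof -
  let ?s = "\<lambda>t::real. (1 - cos t) / 2"
  let ?f = "\<lambda>t. (1 + e + 2 * real n) * (sin t powr e * ?s t ^ n) - (2 + 2 * e + 2 * real n) * (sin t powr e * ?s t ^ Suc n)"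
  have "(?f has_integral (sin pi powr (1 + e) * ?s pi ^ n - sin 0 powr (1 + e) * ?s 0 ^ n)) {0..pi}"
  proof (rule fundamental_theorem_of_calculus_interior)
    show "continuous_on {0..pi} (\<lambda>t. sin t powr (1 + e) * ?s t ^ n)"
      using assms by (intro continuous_intros continuous_on_sin_powr) auto
    fix t :: real assume t: "t \<in> {0<..<pi}"
    then have s: "sin t > 0" by (auto intro: sin_gt_zero)
    have half: "4 * S * (1 - S) / 2 = S * (2 * (1 - S))" for S :: real by simp
    have alg: "(1 + e) * E * (1 - 2 * S) * P + E * (real n * P) * (2 * (1 - S)) =
      (1 + e + 2 * real n) * (E * P) - (2 + 2 * e + 2 * real n) * (E * (S * P))" for E S P :: real
      by (simp add: algebra_simps)
    have e1: "sin t powr (1 + e) = sin t powr e * sin t"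
      using s by (simp add: powr_add)
    have s2: "sin t * sin t = 4 * ?s t * (1 - ?s t)"
      proof -
      have "4 * ?s t * (1 - ?s t) = 1 - (cos t)\<^sup>2" by (simp add: field_simps power2_eq_square)
      then show ?thesis using sin_squared_eq[of t] by (simp only: power2_eq_square)
    qed
    \<comment> \<open>For \<open>n = 0\<close> the exponent \<open>n - 1\<close> is truncated; the
      factor \<open>real n\<close> makes both sides vanish there.\<close>
    have "real n * x ^ (n - 1) * x = real n * x ^ n" for x :: real
      by (cases n) auto
    then have pw: "real n * ?s t ^ (n - 1) * ?s t = real n * ?s t ^ n" .
    have "((\<lambda>t. sin t powr (1 + e) * ?s t ^ n) has_real_derivative
        ((1 + e) * sin t powr e * cos t * ?s t ^ n + sin t powr (1 + e) * (real n * ?s t ^ (n - 1) * (sin t / 2)))) (at t)"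
    proof -
      have d1: "((\<lambda>t. sin t powr (1 + e)) has_real_derivative (1 + e) * sin t powr e * cos t) (at t)"
        using s by (auto intro!: derivative_eq_intros)
      have "(?s has_real_derivative sin t / 2) (at t)"
        by (auto intro!: derivative_eq_intros)
      from DERIV_power[OF this, of n]
      have d2: "((\<lambda>t. ?s t ^ n) has_real_derivative real n * ?s t ^ (n - 1) * (sin t / 2)) (at t)"
        by (simp only: One_nat_def mult_ac)
      show ?thesis using DERIV_mult'[OF d1 d2] by (simp only: add.commute)
    qed
    also have "(1 + e) * sin t powr e * cos t * ?s t ^ n + sin t powr (1 + e) * (real n * ?s t ^ (n - 1) * (sin t / 2))
      = (1 + e) * sin t powr e * (1 - 2 * ?s t) * ?s t ^ n + sin t powr e * (real n * ?s t ^ (n - 1)) * ((sin t * sin t) / 2)"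
      unfolding e1 by (simp add: field_simps)
    also have "\<dots> = (1 + e) * sin t powr e * (1 - 2 * ?s t) * ?s t ^ n + sin t powr e * (real n * ?s t ^ (n - 1) * ?s t) * (2 * (1 - ?s t))"
    proof -
      have "(sin t * sin t) / 2 = ?s t * (2 * (1 - ?s t))" unfolding s2 by (rule half)
      then show ?thesis by (simp only: mult_ac)
    qed
    also have "\<dots> = ?f t"
      unfolding pw power_Suc by (rule alg)
    finally show "((\<lambda>t. sin t powr (1 + e) * ?s t ^ n) has_vector_derivative ?f t) (at t)"
      by (simp add: has_real_derivative_iff_has_vector_derivative)
  qed auto
  then have "(?f has_integral 0) {0..pi}" by simp
  moreover have "(?f has_integral ((1 + e + 2 * real n) * sin_moment e n - (2 + 2 * e + 2 * real n) * sin_moment e (Suc n))) {0..pi}"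
    unfolding sin_moment_def
    by (intro has_integral_diff has_integral_mult_right integrable_integral sin_moment_integrable assms)
  ultimately have "0 = (1 + e + 2 * real n) * sin_moment e n - (2 + 2 * e + 2 * real n) * sin_moment e (Suc n)"
    by (rule has_integral_unique)
  then show ?thesis by linarith
qed

lemma sin_moment_0_pos:
  assumes "0 < e" shows "0 < sin_moment e 0"
proof -
  have "integral {0..pi} (\<lambda>t. sin t powr e) \<noteq> 0"
  proof
    assume "integral {0..pi} (\<lambda>t. sin t powr e) = 0"
    then have "\<forall>t\<in>{0..pi}. sin t powr e = 0"
      using integral_eq_0_iff[OF continuous_on_sin_powr[OF assms]] by simp
    then have "sin (pi / 2) powr e = 0" by (rule bspec) auto
    then show False by simp
  qed
  moreover have "integral {0..pi} (\<lambda>t. sin t powr e) \<ge> 0"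
    by (intro integral_nonneg integrable_continuous_real continuous_on_sin_powr assms) auto
  ultimately show ?thesis by (simp add: sin_moment_def)
qed

text \<open>The recurrence is that of a quotient of Pochhammer symbols: the moments supply the
  factor \<open>(b)_n / (c)_n\<close> of the Gauss coefficients with \<open>b = (1 + e) / 2\<close>
  and \<open>c = 1 + e\<close>. This is a Beta integral evaluated up to its value at
  \<open>n = 0\<close>.\<close>

lemma sin_moment_eq:
  assumes "0 < e"
  shows "sin_moment e n = sin_moment e 0 * pochhammer ((1 + e) / 2) n / pochhammer (1 + e) n"
proof (induction n)
  case (Suc n)
  have p: "pochhammer (1 + e) n \<noteq> 0" "pochhammer (1 + e) (Suc n) \<noteq> 0"
    using assms pochhammer_pos[of "1 + e"] by (metis add_pos_pos less_irrefl zero_less_one)+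
  have "sin_moment e (Suc n) = ((1 + e) / 2 + n) / (1 + e + n) * sin_moment e n"
    using sin_moment_Suc[OF assms, of n] assms by (simp add: field_simps)
  then show ?case using Suc p assms by (simp add: pochhammer_rec' field_simps)
qed simp

section \<open>The cut plane and the continuation of the Gauss series\<close>

abbreviation cut_plane :: "complex set" where
  "cut_plane \<equiv> - {u. Im u = 0 \<and> 1 \<le> Re u}"

text \<open>Keeps the base of the power in the Euler integral off the branch cut of the principal
  power. The same fact shows that the cut plane is star-shaped about 0, hence connected.\<close>

lemma cut_plane_affine:
  assumes "z \<in> cut_plane" "0 \<le> s" "s \<le> 1"
  shows "1 - z * of_real s \<notin> \<real>\<^sub>\<le>\<^sub>0"
proof
  assume "1 - z * of_real s \<in> \<real>\<^sub>\<le>\<^sub>0"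
  then have *: "Re z * s \<ge> 1" "Im z * s = 0" by (auto simp: complex_nonpos_Reals_iff)
  then have "s > 0" using assms(2) by (cases "s = 0") auto
  then have "Im z = 0" using * by auto
  moreover have "Re z \<ge> 1"
  proof (rule ccontr)
    assume "\<not> 1 \<le> Re z"
    then have "Re z * s < 1 * s" using \<open>s > 0\<close> by (intro mult_strict_right_mono) auto
    then show False using * assms by auto
  qed
  ultimately show False using assms(1) by auto
qed

lemma open_cut_plane: "open cut_plane"
proof -
  have "closed {u. Im u = 0 \<and> 1 \<le> Re u}"
    by (intro closed_Collect_conj closed_Collect_eq closed_Collect_le continuous_intros)
  then show ?thesis by auto
qed

lemma connected_cut_plane: "connected cut_plane"
proof (rule starlike_imp_connected)
  have "closed_segment 0 z \<subseteq> cut_plane" if z: "z \<in> cut_plane" for z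
  proof
    fix w assume "w \<in> closed_segment 0 z"
    then obtain s where s: "0 \<le> s" "s \<le> 1" "w = of_real s * z"
      by (auto simp: closed_segment_def scaleR_conv_of_real)
    from cut_plane_affine[OF z s(1,2)] s show "w \<in> cut_plane"
      by (auto simp: complex_nonpos_Reals_iff mult.commute)
  qed
  then show "starlike cut_plane" unfolding starlike_def by (intro bexI[of _ 0]) auto
qed

text \<open>Up to a constant, Euler's integral for \<open>F(a, b; c; z)\<close> in the case
  \<open>c = 2 * b\<close>, with \<open>s = (1 - cos t) / 2\<close> substituted. The weight
  \<open>(s * (1 - s)) powr ((e - 1) / 2)\<close>, singular at both ends for \<open>e < 1\<close>,
  becomes the continuous weight \<open>sin t powr e\<close>.\<close>

definition euler_int :: "real \<Rightarrow> complex \<Rightarrow> complex" where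
  "euler_int e z = integral {0..pi} (\<lambda>t. of_real (sin t powr e) *
     (1 - z * of_real ((1 - cos t) / 2)) powr (- of_real (1 + e / 2)))"

lemma half_1_minus_cos: "0 \<le> (1 - cos t) / 2" "(1 - cos t) / 2 \<le> (1::real)"
  using cos_ge_minus_one[of t] cos_le_one[of t] by auto

lemma continuous_on_powr_const:
  fixes f :: "'a::topological_space \<Rightarrow> complex"
  assumes "continuous_on A f" "\<And>x. x \<in> A \<Longrightarrow> f x \<notin> \<real>\<^sub>\<le>\<^sub>0"
  shows "continuous_on A (\<lambda>x. f x powr c)"
proof -
  have "continuous_on A (\<lambda>x. exp (c * Ln (f x)))"
    using assms by (intro continuous_intros) auto
  moreover have "f x \<noteq> 0" if "x \<in> A" for x using assms(2)[OF that] by auto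
  ultimately show ?thesis by (simp add: powr_def cong: continuous_on_cong)
qed

lemma holomorphic_euler_int:
  assumes "0 < e" shows "euler_int e holomorphic_on cut_plane"
proof -
  define S where "S = (\<lambda>t::real. complex_of_real ((1 - cos t) / 2))"
  have S: "continuous_on A S" for A unfolding S_def by (intro continuous_intros) auto
  note [continuous_intros] = continuous_on_compose2[OF S[of UNIV]]
  let ?a = "- complex_of_real (1 + e / 2)"
  have sp: "continuous_on {0..pi} (\<lambda>t. complex_of_real (sin t powr e))"
    by (intro continuous_intros continuous_on_sin_powr assms)
  \<comment> \<open>Differentiation under the integral is carried out on a convex domain. The cut
    plane is not convex, but holomorphy is local, so small discs suffice.\<close>
  have "\<exists>B. z \<in> B \<and> open B \<and> euler_int e holomorphic_on B" if z: "z \<in> cut_plane" for z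
  proof -
    obtain d where d: "d > 0" "ball z d \<subseteq> cut_plane"
      using open_cut_plane z openE by blast
    have nn: "1 - w * S t \<notin> \<real>\<^sub>\<le>\<^sub>0" if "w \<in> ball z d" for w t
      using that d half_1_minus_cos[of t] unfolding S_def by (intro cut_plane_affine) auto
    have hol: "(\<lambda>w. integral (cbox 0 pi) (\<lambda>t. of_real (sin t powr e) * (1 - w * S t) powr ?a)) holomorphic_on ball z d"
    proof (rule leibniz_rule_holomorphic)
      fix w t assume w: "w \<in> ball z d" "t \<in> cbox 0 pi"
      show "((\<lambda>w. of_real (sin t powr e) * (1 - w * S t) powr ?a) has_field_derivative
         of_real (sin t powr e) * (?a * (1 - w * S t) powr (?a - 1) * (- S t))) (at w within ball z d)"
        using nn[OF w(1), of t] by (auto intro!: derivative_eq_intros)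
    next
      fix w assume w: "w \<in> ball z d"
      show "(\<lambda>t. of_real (sin t powr e) * (1 - w * S t) powr ?a) integrable_on cbox 0 pi"
        unfolding cbox_interval using nn[OF w]
        by (intro integrable_continuous_real continuous_on_mult[OF sp] continuous_on_powr_const continuous_intros) auto
    next
      have "continuous_on (ball z d \<times> {0..pi}) (\<lambda>x. complex_of_real (sin (snd x) powr e))"
        by (rule continuous_on_compose2[OF sp]) (auto intro!: continuous_intros)
      note * = continuous_on_mult[OF this]
      show "continuous_on (ball z d \<times> cbox 0 pi)
        (\<lambda>(w, t). of_real (sin t powr e) * (?a * (1 - w * S t) powr (?a - 1) * (- S t)))"
        unfolding cbox_interval split_beta
        by (rule *, intro continuous_on_powr_const continuous_intros) (use nn in auto)
    qed auto
    have eq: "euler_int e = (\<lambda>w. integral (cbox 0 pi) (\<lambda>t. of_real (sin t powr e) * (1 - w * S t) powr ?a))"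
      by (rule ext) (simp only: euler_int_def S_def cbox_interval)
    have "euler_int e holomorphic_on ball z d" unfolding eq by (rule hol)
    with d show ?thesis by (intro exI[of _ "ball z d"] conjI) auto
  qed
  then have "euler_int e analytic_on {z}" if "z \<in> cut_plane" for z
    using that unfolding analytic_at by blast
  then have "euler_int e analytic_on cut_plane"
    by (subst analytic_on_analytic_at) blast
  then show ?thesis by (rule analytic_imp_holomorphic)
qed

text \<open>The binomial series is integrated term by term, which produces the moments. Since
  \<open>sin t powr e\<close> and \<open>(1 - cos t) / 2\<close> lie between 0 and 1, the absolutely
  convergent binomial series at \<open>z\<close> itself is a majorant uniform in
  \<open>t\<close>.\<close>

lemma euler_int_series:
  assumes "0 < e" "norm z < 1"
  shows "euler_int e z = of_real (sin_moment e 0) *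
    eval_fps (fps_hypergeo [of_real (1 + e / 2), of_real ((1 + e) / 2)] [of_real (1 + e)] 1) z"
proof -
  let ?s = "\<lambda>t::real. (1 - cos t) / 2"
  let ?a = "complex_of_real (1 + e / 2)"
  let ?c = "\<lambda>n. pochhammer ?a n / fact n"
  let ?f = "\<lambda>n t. complex_of_real (sin t powr e) * (?c n * (z * of_real (?s t)) ^ n)"
  have sums: "(\<lambda>n. ?c n * w ^ n) sums (1 - w) powr (- ?a)" if "norm w < 1" for w
  proof -
    have "((- ?a) gchoose n) * (- w) ^ n = ?c n * w ^ n" for n
    proof -
      have "((- ?a) gchoose n) * (- w) ^ n = ((- 1) ^ n * (- 1) ^ n) * (?c n * w ^ n)"
        by (simp only: gbinomial_pochhammer power_minus[of w] minus_minus) (simp add: mult_ac)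
      also have "(- 1) ^ n * (- 1) ^ n = (1 :: complex)"
        by (simp flip: power_mult_distrib)
      finally show ?thesis by simp
    qed
    then show ?thesis using gen_binomial_complex[of "- w" "- ?a"] that by simp
  qed
  have lt: "norm (z * of_real (?s t)) \<le> norm z" for t
    using half_1_minus_cos[of t] by (simp only: norm_mult norm_of_real abs_of_nonneg) (intro mult_left_le, auto)
  \<comment> \<open>Convergence at a real point farther out gives absolute convergence at
    \<open>z\<close>.\<close>
  obtain x where x: "norm z < x" "x < 1" using assms(2) dense by blast
  have summ: "summable (\<lambda>n. norm (?c n * z ^ n))"
  proof (rule powser_insidea)
    show "summable (\<lambda>n. ?c n * of_real x ^ n)"
      using x le_less_trans[OF norm_ge_zero x(1)] by (intro sums_summable[OF sums]) auto
    show "norm z < norm (complex_of_real x)"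
      using x by (auto intro: less_le_trans)
  qed
  have ul: "uniform_limit {0..pi} (\<lambda>n t. \<Sum>i<n. ?f i t) (\<lambda>t. \<Sum>i. ?f i t) sequentially"
  proof (rule Weierstrass_m_test)
    fix n t assume "t \<in> {0..pi}"
    have "\<bar>sin t powr e\<bar> \<le> 1 powr e" using assms \<open>t \<in> {0..pi}\<close>
      by (simp, intro powr_le1) (auto simp: sin_ge_zero)
    moreover have "norm (?c n * (z * of_real (?s t)) ^ n) \<le> norm (?c n * z ^ n)"
      unfolding norm_mult norm_power using lt[of t]
      by (intro mult_left_mono power_mono) (auto simp: norm_mult)
    ultimately show "norm (?f n t) \<le> norm (?c n * z ^ n)"
      by (subst norm_mult) (auto intro!: mult_left_le_one_le order_trans[OF mult_left_le_one_le])
  qed (use summ in auto)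
  have sp: "continuous_on {0..pi} (\<lambda>t. complex_of_real (sin t powr e))"
    by (intro continuous_intros continuous_on_sin_powr assms)
  obtain I J where I: "\<And>n. ((\<lambda>t. \<Sum>i<n. ?f i t) has_integral I n) {0..pi}"
    and J: "((\<lambda>t. \<Sum>i. ?f i t) has_integral J) {0..pi}" and IJ: "I \<longlonglongrightarrow> J"
    by (rule uniform_limit_integral[OF ul]) (auto intro!: continuous_intros sp)
  have eq: "(\<Sum>i. ?f i t) = of_real (sin t powr e) * (1 - z * of_real (?s t)) powr (- ?a)" for t
    using sums_mult[OF sums[of "z * of_real (?s t)"], of "of_real (sin t powr e)"] lt[of t] assms(2)
    by (auto simp: sums_iff)
  have JE: "J = euler_int e z"
    using J unfolding eq euler_int_def by (rule integral_unique[symmetric])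
  have In: "I n = (\<Sum>i<n. ?c i * z ^ i * of_real (sin_moment e i))" for n
  proof -
    have "((\<lambda>t. \<Sum>i<n. ?c i * z ^ i * of_real (sin t powr e * ?s t ^ i)) has_integral
      (\<Sum>i<n. ?c i * z ^ i * of_real (sin_moment e i))) {0..pi}"
      unfolding sin_moment_def
      by (intro has_integral_sum has_integral_mult_right has_integral_of_real integrable_integral
          sin_moment_integrable assms) auto
    moreover have "(\<Sum>i<n. ?c i * z ^ i * of_real (sin t powr e * ?s t ^ i)) = (\<Sum>i<n. ?f i t)" for t
      by (simp only: of_real_mult of_real_power power_mult_distrib mult_ac)
    ultimately show ?thesis using I[of n] by (simp only: has_integral_unique)
  qed
  have J_sums: "(\<lambda>i. ?c i * z ^ i * of_real (sin_moment e i)) sums J"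
    using IJ unfolding In sums_def .
  have nth: "fps_nth (fps_hypergeo [A, B] [C] 1) i = pochhammer A i * pochhammer B i / (pochhammer C i * fact i)" for A B C :: complex and i
    by simp
  have sm: "complex_of_real (sin_moment e i) = of_real (sin_moment e 0) *
    pochhammer (of_real ((1 + e) / 2)) i / pochhammer (of_real (1 + e)) i" for i
    unfolding pochhammer_of_real by (subst sin_moment_eq[OF assms(1)]) (simp only: of_real_mult of_real_divide)
  have eq2: "?c i * z ^ i * of_real (sin_moment e i) = of_real (sin_moment e 0) *
     (fps_nth (fps_hypergeo [?a, of_real ((1 + e) / 2)] [of_real (1 + e)] 1) i * z ^ i)" for i
    unfolding nth by (subst sm) (simp only: times_divide_eq_left times_divide_eq_right divide_divide_eq_left mult_ac)
  have "(\<lambda>i. of_real (sin_moment e 0) *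
     (fps_nth (fps_hypergeo [?a, of_real ((1 + e) / 2)] [of_real (1 + e)] 1) i * z ^ i)) sums J"
    using J_sums unfolding eq2 .
  then have "J / of_real (sin_moment e 0) = eval_fps (fps_hypergeo [?a, of_real ((1 + e) / 2)] [of_real (1 + e)] 1) z"
    using sin_moment_0_pos[OF assms(1)] unfolding eval_fps_def
    by (drule_tac c = "complex_of_real (sin_moment e 0)" in sums_divide)
       (simp add: sums_iff del: fps_hypergeo_nth of_real_add of_real_divide)
  then show ?thesis unfolding JE[symmetric] using sin_moment_0_pos[OF assms(1)]
    by (simp add: field_simps del: fps_hypergeo_nth of_real_add of_real_divide)
qed

text \<open>Existence for the description is the holomorphic Euler integral, divided by its value at
  0; uniqueness is the identity theorem, applied from the unit disc to the connected cut
  plane.\<close>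

lemma hypergeo_F_eq_euler_int:
  assumes "0 < e" "z \<in> cut_plane"
  shows "hypergeo_F (of_real (1 + e / 2)) (of_real ((1 + e) / 2)) (of_real (1 + e)) z =
    euler_int e z / of_real (sin_moment e 0)"
proof -
  let ?S = "eval_fps (fps_hypergeo [of_real (1 + e / 2), of_real ((1 + e) / 2)] [of_real (1 + e)] 1)"
  let ?g = "\<lambda>z. euler_int e z / of_real (sin_moment e 0)"
  have g: "?g holomorphic_on cut_plane"
    using sin_moment_0_pos[OF assms(1)] by (intro holomorphic_intros holomorphic_euler_int assms) auto
  have gS: "?g u = ?S u" if "norm u < 1" for u
    using euler_int_series[OF assms(1) that] sin_moment_0_pos[OF assms(1)] by simp
  show ?thesis unfolding hypergeo_F_def
  proof (rule the_equality)
    show "\<exists>f. f holomorphic_on cut_plane \<and> (\<forall>u. norm u < 1 \<longrightarrow> f u = ?S u) \<and> ?g z = f z"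
      using g gS by (intro exI[of _ ?g]) auto
  next
    fix w assume "\<exists>f. f holomorphic_on cut_plane \<and> (\<forall>u. norm u < 1 \<longrightarrow> f u = ?S u) \<and> w = f z"
    then obtain f where f: "f holomorphic_on cut_plane" "\<And>u. norm u < 1 \<Longrightarrow> f u = ?S u" "w = f z"
      by auto
    have sub: "ball 0 1 \<subseteq> cut_plane" using complex_Re_le_cmod le_less_trans by (fastforce simp: )
    have "f z = ?g z"
      by (rule analytic_continuation_open[of "ball 0 1" cut_plane])
         (use f g gS sub open_cut_plane connected_cut_plane assms in auto)
    then show "w = ?g z" using f by simp
  qed
qed

lemma Re_hypergeo_F:
  assumes "0 < e" "x \<le> 0"
  shows "Re (hypergeo_F (of_real (1 + e / 2)) (of_real ((1 + e) / 2)) (of_real (1 + e)) (of_real x)) =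
    integral {0..pi} (\<lambda>t. sin t powr e * (1 - x * ((1 - cos t) / 2)) powr (- (1 + e / 2))) / sin_moment e 0"
proof -
  let ?f = "\<lambda>t. sin t powr e * (1 - x * ((1 - cos t) / 2)) powr (- (1 + e / 2))"
  have p: "1 - x * ((1 - cos t) / 2) > 0" for t
    using assms half_1_minus_cos[of t] mult_nonpos_nonneg[of x "(1 - cos t) / 2"] by linarith
  have "?f integrable_on {0..pi}"
    using less_imp_neq[OF p, symmetric]
    by (intro integrable_continuous_real continuous_on_mult[OF continuous_on_sin_powr[OF assms(1)]]
        continuous_intros) auto
  then have "((\<lambda>t. complex_of_real (?f t)) has_integral of_real (integral {0..pi} ?f)) {0..pi}"
    by (intro has_integral_of_real integrable_integral)
  moreover have "complex_of_real (?f t) = of_real (sin t powr e) * (1 - of_real x * of_real ((1 - cos t) / 2)) powr (- of_real (1 + e / 2))" for t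
  proof -
    have "(1 - of_real x * of_real ((1 - cos t) / 2)) powr (- of_real (1 + e / 2)) = complex_of_real (1 - x * ((1 - cos t) / 2)) powr (of_real (- (1 + e / 2)))"
      by simp
    also have "\<dots> = of_real ((1 - x * ((1 - cos t) / 2)) powr (- (1 + e / 2)))"
      using p[of t] by (intro powr_of_real) auto
    finally show ?thesis by simp
  qed
  ultimately have "euler_int e (of_real x) = of_real (integral {0..pi} ?f)"
    unfolding euler_int_def by (simp only: integral_unique)
  then show ?thesis using assms by (subst hypergeo_F_eq_euler_int) auto
qed

section \<open>Pfaff transformation and the limit value at infinity\<close>

lemma convex_comb_pos:
  fixes K t :: real
  assumes "0 < K"
  shows "0 < (cos t)\<^sup>2 + K * (sin t)\<^sup>2"
proof (cases "sin t = 0")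
  case True
  then have "(cos t)\<^sup>2 = 1" using sin_cos_squared_add[of t] by simp
  then show ?thesis using True by simp
next
  case False
  then show ?thesis using assms by (simp add: add_nonneg_pos)
qed

text \<open>The substitution is \<open>tan (u / 2) = k * tan t\<close>; writing it as \<open>u = arccos (y t)\<close> keeps it continuous at \<open>pi / 2\<close>.\<close>

lemma pfaff_substitution:
  assumes k: "0 < k" and f: "continuous_on {0..pi} f"
  defines "y \<equiv> \<lambda>t. ((cos t)\<^sup>2 - k\<^sup>2 * (sin t)\<^sup>2) / ((cos t)\<^sup>2 + k\<^sup>2 * (sin t)\<^sup>2)"
  shows "((\<lambda>t. 2 * k / ((cos t)\<^sup>2 + k\<^sup>2 * (sin t)\<^sup>2) * f (arccos (y t))) has_integral integral {0..pi} f) {0..pi/2}"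
proof -
  define D where "D = (\<lambda>t. (cos t)\<^sup>2 + k\<^sup>2 * (sin t)\<^sup>2)"
  have D: "D t > 0" for t using convex_comb_pos[of "k\<^sup>2" t] k by (simp add: D_def)
  have y_bounds: "-1 \<le> y t" "y t \<le> 1" for t
    using D[of t] by (auto simp: y_def D_def field_simps)
  have y: "y t = ((cos t)\<^sup>2 - k\<^sup>2 * (sin t)\<^sup>2) / D t" for t by (simp add: y_def D_def)
  have D0: "(cos t)\<^sup>2 + k\<^sup>2 * (sin t)\<^sup>2 \<noteq> 0" for t using D[of t] by (simp add: D_def)
  have contg: "continuous_on {0..pi/2} (\<lambda>t. arccos (y t))"
  proof (intro continuous_on_arccos)
    show "continuous_on {0..pi/2} y" unfolding y_def using D0 by (intro continuous_intros) auto
  qed (use y_bounds in auto)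
  \<comment> \<open>The end points are exceptional: there \<open>y t\<close> is 1 or -1, where
    \<open>arccos\<close> is continuous but not differentiable.\<close>
  have "((\<lambda>t. (2 * k / D t) *\<^sub>R f (arccos (y t))) has_integral integral {arccos (y 0)..arccos (y (pi/2))} f) {0..pi/2}"
  proof (rule has_integral_substitution_strong[where s = "{0, pi/2}" and c = 0 and d = pi])
    show "(\<lambda>t. arccos (y t)) ` {0..pi/2} \<subseteq> {0..pi}"
      using arccos_lbound[OF y_bounds] arccos_ubound[OF y_bounds] by auto
    show "arccos (y 0) \<le> arccos (y (pi / 2))" using k by (simp add: y_def)
    fix t assume "t \<in> {0..pi/2} - {0, pi/2}"
    then have t: "0 < t" "t < pi/2" by auto
    then have sc: "sin t > 0" "cos t > 0" by (auto intro: sin_gt_zero2 cos_gt_zero)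
    define c s where "c = cos t" "s = sin t"
    have cs: "c\<^sup>2 + s\<^sup>2 = 1" "c > 0" "s > 0" using sc by (auto simp: c_s_def)
    have Dt: "D t = c\<^sup>2 + k\<^sup>2 * s\<^sup>2" by (simp add: D_def c_s_def)
    have yt: "y t = (c\<^sup>2 - k\<^sup>2 * s\<^sup>2) / D t" by (simp add: y c_s_def)
    have y1: "1 - (y t)\<^sup>2 = (2 * k * s * c / D t)\<^sup>2"
      using D[of t] unfolding yt by (simp add: field_simps power2_eq_square) (simp add: Dt power2_eq_square algebra_simps)
    have sq: "sqrt (1 - (y t)\<^sup>2) = 2 * k * s * c / D t"
      unfolding y1 using k cs D[of t] by simp
    have "0 < 2 * k * s * c / D t" using k cs D[of t] by simp
    then have "(y t)\<^sup>2 < 1" using y1 by (metis diff_gt_0_iff_gt zero_less_power)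
    then have ylt: "-1 < y t" "y t < 1" by (auto simp: abs_square_less_1)
    have "(y has_real_derivative ((- 2 * c * s - 2 * k\<^sup>2 * s * c) * D t - (c\<^sup>2 - k\<^sup>2 * s\<^sup>2) * (- 2 * c * s + 2 * k\<^sup>2 * s * c)) / (D t)\<^sup>2) (at t)"
      unfolding y_def Dt c_s_def
      by (rule derivative_eq_intros refl | (use D0 in force))+ (simp add: power2_eq_square algebra_simps)
    also have "(- 2 * c * s - 2 * k\<^sup>2 * s * c) * D t - (c\<^sup>2 - k\<^sup>2 * s\<^sup>2) * (- 2 * c * s + 2 * k\<^sup>2 * s * c)
       = - 4 * k\<^sup>2 * s * c * (c\<^sup>2 + s\<^sup>2)"
      unfolding Dt by (simp add: power2_eq_square algebra_simps)
    finally have dy: "(y has_real_derivative (- 4 * k\<^sup>2 * s * c) / (D t)\<^sup>2) (at t)" using cs by simp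
    have "((\<lambda>t. arccos (y t)) has_real_derivative inverse (- sqrt (1 - (y t)\<^sup>2)) * ((- 4 * k\<^sup>2 * s * c) / (D t)\<^sup>2)) (at t)"
      by (rule DERIV_chain2[OF DERIV_arccos[OF ylt] dy])
    also have "inverse (- sqrt (1 - (y t)\<^sup>2)) * ((- 4 * k\<^sup>2 * s * c) / (D t)\<^sup>2) = 2 * k / D t"
      unfolding sq using k cs D[of t] by (simp add: field_simps power2_eq_square)
    finally show "((\<lambda>t. arccos (y t)) has_real_derivative 2 * k / D t) (at t within {0..pi/2})"
      by (rule has_field_derivative_at_within)
  qed (use f contg in auto)
  moreover have "arccos (y 0) = 0" "arccos (y (pi/2)) = pi" using k by (auto simp: y_def)
  ultimately show ?thesis by (simp add: D_def)
qed

text \<open>Up to the factor \<open>2 powr (- 1 - e) * sin_moment e 0\<close> this is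
  \<open>F(e / 2, (1 + e) / 2; 1 + e; 1 - K)\<close>. The excess \<open>c - a - b\<close> equals
  1/2, so the value stays bounded as \<open>K\<close> tends to 0; for the derivative the excess is
  -1/2, whence its growth like \<open>1 / sqrt K\<close>.\<close>

definition pfaff_int :: "real \<Rightarrow> real \<Rightarrow> real" where
  "pfaff_int e K = integral {0..pi/2} (\<lambda>t. (sin t * cos t) powr e * ((cos t)\<^sup>2 + K * (sin t)\<^sup>2) powr (- (e / 2)))"

definition pfaff_deriv :: "real \<Rightarrow> real \<Rightarrow> real" where
  "pfaff_deriv e K = integral {0..pi/2} (\<lambda>t. (sin t * cos t) powr e *
     (- (e / 2) * ((cos t)\<^sup>2 + K * (sin t)\<^sup>2) powr (- (e / 2) - 1) * (sin t)\<^sup>2))"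

lemma sin_cos_quarter: "t \<in> {0..pi/2} \<Longrightarrow> 0 \<le> sin t" "t \<in> {0..pi/2} \<Longrightarrow> 0 \<le> cos t"
  by (auto intro: sin_ge_zero cos_ge_zero)

text \<open>The substitution turns the linear factor of the Euler integral into
  \<open>1 / D t\<close>. The powers of \<open>D t\<close> then combine to the exponent
  \<open>- (e / 2)\<close>, and the powers of \<open>2 * k\<close> leave the integral.\<close>

lemma Re_hypergeo_F_pfaff:
  assumes e: "0 < e" and k: "0 < k" "k \<le> 1"
  shows "Re (hypergeo_F (of_real (1 + e / 2)) (of_real ((1 + e) / 2)) (of_real (1 + e)) (of_real (1 - 1 / k\<^sup>2))) =
    (2 * k) powr (1 + e) * pfaff_int e (k\<^sup>2) / sin_moment e 0"
proof -
  define x where "x = 1 - 1 / k\<^sup>2"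
  have "k\<^sup>2 \<le> 1" using k by (simp add: power_le_one)
  then have x: "x \<le> 0" using k by (simp add: x_def field_simps)
  define f where "f = (\<lambda>t. sin t powr e * (1 - x * ((1 - cos t) / 2)) powr (- (1 + e / 2)))"
  have p: "1 - x * ((1 - cos t) / 2) > 0" for t
    using x half_1_minus_cos[of t] mult_nonpos_nonneg[of x "(1 - cos t) / 2"] by linarith
  have f: "continuous_on {0..pi} f"
    unfolding f_def using less_imp_neq[OF p, symmetric]
    by (intro continuous_on_mult[OF continuous_on_sin_powr[OF e]] continuous_intros) auto
  define D where "D = (\<lambda>t. (cos t)\<^sup>2 + k\<^sup>2 * (sin t)\<^sup>2)"
  have D: "D t > 0" for t using convex_comb_pos[of "k\<^sup>2" t] k by (simp add: D_def)
  define y where "y = (\<lambda>t. ((cos t)\<^sup>2 - k\<^sup>2 * (sin t)\<^sup>2) / D t)"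
  have "((\<lambda>t. 2 * k / D t * f (arccos (y t))) has_integral integral {0..pi} f) {0..pi/2}"
    using pfaff_substitution[OF k(1) f] unfolding y_def D_def .
  moreover have "2 * k / D t * f (arccos (y t)) = (2 * k) powr (1 + e) * ((sin t * cos t) powr e * D t powr (- (e / 2)))"
    if t: "t \<in> {0..pi/2}" for t
  proof -
    define c s where "c = cos t" "s = sin t"
    have cs: "c\<^sup>2 + s\<^sup>2 = 1" "c \<ge> 0" "s \<ge> 0" using sin_cos_quarter[OF t] by (auto simp: c_s_def)
    have Dt: "D t = c\<^sup>2 + k\<^sup>2 * s\<^sup>2" by (simp add: D_def c_s_def)
    have yt: "y t = (c\<^sup>2 - k\<^sup>2 * s\<^sup>2) / D t" by (simp add: y_def c_s_def)
    have yb: "-1 \<le> y t" "y t \<le> 1" using D[of t] unfolding yt by (auto simp: Dt field_simps)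
    have y1: "1 - (y t)\<^sup>2 = (2 * k * s * c / D t)\<^sup>2"
      using D[of t] unfolding yt by (simp add: field_simps power2_eq_square) (simp add: Dt power2_eq_square algebra_simps)
    have sq: "sin (arccos (y t)) = 2 * k * s * c / D t"
      using yb k cs D[of t] by (simp add: sin_arccos y1)
    \<comment> \<open>The choice \<open>x = 1 - 1 / k^2\<close> makes the numerator collapse to
      \<open>c^2 + s^2 = 1\<close>.\<close>
    have "1 - x * ((1 - y t) / 2) = 1 / D t"
    proof -
      have xk: "x * k\<^sup>2 = k\<^sup>2 - 1" using k by (simp add: x_def field_simps)
      have half: "(1 - y t) / 2 = k\<^sup>2 * s\<^sup>2 / D t" using D[of t] unfolding yt by (simp add: field_simps) (simp add: Dt algebra_simps)
      have "1 - x * ((1 - y t) / 2) = 1 - (x * k\<^sup>2) * s\<^sup>2 / D t" unfolding half by simp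
      also have "\<dots> = (D t - (k\<^sup>2 - 1) * s\<^sup>2) / D t"
        unfolding xk using D[of t] by (simp add: field_simps)
      also have "D t - (k\<^sup>2 - 1) * s\<^sup>2 = c\<^sup>2 + s\<^sup>2" by (simp add: Dt algebra_simps)
      finally show ?thesis using cs by (simp only: cs)
    qed
    then have "f (arccos (y t)) = (2 * k * s * c / D t) powr e * (1 / D t) powr (- (1 + e / 2))"
      unfolding f_def using yb sq by simp
    also have "(2 * k * s * c / D t) powr e = (2 * k) powr e * (s * c) powr e * D t powr (- e)"
      using k cs D[of t] by (simp add: powr_divide powr_mult powr_minus field_simps)
    also have "(1 / D t) powr (- (1 + e / 2)) = D t powr (1 + e / 2)"
      using D[of t] by (simp add: powr_divide powr_minus field_simps)
    finally have "2 * k / D t * f (arccos (y t)) =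
      (2 * k powr 1 * (2 * k) powr e) * (s * c) powr e * (D t powr (- 1) * D t powr (- e) * D t powr (1 + e / 2))"
      using D[of t] k by (simp add: powr_minus field_simps)
    also have "D t powr (- 1) * D t powr (- e) * D t powr (1 + e / 2) = D t powr (- (e / 2))"
      by (simp only: powr_add[symmetric]) (simp add: field_simps)
    also have "2 * k powr 1 * (2 * k) powr e = (2 * k) powr (1 + e)"
      using k by (simp add: powr_add)
    finally show ?thesis by (simp add: c_s_def mult_ac)
  qed
  ultimately have "((\<lambda>t. (2 * k) powr (1 + e) * ((sin t * cos t) powr e * D t powr (- (e / 2)))) has_integral integral {0..pi} f) {0..pi/2}"
    by (rule has_integral_eq[rotated])
  then have "integral {0..pi/2} (\<lambda>t. (2 * k) powr (1 + e) * ((sin t * cos t) powr e * D t powr (- (e / 2)))) = integral {0..pi} f"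
    by (rule integral_unique)
  then have "integral {0..pi} f = (2 * k) powr (1 + e) * pfaff_int e (k\<^sup>2)"
    by (simp add: pfaff_int_def D_def)
  then show ?thesis
    using Re_hypergeo_F[OF e x] unfolding f_def x_def by simp
qed

section \<open>Smoothness, bounds and limit of the Pfaff integral\<close>

lemma arctan_integral:
  assumes "0 < K"
  shows "((\<lambda>t. 1 / ((cos t)\<^sup>2 + K * (sin t)\<^sup>2)) has_integral pi / (2 * sqrt K)) {0..pi/2}"
proof -
  have k: "sqrt K > 0" "(sqrt K)\<^sup>2 = K" using assms by auto
  have "((\<lambda>t. 2 * sqrt K / ((cos t)\<^sup>2 + K * (sin t)\<^sup>2)) has_integral pi) {0..pi/2}"
    using pfaff_substitution[OF k(1), of "\<lambda>_. 1"] by (simp add: k(2))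
  from has_integral_mult_right[OF this, of "1 / (2 * sqrt K)"] show ?thesis using k by simp
qed

lemma continuous_on_sin_cos_powr:
  assumes "0 < e"
  shows "continuous_on {0..pi/2} (\<lambda>t. (sin t * cos t) powr e)"
  using assms by (intro continuous_on_powr' continuous_intros) (auto intro!: mult_nonneg_nonneg sin_cos_quarter)

lemma continuous_on_pfaff_kernel:
  assumes "0 < e"
  shows "continuous_on ({0<..} \<times> {0..pi/2}) (\<lambda>(K, t). (sin t * cos t) powr e * ((cos t)\<^sup>2 + K * (sin t)\<^sup>2) powr p)"
proof -
  have *: "continuous_on ({0<..} \<times> {0..pi/2}) (\<lambda>x::real\<times>real. (sin (snd x) * cos (snd x)) powr e)"
    by (rule continuous_on_compose2[OF continuous_on_sin_cos_powr[OF assms]]) (auto intro!: continuous_intros)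
  have "(cos t)\<^sup>2 + K * (sin t)\<^sup>2 \<noteq> 0" if "K > 0" for K t :: real
    using convex_comb_pos[OF that, of t] by simp
  then show ?thesis unfolding split_beta
    by (intro continuous_on_mult[OF *] continuous_intros) auto
qed

lemma continuous_on_pfaff_kernel_fixed:
  assumes "0 < e" "0 < K"
  shows "continuous_on {0..pi/2} (\<lambda>t. (sin t * cos t) powr e * ((cos t)\<^sup>2 + K * (sin t)\<^sup>2) powr p)"
  using less_imp_neq[OF convex_comb_pos[OF assms(2)], symmetric]
  by (intro continuous_on_mult[OF continuous_on_sin_cos_powr[OF assms(1)]] continuous_intros) auto

lemma pfaff_int_integrable:
  assumes "0 < e" "0 < K"
  shows "(\<lambda>t. (sin t * cos t) powr e * ((cos t)\<^sup>2 + K * (sin t)\<^sup>2) powr p) integrable_on {0..pi/2}"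
  by (intro integrable_continuous_real continuous_on_pfaff_kernel_fixed assms)

lemma pfaff_int_deriv:
  assumes e: "0 < e" and K: "0 < K"
  shows "(pfaff_int e has_real_derivative pfaff_deriv e K) (at K)"
proof -
  have "((\<lambda>K. integral (cbox 0 (pi/2)) (\<lambda>t. (sin t * cos t) powr e * ((cos t)\<^sup>2 + K * (sin t)\<^sup>2) powr (- (e / 2))))
    has_real_derivative integral (cbox 0 (pi/2)) (\<lambda>t. (sin t * cos t) powr e *
     (- (e / 2) * ((cos t)\<^sup>2 + K * (sin t)\<^sup>2) powr (- (e / 2) - 1) * (sin t)\<^sup>2))) (at K within {0<..})"
  proof (rule leibniz_rule_field_derivative)
    fix K t :: real assume "K \<in> {0<..}"
    then show "((\<lambda>K. (sin t * cos t) powr e * ((cos t)\<^sup>2 + K * (sin t)\<^sup>2) powr (- (e / 2))) has_real_derivative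
       (sin t * cos t) powr e * (- (e / 2) * ((cos t)\<^sup>2 + K * (sin t)\<^sup>2) powr (- (e / 2) - 1) * (sin t)\<^sup>2)) (at K within {0<..})"
      using convex_comb_pos[of K t] by (auto intro!: derivative_eq_intros)
  next
    fix K :: real assume "K \<in> {0<..}"
    then show "(\<lambda>t. (sin t * cos t) powr e * ((cos t)\<^sup>2 + K * (sin t)\<^sup>2) powr (- (e / 2))) integrable_on cbox 0 (pi/2)"
      using pfaff_int_integrable[OF e] by auto
  next
    have "continuous_on ({0<..} \<times> {0..pi/2}) (\<lambda>x. (case x of (K, t) \<Rightarrow> (sin t * cos t) powr e * ((cos t)\<^sup>2 + K * (sin t)\<^sup>2) powr (- (e / 2) - 1))
        * (- (e / 2) * (sin (snd x))\<^sup>2))"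
      by (intro continuous_on_mult[OF continuous_on_pfaff_kernel[OF e]] continuous_intros)
    then show "continuous_on ({0<..} \<times> cbox 0 (pi/2)) (\<lambda>(K, t). (sin t * cos t) powr e *
     (- (e / 2) * ((cos t)\<^sup>2 + K * (sin t)\<^sup>2) powr (- (e / 2) - 1) * (sin t)\<^sup>2))"
      by (simp add: split_beta mult_ac)
  qed (use K in auto)
  then show ?thesis
    using K unfolding pfaff_int_def[abs_def] pfaff_deriv_def
    by (simp add: at_within_open[of K "{0<..}"])
qed

lemma continuous_on_pfaff_int:
  assumes "0 < e" shows "continuous_on {0<..} (pfaff_int e)"
  using pfaff_int_deriv[OF assms] by (intro continuous_at_imp_continuous_on) (auto intro: DERIV_isCont)

lemma continuous_on_pfaff_deriv:
  assumes e: "0 < e" shows "continuous_on {0<..} (pfaff_deriv e)"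
proof -
  have "continuous_on ({0<..} \<times> {0..pi/2}) (\<lambda>x. (case x of (K, t) \<Rightarrow> (sin t * cos t) powr e * ((cos t)\<^sup>2 + K * (sin t)\<^sup>2) powr (- (e / 2) - 1))
        * (- (e / 2) * (sin (snd x))\<^sup>2))"
    by (intro continuous_on_mult[OF continuous_on_pfaff_kernel[OF e]] continuous_intros)
  then have "continuous_on ({0<..} \<times> cbox 0 (pi/2)) (\<lambda>(K, t). (sin t * cos t) powr e *
     (- (e / 2) * ((cos t)\<^sup>2 + K * (sin t)\<^sup>2) powr (- (e / 2) - 1) * (sin t)\<^sup>2))"
    by (simp add: split_beta mult_ac)
  from integral_continuous_on_param[OF this] show ?thesis
    unfolding pfaff_deriv_def[abs_def] by simp
qed

text \<open>The exponent of the base is negative, so \<open>K * (sin t)^2\<close> may be dropped;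
  what remains is \<open>cos t powr (- e)\<close>, which the weight cancels. The bound is uniform in
  \<open>K\<close> and therefore dominates the limit \<open>K\<close> to 0.\<close>

lemma pfaff_kernel_bound:
  assumes "0 < e" "0 < K" "t \<in> {0..pi/2}"
  shows "(sin t * cos t) powr e * ((cos t)\<^sup>2 + K * (sin t)\<^sup>2) powr (- (e / 2)) \<le> 1"
proof (cases "cos t = 0")
  case False
  then have c: "cos t > 0" using sin_cos_quarter[OF assms(3)] by simp
  have "((cos t)\<^sup>2 + K * (sin t)\<^sup>2) powr (- (e / 2)) \<le> ((cos t)\<^sup>2) powr (- (e / 2))"
    using assms c by (intro powr_mono2') auto
  also have "\<dots> = cos t powr (- e)" using c by (simp add: powr_powr flip: powr_numeral)
  finally have "(sin t * cos t) powr e * ((cos t)\<^sup>2 + K * (sin t)\<^sup>2) powr (- (e / 2)) \<le> (sin t powr e * cos t powr e) * cos t powr (- e)"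
    using sin_cos_quarter[OF assms(3)] by (intro mult_mono) (auto simp: powr_mult)
  also have "\<dots> = sin t powr e" using c by (simp add: powr_minus)
  also have "\<dots> \<le> 1" using assms sin_cos_quarter[OF assms(3)] by (intro powr_le1) auto
  finally show ?thesis .
qed simp

lemma pfaff_int_bounds:
  assumes e: "0 < e" and K: "0 < K"
  shows "0 \<le> pfaff_int e K" "pfaff_int e K \<le> pi / 2"
proof -
  show "0 \<le> pfaff_int e K" unfolding pfaff_int_def
    by (intro integral_nonneg pfaff_int_integrable e K) auto
  have "pfaff_int e K \<le> integral {0..pi/2} (\<lambda>_. 1)" unfolding pfaff_int_def
    by (intro integral_le pfaff_int_integrable e K pfaff_kernel_bound) auto
  then show "pfaff_int e K \<le> pi / 2" by simp
qed

text \<open>Differentiation in \<open>K\<close> multiplies the old integrand, bounded by 1, by at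
  most \<open>e / 2\<close> times the reciprocal of the base, and the integral of that reciprocal is
  known from \<open>arctan_integral\<close>.\<close>

lemma pfaff_deriv_bound:
  assumes e: "0 < e" and K: "0 < K"
  shows "\<bar>pfaff_deriv e K\<bar> \<le> e * pi / (4 * sqrt K)"
proof -
  let ?D = "\<lambda>t. (cos t)\<^sup>2 + K * (sin t)\<^sup>2"
  have "norm (pfaff_deriv e K) \<le> integral {0..pi/2} (\<lambda>t. e / 2 * (1 / ?D t))"
    unfolding pfaff_deriv_def
  proof (rule integral_norm_bound_integral)
    have "(\<lambda>t. (sin t * cos t) powr e * ?D t powr (- (e / 2) - 1) * (- (e / 2) * (sin t)\<^sup>2)) integrable_on {0..pi/2}"
    proof (intro integrable_continuous_real continuous_on_mult[of _ "\<lambda>t. (sin t * cos t) powr e * ?D t powr (- (e / 2) - 1)"])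
      show "continuous_on {0..pi / 2} (\<lambda>t. (sin t * cos t) powr e * ?D t powr (- (e / 2) - 1))"
        by (rule continuous_on_pfaff_kernel_fixed[OF e K])
    qed (intro continuous_intros)
    then show "(\<lambda>t. (sin t * cos t) powr e * (- (e / 2) * ?D t powr (- (e / 2) - 1) * (sin t)\<^sup>2)) integrable_on {0..pi/2}"
      by (simp add: mult_ac)
    show "(\<lambda>t. e / 2 * (1 / ?D t)) integrable_on {0..pi/2}"
      using has_integral_mult_right[OF arctan_integral[OF K], of "e / 2"] by (rule has_integral_integrable)
    fix t assume t: "t \<in> {0..pi/2}"
    have D: "?D t > 0" by (rule convex_comb_pos[OF K])
    have "norm ((sin t * cos t) powr e * (- (e / 2) * ?D t powr (- (e / 2) - 1) * (sin t)\<^sup>2)) =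
      ((sin t * cos t) powr e * ?D t powr (- (e / 2))) * (sin t)\<^sup>2 * (e / 2 * (1 / ?D t))"
      using D e by (simp add: abs_mult powr_diff)
    also have "\<dots> \<le> 1 * (e / 2 * (1 / ?D t))"
    proof (intro mult_right_mono)
      show "((sin t * cos t) powr e * ?D t powr (- (e / 2))) * (sin t)\<^sup>2 \<le> 1"
        by (rule mult_le_one[OF pfaff_kernel_bound[OF e K t]]) (auto simp: abs_square_le_1)
      show "0 \<le> e / 2 * (1 / ?D t)" using D e by simp
    qed
    finally show "norm ((sin t * cos t) powr e * (- (e / 2) * ?D t powr (- (e / 2) - 1) * (sin t)\<^sup>2)) \<le> e / 2 * (1 / ?D t)"
      by simp
  qed
  also have "\<dots> = e / 2 * (pi / (2 * sqrt K))"
    by (rule integral_unique[OF has_integral_mult_right[OF arctan_integral[OF K]]])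
  finally show ?thesis by simp
qed

lemma sin_moment_half:
  assumes "0 < e"
  shows "integral {0..pi/2} (\<lambda>t. sin t powr e) = sin_moment e 0 / 2"
proof -
  let ?f = "\<lambda>t. sin t powr e"
  have c: "continuous_on {0..pi} ?f" by (rule continuous_on_sin_powr[OF assms])
  have i: "?f integrable_on {0..pi}" by (intro integrable_continuous_real c)
  have "((\<lambda>t. (- 1) *\<^sub>R ?f (pi - t)) has_integral (integral {pi - 0..pi - pi/2} ?f - integral {pi - pi/2..pi - 0} ?f)) {0..pi/2}"
    by (rule has_integral_substitution_general[where s = "{}" and c = 0 and d = pi])
       (use c in \<open>auto intro!: continuous_intros derivative_eq_intros\<close>)
  then have "((\<lambda>t. - ?f t) has_integral (- integral {pi/2..pi} ?f)) {0..pi/2}" by simp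
  then have "integral {0..pi/2} ?f = integral {pi/2..pi} ?f"
    using has_integral_neg[of "\<lambda>t. - ?f t"] by (metis (no_types, lifting) has_integral_cong integral_unique minus_minus)
  moreover have "integral {0..pi/2} ?f + integral {pi/2..pi} ?f = integral {0..pi} ?f"
    by (rule Henstock_Kurzweil_Integration.integral_combine[OF _ _ i]) auto
  ultimately show ?thesis by (simp add: sin_moment_def)
qed

text \<open>At \<open>K = 0\<close> the powers of \<open>cos t\<close> cancel and half of the
  normalising integral remains.\<close>

lemma pfaff_int_tendsto_0:
  assumes e: "0 < e"
  shows "(pfaff_int e \<longlongrightarrow> sin_moment e 0 / 2) (at_right 0)"
  unfolding tendsto_at_iff_sequentially
proof (intro allI impI)
  fix X :: "nat \<Rightarrow> real" assume X: "\<forall>i. X i \<in> {0<..} - {0}" "X \<longlonglongrightarrow> 0"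
  let ?f = "\<lambda>K t. (sin t * cos t) powr e * ((cos t)\<^sup>2 + K * (sin t)\<^sup>2) powr (- (e / 2))"
  have lim: "(\<lambda>i. integral {0..pi/2} (?f (X i))) \<longlonglongrightarrow> integral {0..pi/2} (?f 0)"
  proof (rule dominated_convergence(2)[where h = "\<lambda>_. 1"])
    show "?f (X i) integrable_on {0..pi/2}" for i using X by (intro pfaff_int_integrable e) auto
    show "norm (?f (X i) t) \<le> 1" if "t \<in> {0..pi/2}" for i t
      using pfaff_kernel_bound[OF e _ that, of "X i"] X by simp
    \<comment> \<open>At \<open>t = pi / 2\<close> all terms are 0 because \<open>0 powr e\<close>
      is 0; elsewhere the base stays positive even for \<open>K = 0\<close>.\<close>
    show "(\<lambda>i. ?f (X i) t) \<longlonglongrightarrow> ?f 0 t" if "t \<in> {0..pi/2}" for t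
    proof (cases "cos t = 0")
      case False
      then show ?thesis by (intro tendsto_intros X) auto
    qed simp
  qed auto
  \<comment> \<open>At \<open>t = pi / 2\<close> the integrands are 0 and 1, hence the removal of
    this one point.\<close>
  have "integral {0..pi/2} (?f 0) = integral {0..pi/2} (\<lambda>t. sin t powr e)"
  proof (rule integral_spike[of "{pi/2}"])
    fix t assume "t \<in> {0..pi/2} - {pi/2}"
    then have c: "cos t > 0" "sin t \<ge> 0" by (auto intro: cos_gt_zero_pi sin_ge_zero)
    then have "((cos t)\<^sup>2) powr (- (e / 2)) = cos t powr (- e)" by (simp add: powr_powr flip: powr_numeral)
    then show "sin t powr e = ?f 0 t" using c by (simp add: powr_mult powr_minus)
  qed auto
  from lim[unfolded this sin_moment_half[OF e]]
  show "(pfaff_int e \<circ> X) \<longlonglongrightarrow> sin_moment e 0 / 2"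
    by (simp only: o_def pfaff_int_def)
qed

section \<open>The fundamental solution and its conormal derivative\<close>

lemma powr_half_sq: "0 < x \<Longrightarrow> (x\<^sup>2) powr (p / 2) = x powr p" for x :: real
  by (simp add: powr_powr flip: powr_numeral)

text \<open>Reflection in the plane \<open>x = 0\<close>; it makes \<open>r1\<close> the distance of
  \<open>Q\<close> from the image point of \<open>P\<close>.\<close>

definition mirror :: "real^3 \<Rightarrow> real^3" where
  "mirror P = P - (2 * P$1) *\<^sub>R axis 1 1"

lemma mirror_nth [simp]: "mirror P $ 1 = - P $ 1" "mirror P $ 2 = P $ 2" "mirror P $ 3 = P $ 3"
  by (simp_all add: mirror_def axis_def)

lemma norm_sq_3: "(norm (x::real^3))\<^sup>2 = (x$1)\<^sup>2 + (x$2)\<^sup>2 + (x$3)\<^sup>2"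
  by (simp add: norm_vec_def L2_set_def sum_3 sum_nonneg)

lemma norm_mirror_ge:
  fixes P Q :: "real^3"
  assumes "0 \<le> P$1" "0 \<le> Q$1"
  shows "P$1 \<le> norm (Q - mirror P)" "Q$1 \<le> norm (Q - mirror P)" "norm (Q - P) \<le> norm (Q - mirror P)"
proof -
  have "P$1 + Q$1 \<le> norm (Q - mirror P)"
    using component_le_norm_cart[of "Q - mirror P" 1] by simp
  then show "P$1 \<le> norm (Q - mirror P)" "Q$1 \<le> norm (Q - mirror P)" using assms by auto
  have "(Q$1 - P$1)\<^sup>2 \<le> (Q$1 + P$1)\<^sup>2"
    using assms by (simp add: power2_eq_square algebra_simps)
  then have "(norm (Q - P))\<^sup>2 \<le> (norm (Q - mirror P))\<^sup>2"
    by (simp add: norm_sq_3)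
  then show "norm (Q - P) \<le> norm (Q - mirror P)" by (rule power2_le_imp_le) simp
qed

text \<open>The factor \<open>1 / (2 * pi)\<close> belongs to \<open>q2\<close>, the power of 2 to
  the Pfaff transformation, and \<open>sin_moment e 0\<close> to the normalisation of the Euler
  integral.\<close>

definition kernel_const :: "real \<Rightarrow> real" where
  "kernel_const e = 2 powr (1 + e) / (2 * pi * sin_moment e 0)"

definition kernel_ratio :: "real^3 \<Rightarrow> real^3 \<Rightarrow> real" where
  "kernel_ratio P Q = (norm (Q - P))\<^sup>2 / (norm (Q - mirror P))\<^sup>2"

text \<open>The factor \<open>r powr (1 + e)\<close> set free by the Pfaff transformation reduces
  \<open>r powr (2 * \<alpha> - 3)\<close> to \<open>1 / r\<close>. The norms appear through their
  squares, which are polynomials along lines and easy to differentiate.\<close>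

lemma q2_eq:
  fixes P Q :: "real^3"
  assumes \<alpha>: "0 < 2 * \<alpha>" "2 * \<alpha> < 1" and P: "0 < P$1" and Q: "0 < Q$1" and PQ: "P \<noteq> Q"
  defines "e \<equiv> 1 - 2 * \<alpha>"
  shows "q2 \<alpha> Q P = kernel_const e * ((P$1) powr e * (Q$1) powr e) *
    ((norm (Q - mirror P))\<^sup>2) powr (- (1 + e) / 2) * ((norm (Q - P))\<^sup>2) powr (- 1 / 2) * pfaff_int e (kernel_ratio P Q)"
proof -
  define r where "r = norm (Q - P)"
  define r1 where "r1 = norm (Q - mirror P)"
  have e: "0 < e" using \<alpha> by (simp add: e_def)
  have r: "r > 0" using PQ by (simp add: r_def)
  have r1: "r1 > 0" using norm_mirror_ge(1)[of P Q] P Q unfolding r1_def by linarith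
  have r_eq: "r = sqrt ((Q$1 - P$1)\<^sup>2 + (Q$2 - P$2)\<^sup>2 + (Q$3 - P$3)\<^sup>2)"
    using norm_sq_3[of "Q - P"] by (simp add: r_def real_sqrt_unique)
  have r1_eq: "r1 = sqrt ((Q$1 + P$1)\<^sup>2 + (Q$2 - P$2)\<^sup>2 + (Q$3 - P$3)\<^sup>2)"
    using norm_sq_3[of "Q - mirror P"] by (simp add: r1_def real_sqrt_unique)
  define k where "k = r / r1"
  have k: "0 < k" "k \<le> 1" using r r1 norm_mirror_ge(3)[of P Q] P Q by (auto simp: k_def r_def r1_def)
  have ks: "k\<^sup>2 = kernel_ratio P Q" by (simp add: k_def kernel_ratio_def r_def r1_def power_divide)
  have x: "1 - r1\<^sup>2 / r\<^sup>2 = 1 - 1 / k\<^sup>2" using r r1 by (simp add: k_def power_divide)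
  have "q2 \<alpha> Q P = 1 / (2 * pi) * r powr (2 * \<alpha> - 3) * (Q$1) powr e * (P$1) powr e *
        Re (hypergeo_F (of_real (1 + e / 2)) (of_real ((1 + e) / 2)) (of_real (1 + e)) (of_real (1 - 1 / k\<^sup>2)))"
  proof -
    have p: "3 / 2 - \<alpha> = 1 + e / 2" "1 - \<alpha> = (1 + e) / 2" "2 - 2 * \<alpha> = 1 + e"
      by (auto simp: e_def field_simps)
    show ?thesis unfolding q2_def Let_def r_eq[symmetric] r1_eq[symmetric] x p e_def[symmetric] ..
  qed
  also have "\<dots> = 1 / (2 * pi) * r powr (2 * \<alpha> - 3) * (Q$1) powr e * (P$1) powr e *
     ((2 * k) powr (1 + e) * pfaff_int e (k\<^sup>2) / sin_moment e 0)"
    by (simp only: Re_hypergeo_F_pfaff[OF e k])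
  also have "(2 * k) powr (1 + e) = 2 powr (1 + e) * (r powr (1 + e) * r1 powr (- (1 + e)))"
    unfolding powr_minus_divide[of r1 "1 + e"] using r r1 k by (simp add: powr_mult k_def powr_divide)
  also have "1 / (2 * pi) * r powr (2 * \<alpha> - 3) * (Q$1) powr e * (P$1) powr e *
     (2 powr (1 + e) * (r powr (1 + e) * r1 powr (- (1 + e))) * pfaff_int e (k\<^sup>2) / sin_moment e 0) =
     kernel_const e * ((P$1) powr e * (Q$1) powr e) * r1 powr (- (1 + e)) * (r powr (2 * \<alpha> - 3) * r powr (1 + e)) * pfaff_int e (k\<^sup>2)"
    by (simp add: kernel_const_def field_simps)
  also have "r powr (2 * \<alpha> - 3) * r powr (1 + e) = r powr (-1)"
    by (simp only: powr_add[symmetric]) (simp add: e_def)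
  also have "r powr (-1) = (r\<^sup>2) powr (- 1 / 2)"
    using powr_half_sq[OF r, of "-1"] by simp
  also have "r1 powr (- (1 + e)) = (r1\<^sup>2) powr (- (1 + e) / 2)"
    by (rule powr_half_sq[OF r1, symmetric])
  finally show ?thesis unfolding ks r_def r1_def .
qed

text \<open>
  The conormal derivative of \<open>q2\<close> splits into the derivative of the factor \<open>1 / norm (Q - P)\<close>, whose
  coefficient is \<open>kernel_sing\<close>, and the derivatives of the other factors, collected in \<open>kernel_reg\<close>.
\<close>

definition kernel_sing :: "real \<Rightarrow> real^3 \<Rightarrow> real^3 \<Rightarrow> real" where
  "kernel_sing e P Q = kernel_const e * (P$1) powr e * Q$1 * ((norm (Q - mirror P))\<^sup>2) powr (- (1 + e) / 2) *
     pfaff_int e (kernel_ratio P Q)"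

definition kernel_reg :: "real \<Rightarrow> real^3 \<Rightarrow> real^3 \<Rightarrow> real^3" where
  "kernel_reg e P Q = (kernel_const e * (P$1) powr e * ((norm (Q - mirror P))\<^sup>2) powr (- (1 + e) / 2) / norm (Q - P)) *\<^sub>R
     ((e * pfaff_int e (kernel_ratio P Q)) *\<^sub>R axis 1 1
      - ((1 + e) * Q$1 * pfaff_int e (kernel_ratio P Q) / (norm (Q - mirror P))\<^sup>2) *\<^sub>R (Q - mirror P)
      + (2 * Q$1 * pfaff_deriv e (kernel_ratio P Q) / (norm (Q - mirror P))\<^sup>2) *\<^sub>R
          ((Q - P) - kernel_ratio P Q *\<^sub>R (Q - mirror P)))"

lemma norm_sq_line_deriv:
  fixes a v :: "'a::real_inner"
  shows "((\<lambda>h. (norm (Q + h *\<^sub>R v - a))\<^sup>2) has_real_derivative 2 * ((Q - a) \<bullet> v)) (at 0)"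
proof -
  have "(\<lambda>h. (norm (Q + h *\<^sub>R v - a))\<^sup>2) = (\<lambda>h. (norm (Q - a))\<^sup>2 + 2 * h * ((Q - a) \<bullet> v) + h\<^sup>2 * (norm v)\<^sup>2)"
  proof
    fix h
    define w where "w = Q - a"
    have "Q + h *\<^sub>R v - a = w + h *\<^sub>R v" by (simp add: w_def)
    then show "(norm (Q + h *\<^sub>R v - a))\<^sup>2 = (norm (Q - a))\<^sup>2 + 2 * h * ((Q - a) \<bullet> v) + h\<^sup>2 * (norm v)\<^sup>2"
      unfolding w_def[symmetric]
      by (simp only: power2_norm_eq_inner)
        (simp add: inner_add_left inner_add_right inner_commute power2_eq_square)
  qed
  then show ?thesis by (auto intro!: derivative_eq_intros)
qed

text \<open>Product rule along a coordinate line through \<open>Q\<close>. The term that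
  differentiates \<open>1 / norm (Q - P)\<close> carries \<open>(P - Q) / norm (Q - P) ^ 3\<close>;
  the three others form \<open>kernel_reg\<close>.\<close>

lemma q2_partial_deriv:
  fixes P Q :: "real^3"
  assumes \<alpha>: "0 < 2 * \<alpha>" "2 * \<alpha> < 1" and P: "0 < P$1" and Q: "0 < Q$1" and PQ: "P \<noteq> Q"
  defines "e \<equiv> 1 - 2 * \<alpha>"
  shows "(Q$1) powr (2 * \<alpha>) * partial_deriv i (\<lambda>Q. q2 \<alpha> Q P) Q =
     (kernel_reg e P Q + (kernel_sing e P Q / norm (Q - P) ^ 3) *\<^sub>R (P - Q)) $ i"
proof -
  define v where "v = (axis i 1 :: real^3)"
  define N where "N = (\<lambda>h. (norm (Q + h *\<^sub>R v - P))\<^sup>2)"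
  define M where "M = (\<lambda>h. (norm (Q + h *\<^sub>R v - mirror P))\<^sup>2)"
  define q where "q = (\<lambda>h. (Q + h *\<^sub>R v) $ 1)"
  define F where "F = (\<lambda>h. kernel_const e * ((P$1) powr e * (q h) powr e) *
    (M h) powr (- (1 + e) / 2) * (N h) powr (- 1 / 2) * pfaff_int e (N h / M h))"
  have e: "0 < e" using \<alpha> by (simp add: e_def)
  have N0: "N 0 = (norm (Q - P))\<^sup>2" and M0: "M 0 = (norm (Q - mirror P))\<^sup>2" and q0: "q 0 = Q$1"
    by (simp_all add: N_def M_def q_def)
  have Mpos: "M 0 > 0" using norm_mirror_ge(1)[of P Q] P Q unfolding M0 by auto
  have Npos: "N 0 > 0" using PQ unfolding N0 by auto
  have qpos: "q 0 > 0" using Q by (simp add: q0)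
  define N' M' where "N' = 2 * ((Q - P) \<bullet> v)" and "M' = 2 * ((Q - mirror P) \<bullet> v)"
  have dN: "(N has_real_derivative N') (at 0)" unfolding N_def N'_def by (rule norm_sq_line_deriv)
  have dM: "(M has_real_derivative M') (at 0)" unfolding M_def M'_def by (rule norm_sq_line_deriv)
  have dq: "(q has_real_derivative v$1) (at 0)"
    unfolding q_def by (auto intro!: derivative_eq_intros)
  have dR: "((\<lambda>h. N h / M h) has_real_derivative (N' * M 0 - N 0 * M') / (M 0 * M 0)) (at 0)"
    using Mpos by (intro DERIV_divide dN dM) auto
  have dF1: "((\<lambda>h. pfaff_int e (N h / M h)) has_real_derivative
      pfaff_deriv e (N 0 / M 0) * ((N' * M 0 - N 0 * M') / (M 0 * M 0))) (at 0)"
    using Npos Mpos by (intro DERIV_chain2[OF pfaff_int_deriv[OF e] dR]) auto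
  have dq1: "((\<lambda>h. q h powr e) has_real_derivative e * q 0 powr (e - 1) * v$1) (at 0)"
    using qpos by (auto intro!: derivative_eq_intros dq)
  have dM1: "((\<lambda>h. M h powr (- (1 + e) / 2)) has_real_derivative (- (1 + e) / 2) * M 0 powr (- (1 + e) / 2 - 1) * M') (at 0)"
    using Mpos by (auto intro!: derivative_eq_intros dM)
  have dN1: "((\<lambda>h. N h powr (- 1 / 2)) has_real_derivative (- 1 / 2) * N 0 powr (- 1 / 2 - 1) * N') (at 0)"
    using Npos by (auto intro!: derivative_eq_intros dN)
  define F' where "F' = kernel_const e * (P$1) powr e *
     (e * q 0 powr (e - 1) * v$1 * M 0 powr (- (1 + e) / 2) * N 0 powr (- 1 / 2) * pfaff_int e (N 0 / M 0)
    + q 0 powr e * ((- (1 + e) / 2) * M 0 powr (- (1 + e) / 2 - 1) * M') * N 0 powr (- 1 / 2) * pfaff_int e (N 0 / M 0)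
    + q 0 powr e * M 0 powr (- (1 + e) / 2) * ((- 1 / 2) * N 0 powr (- 1 / 2 - 1) * N') * pfaff_int e (N 0 / M 0)
    + q 0 powr e * M 0 powr (- (1 + e) / 2) * N 0 powr (- 1 / 2) * (pfaff_deriv e (N 0 / M 0) * ((N' * M 0 - N 0 * M') / (M 0 * M 0))))"
  have dF: "(F has_real_derivative F') (at 0)"
    unfolding F_def F'_def
    by (rule derivative_eq_intros dq1 dM1 dN1 dF1 refl)+ (simp add: algebra_simps)
  \<comment> \<open>The closed form of \<open>q2\<close> requires a positive first coordinate and a
    point other than \<open>P\<close>; near \<open>h = 0\<close> both persist, which is enough for a
    derivative.\<close>
  have "\<forall>\<^sub>F h in nhds 0. q h > 0 \<and> N h > 0"
  proof -
    have "isCont q 0" "isCont N 0" using dq dN DERIV_isCont by auto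
    then have "(q \<longlongrightarrow> q 0) (nhds 0)" "(N \<longlongrightarrow> N 0) (nhds 0)"
      by (auto simp: continuous_at tendsto_at_iff_tendsto_nhds)
    then show ?thesis
      using order_tendstoD(1)[OF _ qpos] order_tendstoD(1)[OF _ Npos] by (intro eventually_conj) auto
  qed
  then have "\<forall>\<^sub>F h in nhds 0. q2 \<alpha> (Q + h *\<^sub>R v) P = F h"
  proof eventually_elim
    case (elim h)
    have "P \<noteq> Q + h *\<^sub>R v" using elim by (auto simp: N_def)
    then show ?case
      using elim q2_eq[OF \<alpha> P, of "Q + h *\<^sub>R v"]
      by (simp add: F_def e_def q_def M_def N_def kernel_ratio_def)
  qed
  then have "((\<lambda>h. q2 \<alpha> (Q + h *\<^sub>R v) P) has_real_derivative F') (at 0)"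
    using dF by (subst DERIV_cong_ev[OF refl _ refl])
  then have pd: "partial_deriv i (\<lambda>Q. q2 \<alpha> Q P) Q = F'"
    unfolding partial_deriv_def v_def by (rule DERIV_imp_deriv)
  define A where "A = M 0 powr (- (1 + e) / 2)"
  define n where "n = norm (Q - P)"
  have n: "n > 0" using PQ by (simp add: n_def)
  have N0n: "N 0 = n\<^sup>2" by (simp add: N0 n_def)
  have pN: "N 0 powr (- 1 / 2) = 1 / n"
  proof -
    have "N 0 powr (- 1 / 2) = n powr (- 1)" using powr_half_sq[OF n, of "-1"] unfolding N0n by simp
    then show ?thesis using n by (simp add: powr_minus_divide)
  qed
  have pN1: "N 0 powr (- 1 / 2 - 1) = 1 / n ^ 3"
  proof -
    have "N 0 powr (- 1 / 2 - 1) = N 0 powr (- 1 / 2) / N 0" using Npos by (subst powr_diff) simp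
    also have "\<dots> = 1 / n / n\<^sup>2" unfolding pN unfolding N0n ..
    finally show ?thesis by (simp add: power2_eq_square power3_eq_cube)
  qed
  have pM1: "M 0 powr (- (1 + e) / 2 - 1) = A / M 0"
    using Mpos unfolding A_def by (subst powr_diff) simp
  \<comment> \<open>The weight of the conormal derivative cancels the degenerate power of the first
    coordinate, since \<open>e + 2 * \<alpha> = 1\<close>.\<close>
  have q1: "q 0 powr (e - 1) * q 0 powr (2 * \<alpha>) = 1" "q 0 powr e * q 0 powr (2 * \<alpha>) = q 0"
    using qpos by (simp_all add: e_def flip: powr_add)
  have al: "kernel_const e * (P$1) powr e * (e * E1 * v1 * A * (1 / n) * \<Phi> + E2 * ((- (1 + e) / 2) * (A / m) * M') * (1 / n) * \<Phi>
    + E2 * A * ((- 1 / 2) * (1 / n ^ 3) * N') * \<Phi> + E2 * A * (1 / n) * (\<Psi> * ((N' * m - nn * M') / (m * m)))) * E3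
    = kernel_const e * (P$1) powr e * (e * (E1 * E3) * v1 * A * (1 / n) * \<Phi> + (E2 * E3) * ((- (1 + e) / 2) * (A / m) * M') * (1 / n) * \<Phi>
    + (E2 * E3) * A * ((- 1 / 2) * (1 / n ^ 3) * N') * \<Phi> + (E2 * E3) * A * (1 / n) * (\<Psi> * ((N' * m - nn * M') / (m * m))))"
    for E1 E2 E3 v1 \<Phi> \<Psi> m nn :: real
    by (simp add: algebra_simps)
  have "(Q$1) powr (2 * \<alpha>) * F' = F' * q 0 powr (2 * \<alpha>)" by (simp add: q0)
  also have "\<dots> = kernel_const e * (P$1) powr e *
    (e * 1 * v$1 * A * (1 / n) * pfaff_int e (N 0 / M 0)
     + q 0 * ((- (1 + e) / 2) * (A / M 0) * M') * (1 / n) * pfaff_int e (N 0 / M 0)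
     + q 0 * A * ((- 1 / 2) * (1 / n ^ 3) * N') * pfaff_int e (N 0 / M 0)
     + q 0 * A * (1 / n) * (pfaff_deriv e (N 0 / M 0) * ((N' * M 0 - N 0 * M') / (M 0 * M 0))))"
    unfolding F'_def pN pN1 pM1 A_def[symmetric] al q1 ..
  finally have LHS: "(Q$1) powr (2 * \<alpha>) * F' = kernel_const e * (P$1) powr e *
    (e * 1 * v$1 * A * (1 / n) * pfaff_int e (N 0 / M 0)
     + q 0 * ((- (1 + e) / 2) * (A / M 0) * M') * (1 / n) * pfaff_int e (N 0 / M 0)
     + q 0 * A * ((- 1 / 2) * (1 / n ^ 3) * N') * pfaff_int e (N 0 / M 0)
     + q 0 * A * (1 / n) * (pfaff_deriv e (N 0 / M 0) * ((N' * M 0 - N 0 * M') / (M 0 * M 0))))" .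
  have comp: "x $ i = x \<bullet> v" for x :: "real^3" by (simp add: v_def inner_axis)
  have kr: "kernel_ratio P Q = N 0 / M 0" by (simp add: kernel_ratio_def N0 M0)
  have v1: "axis 1 1 \<bullet> v = v $ 1" by (simp add: inner_axis' )
  have PQv: "(P - Q) \<bullet> v = - N' / 2" "(Q - P) \<bullet> v = N' / 2" "(Q - mirror P) \<bullet> v = M' / 2"
    by (simp_all add: N'_def M'_def inner_diff_left)
  have RHS: "(kernel_reg e P Q + (kernel_sing e P Q / norm (Q - P) ^ 3) *\<^sub>R (P - Q)) $ i =
    (kernel_const e * (P$1) powr e * A / n) *
     ((e * pfaff_int e (N 0 / M 0)) * v$1
      - ((1 + e) * q 0 * pfaff_int e (N 0 / M 0) / M 0) * (M' / 2)
      + (2 * q 0 * pfaff_deriv e (N 0 / M 0) / M 0) * (N' / 2 - N 0 / M 0 * (M' / 2)))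
    + (kernel_const e * (P$1) powr e * q 0 * A * pfaff_int e (N 0 / M 0)) / n ^ 3 * (- N' / 2)"
    unfolding comp kernel_reg_def kernel_sing_def inner_add_left inner_scaleR_left inner_diff_left[of "_ *\<^sub>R _"]
      inner_diff_left[of "Q - P" "_ *\<^sub>R _"] inner_scaleR_left kr v1 PQv
    unfolding M0[symmetric] q0[symmetric] n_def[symmetric] A_def[symmetric] ..
  show ?thesis unfolding pd LHS RHS
    using n Mpos by (simp add: field_simps)
qed

lemma conormal_deriv_q2:
  fixes P Q m :: "real^3"
  assumes "0 < 2 * \<alpha>" "2 * \<alpha> < 1" "0 < P$1" "0 < Q$1" "P \<noteq> Q"
  shows "conormal_deriv \<alpha> m (\<lambda>Q. q2 \<alpha> Q P) Q =
     kernel_sing (1 - 2 * \<alpha>) P Q * ((P - Q) \<bullet> m) / norm (Q - P) ^ 3 + kernel_reg (1 - 2 * \<alpha>) P Q \<bullet> m"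
proof -
  let ?g = "kernel_reg (1 - 2 * \<alpha>) P Q + (kernel_sing (1 - 2 * \<alpha>) P Q / norm (Q - P) ^ 3) *\<^sub>R (P - Q)"
  have "conormal_deriv \<alpha> m (\<lambda>Q. q2 \<alpha> Q P) Q = m$1 * ?g$1 + m$2 * ?g$2 + m$3 * ?g$3"
    unfolding conormal_deriv_def q2_partial_deriv[OF assms, symmetric] by (simp add: algebra_simps)
  also have "\<dots> = ?g \<bullet> m" by (simp add: inner_vec_def sum_3 mult.commute)
  finally show ?thesis by (simp add: inner_add_left)
qed

section \<open>Limits and uniform bounds of the kernel\<close>

lemma kernel_ratio_bounds:
  fixes P Q :: "real^3"
  assumes "0 < P$1" "0 < Q$1" "P \<noteq> Q"
  shows "0 < kernel_ratio P Q" "kernel_ratio P Q \<le> 1" "0 < norm (Q - mirror P)"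
proof -
  show *: "0 < norm (Q - mirror P)" using norm_mirror_ge(1)[of P Q] assms by linarith
  show "0 < kernel_ratio P Q" using * assms by (simp add: kernel_ratio_def)
  show "kernel_ratio P Q \<le> 1" using * norm_mirror_ge(3)[of P Q] assms
    by (simp add: kernel_ratio_def power_mono)
qed

lemma tendsto_mirror: "(P \<longlongrightarrow> p) F \<Longrightarrow> ((\<lambda>x. mirror (P x)) \<longlongrightarrow> mirror p) F"
  unfolding mirror_def by (intro tendsto_intros)

lemma tendsto_kernel_ratio:
  fixes p q :: "real^3"
  assumes "(P \<longlongrightarrow> p) F" "(Q \<longlongrightarrow> q) F" "0 < p$1" "0 < q$1"
  shows "((\<lambda>x. kernel_ratio (P x) (Q x)) \<longlongrightarrow> kernel_ratio p q) F"
proof -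
  have "0 < norm (q - mirror p)" using norm_mirror_ge(1)[of p q] assms by linarith
  then show ?thesis
    unfolding kernel_ratio_def by (intro tendsto_intros tendsto_mirror assms) auto
qed

lemma
  fixes p q :: "real^3"
  assumes e: "0 < e" and P: "(P \<longlongrightarrow> p) F" and Q: "(Q \<longlongrightarrow> q) F"
    and pos: "0 < p$1" "0 < q$1" "p \<noteq> q"
  shows tendsto_kernel_sing: "((\<lambda>x. kernel_sing e (P x) (Q x)) \<longlongrightarrow> kernel_sing e p q) F"
    and tendsto_kernel_reg: "((\<lambda>x. kernel_reg e (P x) (Q x)) \<longlongrightarrow> kernel_reg e p q) F"
proof -
  note K = kernel_ratio_bounds[OF pos]
  have KK: "((\<lambda>x. kernel_ratio (P x) (Q x)) \<longlongrightarrow> kernel_ratio p q) F"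
    by (rule tendsto_kernel_ratio[OF P Q pos(1,2)])
  have "isCont (pfaff_int e) (kernel_ratio p q)" "isCont (pfaff_deriv e) (kernel_ratio p q)"
    using continuous_on_pfaff_int[OF e] continuous_on_pfaff_deriv[OF e] K
    by (auto simp: continuous_on_eq_continuous_at)
  note I = isCont_tendsto_compose[OF this(1) KK] isCont_tendsto_compose[OF this(2) KK]
  show "((\<lambda>x. kernel_sing e (P x) (Q x)) \<longlongrightarrow> kernel_sing e p q) F"
    unfolding kernel_sing_def using K pos by (intro tendsto_intros tendsto_mirror P Q I) auto
  show "((\<lambda>x. kernel_reg e (P x) (Q x)) \<longlongrightarrow> kernel_reg e p q) F"
    unfolding kernel_reg_def using K pos by (intro tendsto_intros tendsto_mirror P Q I KK) auto
qed

text \<open>On the diagonal the distance to the image point is \<open>2 * p$1\<close>, so all powers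
  of \<open>p$1\<close> and of 2 cancel. What is left is \<open>1 / (2 * pi)\<close> times the 1/2
  from the limit of the Pfaff integral: the constant of the Laplace equation, whatever
  \<open>e\<close> is.\<close>

lemma tendsto_kernel_sing_diag:
  fixes p :: "real^3"
  assumes e: "0 < e" and P: "(P \<longlongrightarrow> p) F" and Q: "(Q \<longlongrightarrow> p) F"
    and pos: "0 < p$1" and PQ: "\<forall>\<^sub>F x in F. P x \<noteq> Q x"
  shows "((\<lambda>x. kernel_sing e (P x) (Q x)) \<longlongrightarrow> 1 / (4 * pi)) F"
proof -
  have "((\<lambda>x. P x $ 1) \<longlongrightarrow> p $ 1) F" "((\<lambda>x. Q x $ 1) \<longlongrightarrow> p $ 1) F"
    by (intro tendsto_intros P Q)+
  then have "\<forall>\<^sub>F x in F. 0 < P x $ 1" "\<forall>\<^sub>F x in F. 0 < Q x $ 1"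
    using pos by (auto intro: order_tendstoD(1))
  then have ev: "\<forall>\<^sub>F x in F. 0 < kernel_ratio (P x) (Q x)"
    using PQ by eventually_elim (rule kernel_ratio_bounds(1))
  have "((\<lambda>x. kernel_ratio (P x) (Q x)) \<longlongrightarrow> kernel_ratio p p) F"
    by (rule tendsto_kernel_ratio[OF P Q pos pos])
  \<comment> \<open>The distinctness of the points makes the ratio approach 0 from the
    right.\<close>
  then have "filterlim (\<lambda>x. kernel_ratio (P x) (Q x)) (at_right 0) F"
    using ev by (auto simp: filterlim_at kernel_ratio_def elim: eventually_mono)
  from filterlim_compose[OF pfaff_int_tendsto_0[OF e] this]
  have I: "((\<lambda>x. pfaff_int e (kernel_ratio (P x) (Q x))) \<longlongrightarrow> sin_moment e 0 / 2) F" .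
  have np: "norm (p - mirror p) = 2 * p$1" using pos by (simp add: mirror_def)
  have "((\<lambda>x. kernel_sing e (P x) (Q x)) \<longlongrightarrow> kernel_const e * (p$1) powr e * p$1 *
     ((norm (p - mirror p))\<^sup>2) powr (- (1 + e) / 2) * (sin_moment e 0 / 2)) F"
    unfolding kernel_sing_def using np pos by (intro tendsto_intros tendsto_mirror P Q I) auto
  also have "((norm (p - mirror p))\<^sup>2) powr (- (1 + e) / 2) = (2 * p$1) powr (- (1 + e))"
    using pos unfolding np by (intro powr_half_sq) simp
  also have "\<dots> = 1 / (2 powr (1 + e) * ((p$1) powr e * p$1))"
    unfolding powr_minus_divide[of "2 * p$1" "1 + e"] using pos by (simp add: powr_mult powr_add)
  also have "kernel_const e * (p$1) powr e * p$1 * (1 / (2 powr (1 + e) * ((p$1) powr e * p$1))) * (sin_moment e 0 / 2) = 1 / (4 * pi)"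
    using pos sin_moment_0_pos[OF e] by (simp add: kernel_const_def)
  finally show ?thesis .
qed

lemma kernel_const_pos: "0 < e \<Longrightarrow> 0 < kernel_const e"
  by (simp add: kernel_const_def sin_moment_0_pos)

text \<open>The bound must hold up to the edge of the surface, where \<open>Q$1\<close> tends to 0.
  It does because \<open>norm (Q - mirror P)\<close> dominates \<open>Q$1\<close> and, thanks to
  \<open>P$1\<close>, also \<open>c\<close>, so every negative power of it is under control.\<close>

lemma kernel_bounds:
  assumes e: "0 < e" and c: "0 < c"
  shows "\<exists>B>0. \<forall>P Q. c \<le> P$1 \<and> P$1 \<le> C \<and> 0 < Q$1 \<and> P \<noteq> Q \<longrightarrow>
    \<bar>kernel_sing e P Q\<bar> \<le> B \<and> norm (kernel_reg e P Q) \<le> B / norm (Q - P)"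
proof -
  define B0 where "B0 = kernel_const e * C powr e"
  define B1 where "B1 = \<bar>B0\<bar> * (c powr (- e) * pi / 2)"
  define B2 where "B2 = \<bar>B0\<bar> * (c powr (- (1 + e)) * ((1 + 2 * e) * pi / 2 + e * pi))"
  have "\<bar>kernel_sing e P Q\<bar> \<le> B1 \<and> norm (kernel_reg e P Q) \<le> B2 / norm (Q - P)"
    if PQ: "c \<le> P$1" "P$1 \<le> C" "0 < Q$1" "P \<noteq> Q" for P Q :: "real^3"
  proof -
    define m where "m = norm (Q - mirror P)"
    define n where "n = norm (Q - P)"
    define K where "K = kernel_ratio P Q"
    have P0: "0 < P$1" using PQ c by simp
    have m: "P$1 \<le> m" "Q$1 \<le> m" "n \<le> m" "0 < m" "c \<le> m"
      using norm_mirror_ge[of P Q] P0 PQ unfolding m_def n_def by auto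
    have n: "0 < n" using PQ by (simp add: n_def)
    have K: "0 < K" "K \<le> 1" using kernel_ratio_bounds[of P Q] P0 PQ by (auto simp: K_def)
    have K_eq: "K = n\<^sup>2 / m\<^sup>2" by (simp add: K_def kernel_ratio_def n_def m_def)
    have sK: "sqrt K = n / m" using m n by (simp add: K_eq real_sqrt_divide)
    have I: "0 \<le> pfaff_int e K" "pfaff_int e K \<le> pi / 2" using pfaff_int_bounds[OF e K(1)] by auto
    have J: "\<bar>pfaff_deriv e K\<bar> \<le> e * pi / 4 * (m / n)"
      using pfaff_deriv_bound[OF e K(1)] unfolding sK using m n by (simp add: field_simps)
    have mp: "(m\<^sup>2) powr (- (1 + e) / 2) = m powr (- (1 + e))"
      by (rule powr_half_sq[OF m(4)])
    have c0: "0 \<le> kernel_const e * (P$1) powr e" using kernel_const_pos[OF e] by simp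
    have cB: "kernel_const e * (P$1) powr e \<le> \<bar>B0\<bar>"
      unfolding B0_def using kernel_const_pos[OF e] PQ P0 e
      by (simp add: abs_mult powr_mono2)
    have "Q$1 * m powr (- (1 + e)) \<le> m * m powr (- (1 + e))" using m by (intro mult_right_mono) auto
    also have "\<dots> = m powr (- e)" using m by (simp add: powr_mult_base)
    also have "\<dots> \<le> c powr (- e)" using m c e by (intro powr_mono2') auto
    finally have qm: "Q$1 * m powr (- (1 + e)) \<le> c powr (- e)" .
    have me: "m powr (- (1 + e)) \<le> c powr (- (1 + e))" using m c e by (intro powr_mono2') auto
    have "\<bar>kernel_sing e P Q\<bar> = (kernel_const e * (P$1) powr e) * ((Q$1 * m powr (- (1 + e))) * pfaff_int e K)"
      unfolding kernel_sing_def m_def[symmetric] K_def[symmetric] mp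
      using kernel_const_pos[OF e] PQ I by (simp add: abs_mult mult_ac)
    also have "\<dots> \<le> \<bar>B0\<bar> * (c powr (- e) * (pi / 2))"
      using cB qm I c0 PQ by (intro mult_mono) auto
    finally have 1: "\<bar>kernel_sing e P Q\<bar> \<le> B1" by (simp add: B1_def)
    let ?x = "(e * pfaff_int e K) *\<^sub>R axis 1 1 :: real^3"
    let ?y = "((1 + e) * Q$1 * pfaff_int e K / m\<^sup>2) *\<^sub>R (Q - mirror P)"
    let ?z = "(2 * Q$1 * pfaff_deriv e K / m\<^sup>2) *\<^sub>R ((Q - P) - K *\<^sub>R (Q - mirror P))"
    have x: "norm ?x \<le> e * (pi / 2)" using e I by (simp add: abs_mult)
    have "norm ?y = (1 + e) * (Q$1 / m) * pfaff_int e K"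
    proof -
      have "0 \<le> (1 + e) * Q$1 * pfaff_int e K / m\<^sup>2" using e I PQ m by simp
      then have "norm ?y = (1 + e) * Q$1 * pfaff_int e K / m\<^sup>2 * m"
        by (simp only: norm_scaleR m_def[symmetric] abs_of_nonneg)
      then show ?thesis using m by (simp add: power2_eq_square)
    qed
    also have "\<dots> \<le> (1 + e) * 1 * (pi / 2)" using e I PQ m by (intro mult_mono) auto
    finally have y: "norm ?y \<le> (1 + e) * (pi / 2)" by simp
    \<comment> \<open>Here \<open>K * m = n * (n / m) \<le> n\<close>, so this vector has length at
      most \<open>2 * n\<close>; that compensates the growth \<open>m / n\<close> of
      \<open>pfaff_deriv\<close>.\<close>
    have "norm ((Q - P) - K *\<^sub>R (Q - mirror P)) \<le> n + K * m"
      using norm_triangle_ineq4[of "Q - P" "K *\<^sub>R (Q - mirror P)"] K by (simp add: n_def m_def)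
    also have "K * m = n * (n / m)" using m n by (simp add: K_eq power2_eq_square)
    also have "n * (n / m) \<le> n * 1" using m n by (intro mult_left_mono) auto
    finally have nd: "norm ((Q - P) - K *\<^sub>R (Q - mirror P)) \<le> 2 * n" by simp
    have "norm ?z = 2 * (Q$1 / m\<^sup>2) * \<bar>pfaff_deriv e K\<bar> * norm ((Q - P) - K *\<^sub>R (Q - mirror P))"
      using PQ by (simp add: abs_mult)
    also have "\<dots> \<le> 2 * (m / m\<^sup>2) * (e * pi / 4 * (m / n)) * (2 * n)"
      using J nd m n PQ e by (intro mult_mono divide_right_mono mult_nonneg_nonneg) auto
    also have "\<dots> = e * pi" using m n by (simp add: power2_eq_square)
    finally have z: "norm ?z \<le> e * pi" .
    have xyz: "norm (?x - ?y + ?z) \<le> (1 + 2 * e) * pi / 2 + e * pi"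
      using norm_triangle_ineq[of "?x - ?y" ?z] norm_triangle_ineq4[of ?x ?y] x y z
      by (simp add: algebra_simps add_divide_distrib)
    have "norm (kernel_reg e P Q) = ((kernel_const e * (P$1) powr e) * (m powr (- (1 + e)) * norm (?x - ?y + ?z))) / n"
      unfolding kernel_reg_def m_def[symmetric] n_def[symmetric] K_def[symmetric] mp
      using kernel_const_pos[OF e] PQ n by (simp add: abs_mult)
    also have "\<dots> \<le> (\<bar>B0\<bar> * (c powr (- (1 + e)) * ((1 + 2 * e) * pi / 2 + e * pi))) / n"
      using cB me xyz n c0 by (intro divide_right_mono mult_mono mult_nonneg_nonneg) auto
    finally have "norm (kernel_reg e P Q) \<le> B2 / norm (Q - P)" by (simp add: B2_def n_def)
    with 1 show ?thesis by simp
  qed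
  moreover have "B1 \<le> \<bar>B1\<bar> + \<bar>B2\<bar> + 1" "B2 \<le> \<bar>B1\<bar> + \<bar>B2\<bar> + 1" by auto
  ultimately have "\<forall>P Q. c \<le> P$1 \<and> P$1 \<le> C \<and> 0 < Q$1 \<and> P \<noteq> Q \<longrightarrow>
    \<bar>kernel_sing e P Q\<bar> \<le> \<bar>B1\<bar> + \<bar>B2\<bar> + 1 \<and> norm (kernel_reg e P Q) \<le> (\<bar>B1\<bar> + \<bar>B2\<bar> + 1) / norm (Q - P)"
    by (meson divide_right_mono norm_ge_zero order_trans)
  moreover have "0 < \<bar>B1\<bar> + \<bar>B2\<bar> + 1" by auto
  ultimately show ?thesis by blast
qed

section \<open>Charts of a Lyapunov surface\<close>

locale frame =
  fixes N e1 e2 n :: "real^3"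
  assumes unit: "e1 \<bullet> e1 = 1" "e2 \<bullet> e2 = 1" "n \<bullet> n = 1"
    and orth: "e1 \<bullet> e2 = 0" "e1 \<bullet> n = 0" "e2 \<bullet> n = 0"
    and expand: "\<And>x. x = (x \<bullet> e1) *\<^sub>R e1 + (x \<bullet> e2) *\<^sub>R e2 + (x \<bullet> n) *\<^sub>R n"
begin

definition emb :: "real^2 \<Rightarrow> real^3" where "emb u = u$1 *\<^sub>R e1 + u$2 *\<^sub>R e2"

definition proj :: "real^3 \<Rightarrow> real^2" where "proj Q = (\<chi> i. if i = 1 then (Q - N) \<bullet> e1 else (Q - N) \<bullet> e2)"

definition ht :: "real^3 \<Rightarrow> real" where "ht Q = (Q - N) \<bullet> n"

lemma orth': "e2 \<bullet> e1 = 0" "n \<bullet> e1 = 0" "n \<bullet> e2 = 0"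
  using orth by (simp_all add: inner_commute)

lemma norm_n [simp]: "norm n = 1" using unit by (simp add: norm_eq_sqrt_inner)

lemma emb_n [simp]: "emb u \<bullet> n = 0" "n \<bullet> emb u = 0"
  by (simp_all add: emb_def inner_add_left inner_add_right orth orth')

lemma linear_emb: "linear emb"
  by (rule linearI) (simp_all add: emb_def algebra_simps)

lemma emb_diff: "emb (u - v) = emb u - emb v" and emb_add: "emb (u + v) = emb u + emb v"
  and emb_scale: "emb (c *\<^sub>R u) = c *\<^sub>R emb u" and emb_0 [simp]: "emb 0 = 0"
  by (simp_all add: emb_def algebra_simps)

lemma norm_emb_height: "(norm (emb u + s *\<^sub>R n))\<^sup>2 = (norm u)\<^sup>2 + s\<^sup>2"
proof -
  have "(norm u)\<^sup>2 = (u$1)\<^sup>2 + (u$2)\<^sup>2"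
    unfolding power2_norm_eq_inner inner_vec_def sum_2 by (simp add: power2_eq_square)
  moreover have "(norm (emb u + s *\<^sub>R n))\<^sup>2 = (u$1)\<^sup>2 + (u$2)\<^sup>2 + s\<^sup>2"
    unfolding power2_norm_eq_inner
    by (simp add: emb_def inner_add_left inner_add_right orth orth' unit power2_eq_square)
  ultimately show ?thesis by simp
qed

lemma norm_emb [simp]: "norm (emb u) = norm u"
  using norm_emb_height[of u 0] by simp

lemma proj_nth: "proj Q $ 1 = (Q - N) \<bullet> e1" "proj Q $ 2 = (Q - N) \<bullet> e2"
  by (simp_all add: proj_def)

lemma decomp: "Q = N + emb (proj Q) + ht Q *\<^sub>R n"
proof -
  have "Q = N + (Q - N)" by simp
  also have "Q - N = emb (proj Q) + ht Q *\<^sub>R n"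
    unfolding emb_def proj_nth ht_def by (rule expand)
  finally show ?thesis by (simp only: add.assoc)
qed

lemma proj_point [simp]: "proj (N + emb u + s *\<^sub>R n) = u"
  by (simp add: vec_eq_iff forall_2 proj_nth emb_def inner_add_left unit orth orth')

lemma ht_point [simp]: "ht (N + emb u + s *\<^sub>R n) = s"
  by (simp add: ht_def inner_add_left unit)

lemma dist_N: "(norm (Q - N))\<^sup>2 = (norm (proj Q))\<^sup>2 + (ht Q)\<^sup>2"
proof -
  from arg_cong[OF decomp[of Q], of "\<lambda>x. x - N"]
  have "Q - N = emb (proj Q) + ht Q *\<^sub>R n" by (simp only: add.assoc add_diff_cancel_left')
  then show ?thesis by (simp only: norm_emb_height)
qed

lemma diff_decomp: "Q - P = emb (proj Q - proj P) + (ht Q - ht P) *\<^sub>R n"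
proof -
  have "Q - P = (N + emb (proj Q) + ht Q *\<^sub>R n) - (N + emb (proj P) + ht P *\<^sub>R n)"
    using decomp by simp
  then show ?thesis by (simp add: emb_diff algebra_simps)
qed

lemma norm_diff: "(norm (Q - P))\<^sup>2 = (norm (proj Q - proj P))\<^sup>2 + (ht Q - ht P)\<^sup>2"
  unfolding diff_decomp norm_emb_height ..

lemma norm_proj_diff_le: "norm (proj Q - proj P) \<le> norm (Q - P)"
  by (rule power2_le_imp_le) (simp_all add: norm_diff[of Q P])

lemma ht_diff_le: "\<bar>ht Q - ht P\<bar> \<le> norm (Q - P)"
  by (rule power2_le_imp_le) (simp_all add: norm_diff[of Q P])

lemma continuous_on_ht [continuous_intros]: "continuous_on A f \<Longrightarrow> continuous_on A (\<lambda>x. ht (f x))"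
  unfolding ht_def by (intro continuous_intros)

lemma continuous_on_proj [continuous_intros]: "continuous_on A f \<Longrightarrow> continuous_on A (\<lambda>x. proj (f x))"
  unfolding proj_def
proof (intro continuous_on_vec_lambda)
  fix i :: 2 assume "continuous_on A f"
  then show "continuous_on A (\<lambda>x. if i = 1 then (f x - N) \<bullet> e1 else (f x - N) \<bullet> e2)"
    by (cases "i = 1") (auto intro!: continuous_intros)
qed

lemma continuous_on_emb [continuous_intros]: "continuous_on A f \<Longrightarrow> continuous_on A (\<lambda>x. emb (f x))"
  unfolding emb_def by (intro continuous_intros)

lemma proj_N [simp]: "proj N = 0" and ht_N [simp]: "ht N = 0"
  by (simp_all add: vec_eq_iff forall_2 proj_nth ht_def)

end

text \<open>The standard basis is carried over by an orthogonal map that takes the third axis to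
  \<open>n\<close>.\<close>

lemma frame_exists:
  fixes n :: "real^3"
  assumes "norm n = 1"
  shows "\<exists>e1 e2. frame e1 e2 n"
proof -
  obtain f :: "real^3 \<Rightarrow> real^3" where f: "orthogonal_transformation f" "f (axis 3 1) = n"
    using orthogonal_transformation_exists_1[of "axis 3 1" n] assms by auto
  have ip: "f x \<bullet> f y = x \<bullet> y" for x y using f(1) by (auto simp: orthogonal_transformation_def)
  have lin: "linear f" using f(1) by (rule orthogonal_transformation_linear)
  have "frame (f (axis 1 1)) (f (axis 2 1)) n"
  proof
    fix x
    obtain y where y: "x = f y" using orthogonal_transformation_surj[OF f(1)] by (meson surjD)
    have "y = (y $ 1) *\<^sub>R axis 1 1 + (y $ 2) *\<^sub>R axis 2 1 + (y $ 3) *\<^sub>R axis 3 1"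
      by (simp add: vec_eq_iff forall_3 axis_def)
    from arg_cong[OF this, of f]
    have "f y = (y $ 1) *\<^sub>R f (axis 1 1) + (y $ 2) *\<^sub>R f (axis 2 1) + (y $ 3) *\<^sub>R f (axis 3 1)"
      by (simp only: linear_add[OF lin] linear_scale[OF lin])
    then show "x = (x \<bullet> f (axis 1 1)) *\<^sub>R f (axis 1 1) + (x \<bullet> f (axis 2 1)) *\<^sub>R f (axis 2 1) + (x \<bullet> n) *\<^sub>R n"
      unfolding y f(2)[symmetric] ip by (simp add: inner_axis)
  qed (unfold f(2)[symmetric] ip, simp_all add: inner_axis_axis)
  then show ?thesis by blast
qed

text \<open>A chord is at most its arc: \<open>norm (u - v)\<close> squared is
  \<open>2 - 2 * cos t = 4 * (sin (t / 2))^2\<close>. This converts the condition on angles into a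
  Hoelder condition in norm.\<close>

lemma norm_diff_le_angle:
  fixes u v :: "real^3"
  assumes "norm u = 1" "norm v = 1"
  shows "norm (u - v) \<le> vec_angle u v"
proof -
  define t where "t = vec_angle u v"
  have b: "\<bar>u \<bullet> v\<bar> \<le> 1" using Cauchy_Schwarz_ineq2[of u v] assms by simp
  then have ct: "cos t = u \<bullet> v" and t0: "0 \<le> t" using assms
    by (auto simp: t_def vec_angle_def arccos_lbound)
  have "cos t = 1 - 2 * (sin (t / 2))\<^sup>2"
    using cos_double_sin[of "t / 2"] by simp
  moreover have "(sin (t / 2))\<^sup>2 \<le> (t / 2)\<^sup>2"
    using abs_sin_x_le_abs_x[of "t / 2"] by (rule abs_le_square_iff[THEN iffD1])
  ultimately have "2 - 2 * (u \<bullet> v) \<le> t\<^sup>2" using ct by (simp add: power_divide)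
  moreover have "(norm (u - v))\<^sup>2 = 2 - 2 * (u \<bullet> v)"
    using assms by (simp add: power2_norm_eq_inner inner_diff_left inner_diff_right inner_commute norm_eq_1)
  ultimately have "(norm (u - v))\<^sup>2 \<le> t\<^sup>2" by linarith
  from power2_le_imp_le[OF this t0] show ?thesis by (simp only: t_def)
qed

text \<open>Collects the local consequences of the Lyapunov conditions: in a cylinder over its
  tangent disc the surface is the graph of \<open>\<phi>\<close>. The derivative of
  \<open>\<phi>\<close> is expressed by the normal, so regularity of the graph is read off from
  \<open>\<nu>\<close> without any parametrization.\<close>

locale chart = frame N e1 e2 n for N e1 e2 n +
  fixes S :: "(real^3) set" and \<nu> :: "real^3 \<Rightarrow> real^3" and \<phi> :: "real^2 \<Rightarrow> real" and \<delta> \<eta> A l :: real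
  assumes pos: "0 < \<delta>" "0 < \<eta>" "0 < A" "0 < l" "l \<le> 1"
    and n_eq: "n = \<nu> N"
    and \<phi>_0: "\<phi> 0 = 0"
    and \<phi>_bound: "\<And>u. u \<in> ball 0 \<delta> \<Longrightarrow> \<bar>\<phi> u\<bar> < \<eta>"
    and graph_in: "\<And>u. u \<in> ball 0 \<delta> \<Longrightarrow> N + emb u + \<phi> u *\<^sub>R n \<in> S"
    and graph_unique: "\<And>Q. Q \<in> S \<Longrightarrow> proj Q \<in> ball 0 \<delta> \<Longrightarrow> \<bar>ht Q\<bar> < \<eta> \<Longrightarrow> ht Q = \<phi> (proj Q)"
    and unit_normal: "\<And>u. u \<in> ball 0 \<delta> \<Longrightarrow> norm (\<nu> (N + emb u + \<phi> u *\<^sub>R n)) = 1"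
    and normal_n: "\<And>u. u \<in> ball 0 \<delta> \<Longrightarrow> \<nu> (N + emb u + \<phi> u *\<^sub>R n) \<bullet> n \<ge> 1 / 2"
    and normal_Hoelder: "\<And>u v. u \<in> ball 0 \<delta> \<Longrightarrow> v \<in> ball 0 \<delta> \<Longrightarrow>
       norm (\<nu> (N + emb u + \<phi> u *\<^sub>R n) - \<nu> (N + emb v + \<phi> v *\<^sub>R n))
         \<le> A * norm ((N + emb u + \<phi> u *\<^sub>R n) - (N + emb v + \<phi> v *\<^sub>R n)) powr l"
    and \<phi>_deriv: "\<And>u. u \<in> ball 0 \<delta> \<Longrightarrow> (\<phi> has_derivative
       (\<lambda>v. - (\<nu> (N + emb u + \<phi> u *\<^sub>R n) \<bullet> emb v) / (\<nu> (N + emb u + \<phi> u *\<^sub>R n) \<bullet> n))) (at u)"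

text \<open>The condition on lines parallel to the normal makes the projection to the tangent plane
  injective near \<open>N\<close>. Composed with a local homeomorphism from the plane it is an
  injective continuous map of the plane, hence open. Its image therefore contains a disc, and the
  tangent planes then supply differentiability.\<close>

lemma lyapunov_chart:
  assumes L: "lyapunov_surface S \<nu>" and N: "N \<in> S" and W: "open W" "N \<in> W"
  shows "\<exists>e1 e2 \<phi> \<delta> \<eta> A l. chart N e1 e2 (\<nu> N) S \<nu> \<phi> \<delta> \<eta> A l \<and>
    (\<forall>Q. frame.proj N e1 e2 Q \<in> ball 0 \<delta> \<and> \<bar>frame.ht N (\<nu> N) Q\<bar> < \<eta> \<longrightarrow> Q \<in> W)"
proof -
  define n where "n = \<nu> N"
  have top: "topological_surface S" and normal: "\<And>Q. Q \<in> S \<Longrightarrow> unit_normal_at S Q (\<nu> Q)"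
    using L by (auto simp: lyapunov_surface_def)
  obtain d where d: "d > 0" "\<And>P Q. P \<in> S \<inter> ball N d \<Longrightarrow> Q \<in> S \<inter> ball N d \<Longrightarrow> \<exists>h. Q = P + h *\<^sub>R n \<Longrightarrow> Q = P"
    using L N unfolding lyapunov_surface_def n_def by meson
  obtain A l where A: "A > 0" "0 < l" "l \<le> 1"
    and ang: "\<And>P Q. P \<in> S \<Longrightarrow> Q \<in> S \<Longrightarrow> vec_angle (\<nu> P) (\<nu> Q) \<le> A * dist P Q powr l"
    using L unfolding lyapunov_surface_def by meson
  have unitN: "norm (\<nu> Q) = 1" if "Q \<in> S" for Q using normal[OF that] by (simp add: unit_normal_at_def)
  have Hoelder: "norm (\<nu> P - \<nu> Q) \<le> A * norm (P - Q) powr l" if "P \<in> S" "Q \<in> S" for P Q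
    using norm_diff_le_angle[OF unitN unitN, OF that] ang[OF that] by (simp add: dist_norm)
  have "norm n = 1" using unitN[OF N] by (simp add: n_def)
  from frame_exists[OF this] obtain e1 e2 where "frame e1 e2 n" by blast
  then interpret frame N e1 e2 n .
  obtain U0 where U0: "openin (top_of_set S) U0" "N \<in> U0" "U0 homeomorphic (UNIV :: (real^2) set)"
    using top N unfolding topological_surface_def by blast
  obtain U1 where U1: "open U1" "U0 = S \<inter> U1" using U0(1) by (auto simp: openin_open)
  obtain h h' where hom: "homeomorphism (UNIV :: (real^2) set) U0 h h'"
    using U0(3) homeomorphic_sym by (metis homeomorphic_def)
  obtain \<rho>0 where \<rho>0: "\<rho>0 > 0" "ball N \<rho>0 \<subseteq> U1 \<inter> W"
    using U1 U0 W by (metis Int_iff open_Int openE)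
  \<comment> \<open>The last entry makes \<open>A * \<rho> powr l\<close> at most 1, so nearby unit
    normals differ from \<open>n\<close> by at most 1 and satisfy
    \<open>\<nu> Q \<bullet> n \<ge> 1 / 2\<close>.\<close>
  define \<rho> where "\<rho> = min (min \<rho>0 d) ((1 / A) powr (1 / l))"
  have \<rho>: "\<rho> > 0" "\<rho> \<le> \<rho>0" "\<rho> \<le> d" "\<rho> \<le> (1 / A) powr (1 / l)" using \<rho>0 d A by (auto simp: \<rho>_def)
  define V where "V = S \<inter> ball N \<rho>"
  have VU0: "V \<subseteq> U0" using \<rho> \<rho>0 U1 by (auto simp: V_def)
  have inj: "inj_on proj V"
  proof (rule inj_onI)
    fix P Q assume PQ: "P \<in> V" "Q \<in> V" "proj P = proj Q"
    have "Q = P + (ht Q - ht P) *\<^sub>R n" using diff_decomp[of Q P] PQ(3) by (simp add: algebra_simps)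
    then have "Q = P" using PQ \<rho> by (intro d(2)) (auto simp: V_def)
    then show "P = Q" ..
  qed
  \<comment> \<open>Stated for all open \<open>G\<close>, because openness of the projection is also
    what makes its inverse \<open>gam\<close> continuous.\<close>
  have open_proj: "open (proj ` (V \<inter> G))" if "open G" for G
  proof -
    define B where "B = h -` (ball N \<rho> \<inter> G)"
    have ch: "continuous_on UNIV h" using hom by (auto simp: homeomorphism_def)
    have imh: "h ` UNIV = U0" using hom by (auto simp: homeomorphism_def)
    have inv: "h' (h x) = x" for x using hom by (auto simp: homeomorphism_def)
    have "open B" unfolding B_def using that by (intro open_vimage ch) auto
    moreover have hB: "h ` B = V \<inter> G"
    proof -
      have "U0 \<inter> ball N \<rho> = V" using VU0 U1 by (auto simp: V_def)
      moreover have "h ` B = (ball N \<rho> \<inter> G) \<inter> U0" unfolding B_def image_vimage_eq imh ..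
      ultimately show ?thesis by blast
    qed
    have "inj_on (\<lambda>x. proj (h x)) B"
    proof (rule inj_onI)
      fix x y assume xy: "x \<in> B" "y \<in> B" "proj (h x) = proj (h y)"
      then have "h x = h y" using hB inj by (auto dest: inj_onD)
      then show "x = y" using inv by metis
    qed
    moreover have "continuous_on B (\<lambda>x. proj (h x))"
      by (rule continuous_on_proj[OF continuous_on_subset[OF ch]]) auto
    ultimately have "open ((\<lambda>x. proj (h x)) ` B)" by (intro invariance_of_domain) auto
    also have "(\<lambda>x. proj (h x)) ` B = proj ` (V \<inter> G)" by (simp only: hB[symmetric] image_image)
    finally show ?thesis .
  qed
  \<comment> \<open>With \<open>\<delta> \<le> \<eta>\<close> a point of the cylinder has distance
    less than \<open>sqrt 2 * \<eta> < \<rho>\<close> from \<open>N\<close>.\<close>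
  define \<eta> where "\<eta> = \<rho> / 2"
  have "0 \<in> proj ` (V \<inter> ball N \<eta>)" using N \<rho> by (intro image_eqI[of _ _ N]) (auto simp: V_def \<eta>_def)
  then obtain \<delta>0 where \<delta>0: "\<delta>0 > 0" "ball 0 \<delta>0 \<subseteq> proj ` (V \<inter> ball N \<eta>)"
    using open_proj[of "ball N \<eta>"] by (meson open_ball openE)
  define \<delta> where "\<delta> = min \<delta>0 \<eta>"
  have \<delta>: "\<delta> > 0" "\<delta> \<le> \<delta>0" "\<delta> \<le> \<eta>" "\<eta> > 0" using \<delta>0 \<rho> by (auto simp: \<delta>_def \<eta>_def)
  define \<phi> where "\<phi> = (\<lambda>u. ht (inv_into V proj u))"
  define gam where "gam = (\<lambda>u. N + emb u + \<phi> u *\<^sub>R n)"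
  have gam_unique: "Q = gam (proj Q)" if "Q \<in> V" for Q
    using decomp[of Q] inv_into_f_f[OF inj that] by (simp add: gam_def \<phi>_def)
  have gam_exists: "\<exists>Q. Q \<in> V \<and> Q \<in> ball N \<eta> \<and> proj Q = u \<and> gam u = Q" if "u \<in> ball 0 \<delta>" for u
  proof -
    have "u \<in> proj ` (V \<inter> ball N \<eta>)" using that \<delta> \<delta>0 by auto
    then show ?thesis using gam_unique by fastforce
  qed
  have cyl: "Q \<in> ball N \<rho>" if "proj Q \<in> ball 0 \<delta>" "\<bar>ht Q\<bar> < \<eta>" for Q
  proof -
    have "(norm (proj Q))\<^sup>2 < \<eta>\<^sup>2" using that \<delta> by (intro power_strict_mono) auto
    moreover have "(ht Q)\<^sup>2 < \<eta>\<^sup>2" using that \<delta> by (metis abs_ge_zero power2_abs power_strict_mono zero_less_numeral)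
    moreover have "\<eta>\<^sup>2 + \<eta>\<^sup>2 \<le> \<rho>\<^sup>2" by (simp add: \<eta>_def power2_eq_square)
    ultimately have "(norm (Q - N))\<^sup>2 < \<rho>\<^sup>2" unfolding dist_N by linarith
    then show ?thesis using \<rho> by (auto simp: dist_norm norm_minus_commute intro: power2_less_imp_less)
  qed
  have gamS: "gam u \<in> S" if "u \<in> ball 0 \<delta>" for u using gam_exists[OF that] by (auto simp: V_def)
  have gamV: "gam u \<in> V" if "u \<in> ball 0 \<delta>" for u using gam_exists[OF that] by auto
  have proj_gam: "proj (gam u) = u" and ht_gam: "ht (gam u) = \<phi> u" for u by (simp_all add: gam_def)
  have close: "norm (\<nu> Q - n) \<le> 1" if "Q \<in> V" for Q
  proof -
    have "norm (Q - N) powr l \<le> ((1 / A) powr (1 / l)) powr l"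
      using that \<rho> A by (intro powr_mono2) (auto simp: V_def dist_norm norm_minus_commute)
    also have "\<dots> = 1 / A" using A by (simp add: powr_powr)
    finally show ?thesis using Hoelder[of Q N] that N A by (simp add: n_def V_def field_simps)
  qed
  have nn: "\<nu> Q \<bullet> n \<ge> 1 / 2" if "Q \<in> V" for Q
  proof -
    have "(norm (\<nu> Q - n))\<^sup>2 \<le> 1" using close[OF that] by (simp add: power_le_one)
    moreover have "(norm (\<nu> Q - n))\<^sup>2 = 2 - 2 * (\<nu> Q \<bullet> n)"
      using unitN[of Q] that unit by (simp add: power2_norm_eq_inner inner_diff_left inner_diff_right inner_commute norm_eq_1 V_def)
    ultimately show ?thesis by simp
  qed
  have cont_gam: "(gam \<longlongrightarrow> gam u) (at u)" if u: "u \<in> ball 0 \<delta>" for u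
  proof (rule topological_tendstoI)
    fix G assume G: "open G" "gam u \<in> G"
    have "u \<in> proj ` (V \<inter> G)" using gamV[OF u] G proj_gam[of u] by (intro image_eqI[of _ _ "gam u"]) auto
    then have "\<forall>\<^sub>F w in at u. w \<in> proj ` (V \<inter> G)"
      using open_proj[OF G(1)] by (rule eventually_at_in_open'[rotated])
    then show "\<forall>\<^sub>F w in at u. gam w \<in> G"
      by eventually_elim (use gam_unique in force)
  qed
  have deriv: "(\<phi> has_derivative (\<lambda>v. - (\<nu> (gam u) \<bullet> emb v) / (\<nu> (gam u) \<bullet> n))) (at u)" if u: "u \<in> ball 0 \<delta>" for u
  proof -
    define m where "m = \<nu> (gam u)"
    define c where "c = m \<bullet> n"
    have c: "c \<ge> 1 / 2" using nn[OF gamV[OF u]] by (simp add: c_def m_def)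
    have m1: "norm m = 1" using unitN[OF gamS[OF u]] by (simp add: m_def)
    define E where "E = (\<lambda>w. (gam w - gam u) \<bullet> m)"
    have lim: "((\<lambda>w. E w / norm (gam w - gam u)) \<longlongrightarrow> 0) (at u)"
    proof -
      have "((\<lambda>Q. ((Q - gam u) \<bullet> m) / norm (Q - gam u)) \<longlongrightarrow> 0) (at (gam u) within S)"
        using normal[OF gamS[OF u]] by (simp add: unit_normal_at_def m_def)
      moreover have "filterlim gam (at (gam u) within S) (at u)"
        unfolding filterlim_at
      proof
        have "\<forall>\<^sub>F w in at u. w \<in> ball 0 \<delta>" using u by (intro eventually_at_in_open') auto
        moreover have "\<forall>\<^sub>F w in at u. w \<noteq> u" by (simp add: eventually_at_filter)
        ultimately show "\<forall>\<^sub>F w in at u. gam w \<in> S \<and> gam w \<noteq> gam u"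
          by eventually_elim (use gamS proj_gam in metis)
      qed (rule cont_gam[OF u])
      ultimately show ?thesis unfolding E_def by (rule filterlim_compose)
    qed
    have Eeq: "E w = emb (w - u) \<bullet> m + (\<phi> w - \<phi> u) * c" for w
      unfolding E_def diff_decomp[of "gam w" "gam u"] proj_gam ht_gam
      by (simp add: inner_add_left inner_add_right c_def inner_commute)
    have nle: "norm (gam w - gam u) \<le> norm (w - u) + \<bar>\<phi> w - \<phi> u\<bar>" for w
      using norm_triangle_ineq[of "emb (w - u)" "(\<phi> w - \<phi> u) *\<^sub>R n"]
      unfolding diff_decomp[of "gam w" "gam u"] proj_gam ht_gam by simp
    have "\<forall>\<^sub>F w in at u. norm (E w / norm (gam w - gam u)) < 1 / 4"
      using order_tendstoD(2)[OF tendsto_norm_zero[OF lim], of "1 / 4"] by simp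
    \<comment> \<open>The tangency condition is relative to \<open>norm (gam w - gam u)\<close> and
      must become relative to \<open>norm (w - u)\<close>. The slope 1/2 of the normal beats the
      error 1/4, which bounds the first distance by a multiple of the second.\<close>
    have arith: "D * (1 / 2) \<le> x + 1 / 4 * g \<Longrightarrow> g \<le> x + D \<Longrightarrow> 0 \<le> x \<Longrightarrow> g \<le> 8 * x" for D g x :: real
      by linarith
    from \<open>\<forall>\<^sub>F w in at u. norm (E w / norm (gam w - gam u)) < 1 / 4\<close>
    have ev: "\<forall>\<^sub>F w in at u. norm (gam w - gam u) \<le> 8 * norm (w - u)"
    proof eventually_elim
      case (elim w)
      have "\<bar>E w\<bar> \<le> 1 / 4 * norm (gam w - gam u)"
      proof (cases "gam w = gam u")
        case True then show ?thesis by (simp add: E_def)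
      next
        case False then show ?thesis using elim by (simp add: field_simps)
      qed
      moreover have "\<bar>emb (w - u) \<bullet> m\<bar> \<le> norm (w - u)"
        using Cauchy_Schwarz_ineq2[of "emb (w - u)" m] m1 by simp
      moreover have "\<bar>\<phi> w - \<phi> u\<bar> * (1 / 2) \<le> \<bar>(\<phi> w - \<phi> u) * c\<bar>"
      proof -
        have "\<bar>(\<phi> w - \<phi> u) * c\<bar> = \<bar>\<phi> w - \<phi> u\<bar> * c" using c by (simp add: abs_mult)
        then show ?thesis using mult_left_mono[OF c abs_ge_zero[of "\<phi> w - \<phi> u"]] by simp
      qed
      ultimately have "\<bar>\<phi> w - \<phi> u\<bar> * (1 / 2) \<le> norm (w - u) + 1 / 4 * norm (gam w - gam u)"
        using Eeq[of w] by linarith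
      from arith[OF this nle norm_ge_zero] show ?case .
    qed
    have "((\<lambda>w. E w / norm (w - u)) \<longlongrightarrow> 0) (at u)"
    proof (rule Lim_null_comparison)
      show "((\<lambda>w. 8 * \<bar>E w / norm (gam w - gam u)\<bar>) \<longlongrightarrow> 0) (at u)"
        using tendsto_mult_right_zero[OF tendsto_rabs_zero[OF lim]] .
      have "\<forall>\<^sub>F w in at u. w \<noteq> u" by (simp add: eventually_at_filter)
      with ev show "\<forall>\<^sub>F w in at u. norm (E w / norm (w - u)) \<le> 8 * \<bar>E w / norm (gam w - gam u)\<bar>"
      proof eventually_elim
        case (elim w)
        then have "gam w \<noteq> gam u" using proj_gam by metis
        then have "\<bar>E w\<bar> * norm (gam w - gam u) \<le> \<bar>E w\<bar> * (8 * norm (w - u))"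
          using elim by (intro mult_left_mono) auto
        then show ?case using elim \<open>gam w \<noteq> gam u\<close> by (simp add: field_simps)
      qed
    qed
    then have "((\<lambda>w. 1 / c * (E w / norm (w - u))) \<longlongrightarrow> 0) (at u)"
      by (rule tendsto_mult_right_zero)
    moreover have "1 / c * (E w / norm (w - u)) = (\<phi> w - \<phi> u - (- (m \<bullet> emb (w - u)) / c)) / norm (w - u)" for w
      using c unfolding Eeq by (simp add: field_simps inner_commute)
    ultimately have "((\<lambda>w. (\<phi> w - \<phi> u - (- (m \<bullet> emb (w - u)) / c)) / norm (w - u)) \<longlongrightarrow> 0) (at u)"
      by simp
    moreover have "bounded_linear (\<lambda>v. - (m \<bullet> emb v) / c)"
      by (intro linear_conv_bounded_linear[THEN iffD1] linearI)
         (simp_all add: emb_add emb_scale inner_add_right add_divide_distrib algebra_simps diff_divide_distrib)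
    ultimately show ?thesis
      unfolding has_derivative_def m_def[symmetric] c_def[symmetric]
      by (simp add: has_derivative_at' has_derivative_def Lim_ident_at divide_inverse_commute)
  qed
  have gam_eq: "N + emb u + \<phi> u *\<^sub>R n = gam u" for u by (simp add: gam_def)
  have "chart N e1 e2 n S \<nu> \<phi> \<delta> \<eta> A l"
  proof (unfold_locales, unfold gam_eq)
    show "\<phi> 0 = 0"
    proof -
      have "N \<in> V" using N \<rho> by (simp add: V_def)
      from inv_into_f_f[OF inj this] show ?thesis by (simp add: \<phi>_def)
    qed
    show "\<bar>\<phi> u\<bar> < \<eta>" if "u \<in> ball 0 \<delta>" for u
    proof -
      have "gam u \<in> ball N \<eta>" using gam_exists[OF that] by auto
      then show ?thesis using ht_diff_le[of "gam u" N] ht_gam[of u] by (simp add: dist_norm norm_minus_commute)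
    qed
    show "ht Q = \<phi> (proj Q)" if "Q \<in> S" "proj Q \<in> ball 0 \<delta>" "\<bar>ht Q\<bar> < \<eta>" for Q
      using gam_unique[of Q] cyl[OF that(2,3)] that(1) ht_gam by (metis IntI V_def)
    show "norm (\<nu> (gam u) - \<nu> (gam v)) \<le> A * norm (gam u - gam v) powr l" if "u \<in> ball 0 \<delta>" "v \<in> ball 0 \<delta>" for u v
      by (rule Hoelder[OF gamS gamS, OF that])
  qed (use \<delta> A gamS unitN nn gamV deriv in \<open>auto simp: n_def\<close>)
  moreover have "Q \<in> W" if "proj Q \<in> ball 0 \<delta>" "\<bar>ht Q\<bar> < \<eta>" for Q
    using cyl[OF that] subset_ball[OF \<rho>(2), of N] \<rho>0(2) by blast
  ultimately show ?thesis
    unfolding n_def[symmetric] by blast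
qed

section \<open>Lipschitz and tangency estimates on the graph\<close>

context chart
begin

definition gam :: "real^2 \<Rightarrow> real^3" where "gam u = N + emb u + \<phi> u *\<^sub>R n"

lemmas graph_in_gam = graph_in[folded gam_def]
lemmas unit_normal_gam = unit_normal[folded gam_def]
lemmas normal_n_gam = normal_n[folded gam_def]
lemmas normal_Hoelder_gam = normal_Hoelder[folded gam_def]
lemmas \<phi>_deriv_gam = \<phi>_deriv[folded gam_def]

lemma proj_gam [simp]: "proj (gam u) = u" and ht_gam [simp]: "ht (gam u) = \<phi> u"
  by (simp_all add: gam_def)

lemma gam_0 [simp]: "gam 0 = N"
  by (simp add: gam_def \<phi>_0)

lemma normal_close:
  assumes "u \<in> ball 0 \<delta>" shows "norm (\<nu> (gam u) - n) \<le> 1"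
proof -
  have "(norm (\<nu> (gam u) - n))\<^sup>2 = 2 - 2 * (\<nu> (gam u) \<bullet> n)"
    using unit_normal_gam[OF assms] unit
    by (simp add: power2_norm_eq_inner inner_diff_left inner_diff_right inner_commute norm_eq_1)
  then have "(norm (\<nu> (gam u) - n))\<^sup>2 \<le> 1\<^sup>2" using normal_n_gam[OF assms] by simp
  then show ?thesis by (rule power2_le_imp_le) simp
qed

text \<open>Vectors of the tangent plane at \<open>N\<close> are orthogonal to \<open>n\<close>, so
  the gradient of \<open>\<phi>\<close> sees only the deviation of the normal from \<open>n\<close>;
  dividing by \<open>\<nu> (gam w) \<bullet> n \<ge> 1 / 2\<close> gives the factor 2. The constant
  \<open>\<kappa>\<close> is kept free because it can be made small on small discs.\<close>

lemma \<phi>_Lipschitz: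
  assumes \<rho>: "\<rho> \<le> \<delta>" and \<kappa>: "\<And>u. u \<in> ball 0 \<rho> \<Longrightarrow> norm (\<nu> (gam u) - n) \<le> \<kappa>"
    and uv: "u \<in> ball 0 \<rho>" "v \<in> ball 0 \<rho>"
  shows "\<bar>\<phi> u - \<phi> v\<bar> \<le> 2 * \<kappa> * norm (u - v)"
proof -
  have sub: "w \<in> ball 0 \<delta>" if "w \<in> ball 0 \<rho>" for w using that \<rho> by auto
  have "norm (\<phi> u - \<phi> v) \<le> 2 * \<kappa> * norm (u - v)"
  proof (rule differentiable_bound[OF convex_ball[of 0 \<rho>] _ _ uv])
    fix w :: "real^2" assume w: "w \<in> ball 0 \<rho>"
    show "(\<phi> has_derivative (\<lambda>v. - (\<nu> (gam w) \<bullet> emb v) / (\<nu> (gam w) \<bullet> n))) (at w within ball 0 \<rho>)"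
      using \<phi>_deriv_gam[OF sub[OF w]] by (rule has_derivative_at_withinI)
    show "onorm (\<lambda>v. - (\<nu> (gam w) \<bullet> emb v) / (\<nu> (gam w) \<bullet> n)) \<le> 2 * \<kappa>"
    proof (rule onorm_le)
      fix v
      have "\<bar>\<nu> (gam w) \<bullet> emb v\<bar> = \<bar>(\<nu> (gam w) - n) \<bullet> emb v\<bar>" by (simp add: inner_diff_left)
      also have "\<dots> \<le> \<kappa> * norm v"
        using Cauchy_Schwarz_ineq2[of "\<nu> (gam w) - n" "emb v"] mult_right_mono[OF \<kappa>[OF w] norm_ge_zero[of v]] by simp
      finally have 1: "\<bar>\<nu> (gam w) \<bullet> emb v\<bar> \<le> \<kappa> * norm v" .
      have c: "\<nu> (gam w) \<bullet> n \<ge> 1 / 2" by (rule normal_n_gam[OF sub[OF w]])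
      have "\<bar>\<nu> (gam w) \<bullet> emb v\<bar> / (\<nu> (gam w) \<bullet> n) \<le> \<kappa> * norm v / (1 / 2)"
        using 1 c by (intro frac_le) auto
      then show "norm (- (\<nu> (gam w) \<bullet> emb v) / (\<nu> (gam w) \<bullet> n)) \<le> 2 * \<kappa> * norm v"
        using c by simp
    qed
  qed
  then show ?thesis by simp
qed

lemma \<phi>_Lipschitz2:
  assumes "u \<in> ball 0 \<delta>" "v \<in> ball 0 \<delta>"
  shows "\<bar>\<phi> u - \<phi> v\<bar> \<le> 2 * norm (u - v)"
  using \<phi>_Lipschitz[of \<delta> 1] normal_close assms by simp

lemma gam_diff: "gam u - gam v = emb (u - v) + (\<phi> u - \<phi> v) *\<^sub>R n"
  by (simp add: diff_decomp)

lemma gam_Lipschitz: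
  assumes "u \<in> ball 0 \<delta>" "v \<in> ball 0 \<delta>"
  shows "norm (gam u - gam v) \<le> 3 * norm (u - v)"
  using norm_triangle_ineq[of "emb (u - v)" "(\<phi> u - \<phi> v) *\<^sub>R n"] \<phi>_Lipschitz2[OF assms]
  unfolding gam_diff by simp

lemma continuous_on_\<phi>: "continuous_on (ball 0 \<delta>) \<phi>"
  by (intro continuous_at_imp_continuous_on ballI has_derivative_continuous[OF \<phi>_deriv_gam])

lemma continuous_on_gam: "continuous_on (ball 0 \<delta>) gam"
  unfolding gam_def[abs_def] by (intro continuous_intros continuous_on_\<phi>)

lemma continuous_on_normal_gam: "continuous_on (ball 0 \<delta>) (\<lambda>u. \<nu> (gam u))"
  unfolding continuous_on_def
proof
  fix u :: "real^2" assume u: "u \<in> ball 0 \<delta>"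
  have "(gam \<longlongrightarrow> gam u) (at u within ball 0 \<delta>)"
    using continuous_on_gam u by (simp add: continuous_on_def)
  then have "((\<lambda>w. norm (gam w - gam u)) \<longlongrightarrow> 0) (at u within ball 0 \<delta>)"
    by (intro tendsto_norm_zero) (simp add: LIM_zero_iff)
  then have "((\<lambda>w. A * norm (gam w - gam u) powr l) \<longlongrightarrow> A * (0 powr l)) (at u within ball 0 \<delta>)"
    using pos by (intro tendsto_intros tendsto_powr') auto
  then have "((\<lambda>w. A * norm (gam w - gam u) powr l) \<longlongrightarrow> 0) (at u within ball 0 \<delta>)" by simp
  then have "((\<lambda>w. \<nu> (gam w) - \<nu> (gam u)) \<longlongrightarrow> 0) (at u within ball 0 \<delta>)"
  proof (rule Lim_null_comparison[rotated])
    have "\<forall>\<^sub>F w in at u within ball 0 \<delta>. w \<in> ball 0 \<delta>" by (simp add: eventually_at_filter)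
    then show "\<forall>\<^sub>F w in at u within ball 0 \<delta>. norm (\<nu> (gam w) - \<nu> (gam u)) \<le> A * norm (gam w - gam u) powr l"
      by eventually_elim (rule normal_Hoelder_gam[OF _ u])
  qed
  then show "((\<lambda>w. \<nu> (gam w)) \<longlongrightarrow> \<nu> (gam u)) (at u within ball 0 \<delta>)"
    by (simp add: LIM_zero_iff)
qed

text \<open>The derivative of \<open>gam\<close> is tangent, so only the variation of the normal along the segment contributes.\<close>

lemma tangential_bound:
  assumes u: "u \<in> ball 0 \<delta>" and v: "v \<in> ball 0 \<delta>"
  shows "\<bar>(gam u - gam v) \<bullet> \<nu> (gam u)\<bar> \<le> 3 * A * (3 * norm (u - v)) powr l * norm (u - v)"
proof -
  have sub: "w \<in> ball 0 \<delta>" if "w \<in> closed_segment v u" for w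
    using that closed_segment_subset[OF v u convex_ball] by blast
  have "norm (gam u \<bullet> \<nu> (gam u) - gam v \<bullet> \<nu> (gam u)) \<le> 3 * A * (3 * norm (u - v)) powr l * norm (u - v)"
  proof (rule differentiable_bound[OF convex_closed_segment[of v u]])
    fix w assume w: "w \<in> closed_segment v u"
    define m where "m = \<nu> (gam w)"
    define c where "c = m \<bullet> n"
    have c: "c \<ge> 1 / 2" unfolding c_def m_def by (rule normal_n_gam[OF sub[OF w]])
    define T where "T = (\<lambda>x. emb x + (- (m \<bullet> emb x) / c) *\<^sub>R n)"
    have bl: "bounded_linear emb" using linear_emb linear_conv_bounded_linear by blast
    have "(gam has_derivative T) (at w)"
      unfolding gam_def[abs_def] T_def
      using \<phi>_deriv_gam[OF sub[OF w]] bl unfolding m_def[symmetric] c_def[symmetric]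
      by (auto intro!: derivative_eq_intros bounded_linear.has_derivative[OF bl])
    then show "((\<lambda>w. gam w \<bullet> \<nu> (gam u)) has_derivative (\<lambda>x. T x \<bullet> \<nu> (gam u))) (at w within closed_segment v u)"
      by (rule has_derivative_inner_left[OF has_derivative_at_withinI])
    show "onorm (\<lambda>x. T x \<bullet> \<nu> (gam u)) \<le> 3 * A * (3 * norm (u - v)) powr l"
    proof (rule onorm_le)
      fix x
      have "T x \<bullet> m = emb x \<bullet> m - (m \<bullet> emb x) / c * (n \<bullet> m)"
        by (simp add: T_def inner_diff_left)
      then have "T x \<bullet> m = 0"
        using c by (simp add: c_def inner_commute)
      then have "T x \<bullet> \<nu> (gam u) = T x \<bullet> (\<nu> (gam u) - m)" by (simp add: inner_diff_right)
      then have 1: "\<bar>T x \<bullet> \<nu> (gam u)\<bar> \<le> norm (T x) * norm (\<nu> (gam u) - m)"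
        using Cauchy_Schwarz_ineq2[of "T x" "\<nu> (gam u) - m"] by simp
      have "\<bar>m \<bullet> emb x\<bar> \<le> norm x"
        using Cauchy_Schwarz_ineq2[of m "emb x"] unit_normal_gam[OF sub[OF w]] by (simp add: m_def)
      then have "\<bar>m \<bullet> emb x\<bar> / c \<le> norm x / (1 / 2)" using c by (intro frac_le) auto
      then have 2: "norm (T x) \<le> 3 * norm x"
        using norm_triangle_ineq[of "emb x" "(- (m \<bullet> emb x) / c) *\<^sub>R n"] c by (simp add: T_def)
      have "norm (u - w) \<le> norm (u - v)"
        using segment_bound(2)[of w v u] w by (simp add: norm_minus_commute)
      then have "norm (gam u - gam w) \<le> 3 * norm (u - v)"
        using gam_Lipschitz[OF u sub[OF w]] by simp
      then have "norm (gam u - gam w) powr l \<le> (3 * norm (u - v)) powr l"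
        using pos by (intro powr_mono2) auto
      then have 3: "norm (\<nu> (gam u) - m) \<le> A * (3 * norm (u - v)) powr l"
        using normal_Hoelder_gam[OF u sub[OF w]] pos unfolding m_def
        by (meson mult_left_mono order_trans less_imp_le)
      have "norm (T x) * norm (\<nu> (gam u) - m) \<le> (3 * norm x) * (A * (3 * norm (u - v)) powr l)"
        using 2 3 by (intro mult_mono) auto
      then show "norm (T x \<bullet> \<nu> (gam u)) \<le> 3 * A * (3 * norm (u - v)) powr l * norm x"
        using 1 by (simp add: mult_ac)
    qed
  qed auto
  then show ?thesis by (simp add: inner_diff_left)
qed

section \<open>The two sides of the surface in the cylinder\<close>

definition cylinder :: "(real^3) set" where
  "cylinder = {Q. proj Q \<in> ball 0 \<delta> \<and> \<bar>ht Q\<bar> < \<eta>}"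

lemma open_cylinder: "open cylinder"
proof -
  have "cylinder = proj -` ball 0 \<delta> \<inter> ht -` {-\<eta><..<\<eta>}" by (auto simp: cylinder_def)
  moreover have "continuous_on UNIV proj" "continuous_on UNIV ht"
    by (intro continuous_on_proj continuous_on_ht continuous_on_id)+
  ultimately show ?thesis by (auto intro!: open_Int open_vimage)
qed

lemma N_in_cylinder: "N \<in> cylinder" using pos by (simp add: cylinder_def)

lemma surface_in_cylinder: "Q \<in> S \<Longrightarrow> Q \<in> cylinder \<Longrightarrow> Q = gam (proj Q)"
  using graph_unique[of Q] decomp[of Q] by (simp add: cylinder_def gam_def)

lemma gam_in_cylinder: "u \<in> ball 0 \<delta> \<Longrightarrow> gam u \<in> cylinder"
  using \<phi>_bound by (simp add: cylinder_def)

text \<open>The layer between two graphs is a continuous image of the convex set of disc points and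
  heights.\<close>

lemma connected_graph_layer:
  assumes g: "continuous_on (ball 0 \<delta>) g" and h: "continuous_on (ball 0 \<delta>) h"
  shows "connected ((\<lambda>(u, t). N + emb u + ((1 - t) * g u + t * h u) *\<^sub>R n) ` (ball 0 \<delta> \<times> {0<..<1}))"
proof (rule connected_continuous_image)
  have "continuous_on (ball 0 \<delta> \<times> {0<..<1}) (\<lambda>x. g (fst x))" "continuous_on (ball 0 \<delta> \<times> {0<..<1}) (\<lambda>x. h (fst x))"
    by (rule continuous_on_compose2[OF g] continuous_on_compose2[OF h]; auto intro!: continuous_intros)+
  then show "continuous_on (ball 0 \<delta> \<times> {0<..<1::real}) (\<lambda>(u, t). N + emb u + ((1 - t) * g u + t * h u) *\<^sub>R n)"
    unfolding split_beta by (intro continuous_intros)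
qed (intro convex_connected convex_Times convex_ball convex_real_interval)

lemma graph_layer_iff:
  assumes gh: "\<And>u. u \<in> ball 0 \<delta> \<Longrightarrow> g u < h u"
  shows "(\<lambda>(u, t). N + emb u + ((1 - t) * g u + t * h u) *\<^sub>R n) ` (ball 0 \<delta> \<times> {0<..<1})
     = {Q. proj Q \<in> ball 0 \<delta> \<and> g (proj Q) < ht Q \<and> ht Q < h (proj Q)}" (is "?f ` _ = ?R")
proof (intro equalityI subsetI)
  fix Q assume "Q \<in> ?f ` (ball 0 \<delta> \<times> {0<..<1})"
  then obtain u t where ut: "u \<in> ball 0 \<delta>" "0 < t" "t < 1" "Q = N + emb u + ((1 - t) * g u + t * h u) *\<^sub>R n" by auto
  have "0 < t * (h u - g u)" "0 < (1 - t) * (h u - g u)" using ut gh[OF ut(1)] by auto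
  moreover have "proj Q = u" "ht Q = (1 - t) * g u + t * h u" unfolding ut(4) by simp_all
  ultimately show "Q \<in> ?R" using ut(1) by (simp add: algebra_simps)
next
  fix Q assume Q: "Q \<in> ?R"
  define u where "u = proj Q"
  define t where "t = (ht Q - g u) / (h u - g u)"
  have d: "h u - g u > 0" using gh[of u] Q by (simp add: u_def)
  have t: "0 < t" "t < 1" using Q d by (auto simp: t_def u_def)
  have "(1 - t) * g u + t * h u = g u + t * (h u - g u)" by (simp add: algebra_simps)
  also have "\<dots> = ht Q" using d by (simp add: t_def)
  finally have "Q = ?f (u, t)" using decomp[of Q] by (simp add: u_def)
  then show "Q \<in> ?f ` (ball 0 \<delta> \<times> {0<..<1})" using t Q by (intro image_eqI) (auto simp: u_def)
qed

text \<open>The layers below and above the graph are connected and miss the frontier of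
  \<open>D\<close>, so each lies entirely in \<open>D\<close> or entirely in its complement. The
  outward normal at the single point \<open>N\<close> decides which.\<close>

lemma domain_sides:
  assumes D: "open D" "frontier D \<inter> cylinder \<subseteq> S" and out: "points_outward D N n"
    and Q: "Q \<in> cylinder"
  shows "ht Q < \<phi> (proj Q) \<Longrightarrow> Q \<in> D" "ht Q > \<phi> (proj Q) \<Longrightarrow> Q \<notin> closure D"
proof -
  define L where "L = {Q. proj Q \<in> ball 0 \<delta> \<and> - \<eta> < ht Q \<and> ht Q < \<phi> (proj Q)}"
  define U where "U = {Q. proj Q \<in> ball 0 \<delta> \<and> \<phi> (proj Q) < ht Q \<and> ht Q < \<eta>}"
  note c\<phi> = continuous_on_\<phi>
  have conn: "connected L" "connected U"
    using connected_graph_layer[of "\<lambda>_. - \<eta>" \<phi>] graph_layer_iff[of "\<lambda>_. - \<eta>" \<phi>]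
      connected_graph_layer[of \<phi> "\<lambda>_. \<eta>"] graph_layer_iff[of \<phi> "\<lambda>_. \<eta>"] c\<phi> \<phi>_bound
    by (force simp: L_def U_def abs_less_iff)+
  have cyl: "L \<subseteq> cylinder" "U \<subseteq> cylinder" using \<phi>_bound by (fastforce simp: L_def U_def cylinder_def abs_less_iff)+
  have off: "Q \<notin> S" if "Q \<in> L \<union> U" for Q
  proof
    assume "Q \<in> S"
    moreover have "Q \<in> cylinder" using that cyl by blast
    ultimately have "ht Q = \<phi> (proj Q)" using graph_unique[of Q] by (simp add: cylinder_def)
    then show False using that by (simp add: L_def U_def)
  qed
  have fr: "L \<inter> frontier D = {}" "U \<inter> frontier D = {}" using off cyl D(2) by blast+
  have "\<forall>\<^sub>F h in at_right 0. h < \<eta> \<and> 0 < (h::real)"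
    using pos by (intro eventually_conj order_tendstoD(2)[OF tendsto_ident_at] eventually_at_right_less) auto
  with out[unfolded points_outward_def]
  have "\<forall>\<^sub>F h in at_right 0. N - h *\<^sub>R n \<in> D \<inter> L \<and> N + h *\<^sub>R n \<in> U - closure D"
  proof eventually_elim
    case (elim h)
    have p: "proj (N - h *\<^sub>R n) = 0" "ht (N - h *\<^sub>R n) = - h" "proj (N + h *\<^sub>R n) = 0" "ht (N + h *\<^sub>R n) = h"
      using proj_point[of 0 "- h"] ht_point[of 0 "- h"] proj_point[of 0 h] ht_point[of 0 h] by simp_all
    show ?case unfolding L_def U_def using elim pos by (auto simp: p \<phi>_0)
  qed
  then obtain h where h: "N - h *\<^sub>R n \<in> D \<inter> L" "N + h *\<^sub>R n \<in> U - closure D"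
    using eventually_happens'[of "at_right (0::real)"] by auto
  have LD: "L \<subseteq> D" using connected_Int_frontier[OF conn(1), of D] fr h by blast
  have UD: "U \<inter> D = {}" using connected_Int_frontier[OF conn(2), of D] fr h closure_subset[of D] by blast
  \<comment> \<open>The closure adds only frontier points to \<open>D\<close>, and \<open>U\<close>
    contains none of them.\<close>
  then have "U \<inter> closure D = {}" using fr(2) D(1) by (auto simp: frontier_def interior_open)
  then show "ht Q > \<phi> (proj Q) \<Longrightarrow> Q \<notin> closure D" using Q by (auto simp: U_def cylinder_def)
  show "ht Q < \<phi> (proj Q) \<Longrightarrow> Q \<in> D" using Q LD by (auto simp: L_def cylinder_def)
qed

lemma domain_sides_converse:
  assumes D: "open D" "frontier D \<inter> cylinder \<subseteq> S" "S \<subseteq> frontier D" and out: "points_outward D N n"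
    and Q: "Q \<in> cylinder"
  shows "Q \<in> D \<Longrightarrow> ht Q < \<phi> (proj Q)" "Q \<notin> closure D \<Longrightarrow> ht Q > \<phi> (proj Q)"
proof -
  have "Q \<in> S" if "ht Q = \<phi> (proj Q)"
    using graph_in_gam[of "proj Q"] decomp[of Q] that Q by (simp add: gam_def cylinder_def)
  then have eq: "Q \<notin> D \<and> Q \<in> closure D" if "ht Q = \<phi> (proj Q)"
    using that D by (auto simp: frontier_def interior_open)
  note * = domain_sides[OF D(1,2) out Q]
  show "Q \<in> D \<Longrightarrow> ht Q < \<phi> (proj Q)" using * eq closure_subset[of D] by (metis linorder_less_linear subsetD)
  show "Q \<notin> closure D \<Longrightarrow> ht Q > \<phi> (proj Q)" using * eq closure_subset[of D] by (metis linorder_less_linear subsetD)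
qed

end

section \<open>Integrals over the plane\<close>

text \<open>Parameters are pairs, whereas tangent coordinates and determinants live on
  \<open>real^2\<close>; this map transports Lebesgue measure between the two.\<close>

definition mk2 :: "real \<times> real \<Rightarrow> real^2" where
  "mk2 p = (\<chi> i. if i = 1 then fst p else snd p)"

lemma mk2_nth [simp]: "mk2 p $ 1 = fst p" "mk2 p $ 2 = snd p"
  by (simp_all add: mk2_def)

lemma mk2_measurable [measurable]: "mk2 \<in> borel_measurable borel"
proof (rule borel_measurable_continuous_onI)
  have eq: "mk2 = (\<lambda>p. fst p *\<^sub>R axis 1 1 + snd p *\<^sub>R axis 2 1)"
    by (rule ext) (simp add: vec_eq_iff forall_2 axis_def)
  show "continuous_on UNIV mk2" unfolding eq by (intro continuous_intros)
qed

lemma Basis_real_pair: "(Basis :: (real \<times> real) set) = {(1, 0), (0, 1)}"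
  by (auto simp: Basis_prod_def)

lemma distr_mk2: "distr (lborel :: (real \<times> real) measure) borel mk2 = lborel"
proof (rule lborel_eqI[symmetric])
  fix l u :: "real^2" assume le: "\<And>b. b \<in> Basis \<Longrightarrow> l \<bullet> b \<le> u \<bullet> b"
  have le': "l $ i \<le> u $ i" for i using le[of "axis i 1"] by (simp add: inner_axis)
  have B2: "(Basis :: (real^2) set) = {axis 1 1, axis 2 1}"
    by (auto simp: Basis_vec_def UNIV_2)
  have ne: "axis 1 1 \<noteq> (axis 2 1 :: real^2)" by (simp add: axis_eq_axis)
  have "mk2 -` box l u = box (l $ 1, l $ 2) (u $ 1, u $ 2)"
    by (auto simp: box_def B2 Basis_real_pair inner_axis)
  then have "emeasure (distr (lborel :: (real \<times> real) measure) borel mk2) (box l u) = emeasure lborel (box (l $ 1, l $ 2) (u $ 1, u $ 2))"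
    by (subst emeasure_distr) auto
  also have "\<dots> = (\<Prod>b\<in>Basis. ((u $ 1, u $ 2) - (l $ 1, l $ 2)) \<bullet> b)"
    by (rule emeasure_lborel_box) (auto simp: Basis_real_pair le')
  also have "\<dots> = (\<Prod>b\<in>Basis. (u - l) \<bullet> b)"
    using ne by (simp add: Basis_real_pair B2 inner_axis)
  finally show "emeasure (distr (lborel :: (real \<times> real) measure) borel mk2) (box l u) = (\<Prod>b\<in>Basis. (u - l) \<bullet> b)" .
qed simp

lemma nn_integral_mk2:
  assumes [measurable]: "f \<in> borel_measurable borel"
  shows "(\<integral>\<^sup>+x. f x \<partial>(lborel :: (real^2) measure)) = (\<integral>\<^sup>+a. \<integral>\<^sup>+b. f (mk2 (a, b)) \<partial>lborel \<partial>lborel)"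
proof -
  have "(\<integral>\<^sup>+x. f x \<partial>(lborel :: (real^2) measure)) = (\<integral>\<^sup>+p. f (mk2 p) \<partial>lborel)"
    by (subst distr_mk2[symmetric], subst nn_integral_distr) auto
  also have "\<dots> = (\<integral>\<^sup>+p. f (mk2 p) \<partial>(lborel \<Otimes>\<^sub>M lborel))" by (simp only: lborel_prod)
  also have "\<dots> = (\<integral>\<^sup>+a. \<integral>\<^sup>+b. f (mk2 (a, b)) \<partial>lborel \<partial>lborel)"
    by (rule lborel.nn_integral_fst[symmetric]) (simp add: lborel_prod)
  finally show ?thesis .
qed

lemma norm_mk2: "(norm (mk2 (a, b)))\<^sup>2 = a\<^sup>2 + b\<^sup>2"
  unfolding power2_norm_eq_inner inner_vec_def sum_2 by (simp add: power2_eq_square)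

section \<open>Weakly singular and Poisson integrals\<close>

lemma nn_integral_powr_abs_finite:
  assumes c: "-1 < c" and \<rho>: "0 \<le> \<rho>"
  shows "(\<integral>\<^sup>+x. ennreal (\<bar>x\<bar> powr c * indicator {-\<rho>..\<rho>} x) \<partial>lborel) < \<infinity>"
proof -
  have i1: "(\<lambda>x. \<bar>x\<bar> powr c) integrable_on {0..\<rho>}"
    using integrable_on_powr_from_0[OF c \<rho>] by (rule integrable_eq) auto
  then have i2: "(\<lambda>x. \<bar>x\<bar> powr c) integrable_on {-\<rho>..0}"
    using Henstock_Kurzweil_Integration.integrable_reflect_real[where f = "\<lambda>x. \<bar>x\<bar> powr c" and a = 0 and b = \<rho>] by simp
  have "(\<lambda>x. \<bar>x\<bar> powr c) integrable_on {-\<rho>..\<rho>}"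
    by (rule Henstock_Kurzweil_Integration.integrable_combine[OF _ _ i2 i1]) (use \<rho> in auto)
  then obtain I where I: "((\<lambda>x. \<bar>x\<bar> powr c) has_integral I) {-\<rho>..\<rho>}" by blast
  have "(\<integral>\<^sup>+x. ennreal (\<bar>x\<bar> powr c) * indicator {-\<rho>..\<rho>} x \<partial>lborel) = ennreal I"
    by (rule nn_integral_has_integral_lebesgue'[OF _ I]) simp
  moreover have "ennreal (\<bar>x\<bar> powr c * indicator {-\<rho>..\<rho>} x) = ennreal (\<bar>x\<bar> powr c) * indicator {-\<rho>..\<rho>} x" for x
    by (simp split: split_indicator)
  ultimately show ?thesis by simp
qed

text \<open>Since \<open>\<bar>x\<bar> * \<bar>y\<bar> \<le> x\<^sup>2 + y\<^sup>2\<close>, a product of two one-dimensional singularities dominates.\<close>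

lemma integrable_norm_powr:
  assumes b: "0 \<le> b" "b < 2" and \<rho>: "0 \<le> \<rho>"
  shows "integrable (lborel :: (real^2) measure) (\<lambda>x. norm x powr (- b) * indicator (ball 0 \<rho>) x)"
proof (rule integrableI_bounded)
  have meas: "(\<lambda>x::real^2. norm x powr (- b) * indicator (ball 0 \<rho>) x) \<in> borel_measurable borel"
    by (intro borel_measurable_times powr_real_measurable borel_measurable_norm borel_measurable_indicator) auto
  then show "(\<lambda>x::real^2. norm x powr (- b) * indicator (ball 0 \<rho>) x) \<in> borel_measurable lborel" by simp
  let ?g = "\<lambda>a::real. \<bar>a\<bar> powr (- (b / 2)) * indicator {-\<rho>..\<rho>} a"
  have g[measurable]: "?g \<in> borel_measurable borel" by simp
  have fin: "(\<integral>\<^sup>+a. ennreal (?g a) \<partial>lborel) < \<infinity>"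
    by (rule nn_integral_powr_abs_finite) (use b \<rho> in auto)
  \<comment> \<open>On the axes the majorant is 0, since \<open>0 powr\<close> anything is 0, so the
    bound can fail there; the axes are null sets.\<close>
  have AE0: "AE a in lborel. a \<noteq> (0::real)"
    by (rule AE_lborel_singleton)
  have le: "norm (mk2 (x, y)) powr (- b) * indicator (ball 0 \<rho>) (mk2 (x, y)) \<le> ?g x * ?g y" if "x \<noteq> 0" "y \<noteq> 0" for x y
  proof (cases "norm (mk2 (x, y)) < \<rho>")
    case True
    define m where "m = norm (mk2 (x, y))"
    have m2: "m\<^sup>2 = x\<^sup>2 + y\<^sup>2" unfolding m_def by (rule norm_mk2)
    have m0: "0 \<le> m" by (simp add: m_def)
    have "\<bar>x\<bar>\<^sup>2 \<le> m\<^sup>2" "\<bar>y\<bar>\<^sup>2 \<le> m\<^sup>2" unfolding m2 by simp_all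
    then have le_m: "\<bar>x\<bar> \<le> m" "\<bar>y\<bar> \<le> m" using m0 by (auto intro: power2_le_imp_le)
    have m\<rho>: "m < \<rho>" using True by (simp only: m_def)
    have xy: "\<bar>x\<bar> * \<bar>y\<bar> \<le> m * m" "\<bar>x\<bar> \<le> \<rho>" "\<bar>y\<bar> \<le> \<rho>" "0 < m"
      using m\<rho> that le_m m0 mult_mono[OF le_m m0 abs_ge_zero] by auto
    have "m powr (- b) = (m * m) powr (- (b / 2))"
      using xy by (simp add: powr_mult flip: powr_add)
    also have "\<dots> \<le> (\<bar>x\<bar> * \<bar>y\<bar>) powr (- (b / 2))"
      using xy b that by (intro powr_mono2') auto
    also have "\<dots> = \<bar>x\<bar> powr (- (b / 2)) * \<bar>y\<bar> powr (- (b / 2))" by (simp add: powr_mult)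
    finally have "m powr (- b) \<le> \<bar>x\<bar> powr (- (b / 2)) * \<bar>y\<bar> powr (- (b / 2))" .
    moreover have "indicator {-\<rho>..\<rho>} x = (1::real)" "indicator {-\<rho>..\<rho>} y = (1::real)"
      using xy by (auto simp: indicator_def abs_le_iff)
    moreover have "indicator (ball 0 \<rho>) (mk2 (x, y)) = (1::real)" using True by simp
    ultimately show ?thesis unfolding m_def by (simp only: mult_1_right)
  qed (auto simp: indicator_def)
  have "(\<integral>\<^sup>+x. ennreal (norm (norm x powr (- b) * indicator (ball 0 \<rho>) x)) \<partial>(lborel :: (real^2) measure))
    = (\<integral>\<^sup>+x. \<integral>\<^sup>+y. ennreal (norm (mk2 (x, y)) powr (- b) * indicator (ball 0 \<rho>) (mk2 (x, y))) \<partial>lborel \<partial>lborel)"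
    by (subst nn_integral_mk2) (auto simp: abs_mult meas)
  also have "\<dots> \<le> (\<integral>\<^sup>+x. \<integral>\<^sup>+y. ennreal (?g x) * ennreal (?g y) \<partial>lborel \<partial>lborel)"
  proof (rule nn_integral_mono_AE)
    show "AE x in lborel. (\<integral>\<^sup>+y. ennreal (norm (mk2 (x, y)) powr (- b) * indicator (ball 0 \<rho>) (mk2 (x, y))) \<partial>lborel)
       \<le> (\<integral>\<^sup>+y. ennreal (?g x) * ennreal (?g y) \<partial>lborel)"
      using AE0
    proof eventually_elim
      case (elim x)
      show ?case
      proof (rule nn_integral_mono_AE)
        show "AE y in lborel. ennreal (norm (mk2 (x, y)) powr (- b) * indicator (ball 0 \<rho>) (mk2 (x, y))) \<le> ennreal (?g x) * ennreal (?g y)"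
          using AE0
        proof eventually_elim
          case (elim y)
          have "ennreal (?g x) * ennreal (?g y) = ennreal (?g x * ?g y)"
            by (rule ennreal_mult'[symmetric]) (simp add: indicator_def)
          then show ?case using le[OF \<open>x \<noteq> 0\<close> elim] by (simp only: ennreal_leI)
        qed
      qed
    qed
  qed
  also have "\<dots> = (\<integral>\<^sup>+x. ennreal (?g x) * (\<integral>\<^sup>+y. ennreal (?g y) \<partial>lborel) \<partial>lborel)"
    by (subst nn_integral_cmult) auto
  also have "\<dots> = (\<integral>\<^sup>+x. ennreal (?g x) \<partial>lborel) * (\<integral>\<^sup>+y. ennreal (?g y) \<partial>lborel)"
    by (rule nn_integral_multc) auto
  also have "\<dots> < \<infinity>" using fin by (simp add: ennreal_mult_less_top)
  finally show "(\<integral>\<^sup>+x. ennreal (norm (norm x powr (- b) * indicator (ball 0 \<rho>) x)) \<partial>(lborel :: (real^2) measure)) < \<infinity>" .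
qed

lemma nn_integral_FTC_UNIV:
  fixes f F :: "real \<Rightarrow> real"
  assumes F: "\<And>x. DERIV F x :> f x" and f: "continuous_on UNIV f" "\<And>x. 0 \<le> f x"
    and A: "(F \<longlongrightarrow> A) at_bot" and B: "(F \<longlongrightarrow> B) at_top"
  shows "(\<integral>\<^sup>+x. ennreal (f x) \<partial>lborel) = ennreal (B - A)"
proof -
  have e: "einterval (-\<infinity>) \<infinity> = UNIV" by (auto simp: einterval_def)
  have "set_integrable lborel (einterval (-\<infinity>) \<infinity>) f" "(LBINT x=-\<infinity>..\<infinity>. f x) = B - A"
    by (rule interval_integral_FTC_nonneg[where F = F];
        use assms in \<open>auto simp: ereal_tendsto_simps continuous_on_eq_continuous_at\<close>)+
  then have "integrable lborel f" "integral\<^sup>L lborel f = B - A"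
    unfolding interval_lebesgue_integral_def e set_integrable_def set_lebesgue_integral_def by auto
  then show ?thesis using f by (subst nn_integral_eq_integral) auto
qed

text \<open>The antiderivative is \<open>y / (c * sqrt (c + y^2))\<close>, written with
  \<open>sin\<close> and \<open>arctan\<close> so that its limits at both infinities are
  immediate.\<close>

lemma nn_integral_poisson_inner:
  assumes c: "0 < c"
  shows "(\<integral>\<^sup>+y. ennreal (1 / sqrt (c + y\<^sup>2) ^ 3) \<partial>lborel) = ennreal (2 / c)"
proof -
  define F where "F = (\<lambda>y. sin (arctan (y / sqrt c)) / c)"
  have s: "sqrt c > 0" using c by simp
  have cp: "c + y\<^sup>2 > 0" for y :: real using c by (simp add: add_pos_nonneg)
  have "(\<integral>\<^sup>+y. ennreal (1 / sqrt (c + y\<^sup>2) ^ 3) \<partial>lborel) = ennreal (1 / c - (- 1 / c))"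
  proof (rule nn_integral_FTC_UNIV[where F = F])
    fix y
    have "(F has_real_derivative cos (arctan (y / sqrt c)) * (inverse (1 + (y / sqrt c)\<^sup>2) * (1 / sqrt c)) / c) (at y)"
      unfolding F_def
      by (intro DERIV_cdivide DERIV_chain2[OF DERIV_sin] DERIV_chain2[OF DERIV_arctan] DERIV_ident)
    also have "cos (arctan (y / sqrt c)) * (inverse (1 + (y / sqrt c)\<^sup>2) * (1 / sqrt c)) / c = 1 / sqrt (c + y\<^sup>2) ^ 3"
    proof -
      have e: "1 + (y / sqrt c)\<^sup>2 = (c + y\<^sup>2) / c" using c by (simp add: power_divide field_simps)
      have "sqrt (c + y\<^sup>2) ^ 3 = sqrt (c + y\<^sup>2) * (c + y\<^sup>2)"
        using cp[of y] by (simp add: power3_eq_cube)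
      moreover have "1 / (r / s) * (inverse (k / c) * (1 / s)) / c = 1 / (r * k)" if "s > 0" "r > 0" "k > 0" for r s k :: real
        using that c by (simp add: field_simps)
      from this[OF s _ cp[of y], of "sqrt (c + y\<^sup>2)"]
      have "1 / (sqrt (c + y\<^sup>2) / sqrt c) * (inverse ((c + y\<^sup>2) / c) * (1 / sqrt c)) / c = 1 / (sqrt (c + y\<^sup>2) * (c + y\<^sup>2))"
        using cp[of y] by simp
      ultimately show ?thesis unfolding cos_arctan e real_sqrt_divide by (simp only:)
    qed
    finally show "DERIV F y :> 1 / sqrt (c + y\<^sup>2) ^ 3" .
  next
    show "continuous_on UNIV (\<lambda>y. 1 / sqrt (c + y\<^sup>2) ^ 3)"
      using cp by (intro continuous_intros) (metis less_irrefl real_sqrt_gt_zero zero_less_power)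
    show "0 \<le> 1 / sqrt (c + y\<^sup>2) ^ 3" for y using cp[of y] by simp
    have "((\<lambda>y. arctan (y / sqrt c)) \<longlongrightarrow> pi / 2) at_top" "((\<lambda>y. arctan (y / sqrt c)) \<longlongrightarrow> - (pi / 2)) at_bot"
    proof -
      have "filterlim (\<lambda>y. y / sqrt c) at_top at_top" "filterlim (\<lambda>y. y / sqrt c) at_bot at_bot"
        using s filterlim_tendsto_pos_mult_at_top[of "\<lambda>_. 1 / sqrt c" "1 / sqrt c" at_top "\<lambda>y. y"]
          filterlim_tendsto_pos_mult_at_bot[of "\<lambda>_. 1 / sqrt c" "1 / sqrt c" at_bot "\<lambda>y. y"] 
        by (simp_all add: filterlim_ident)
      from filterlim_compose[OF tendsto_arctan_at_top this(1)] filterlim_compose[OF tendsto_arctan_at_bot this(2)]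
      show "((\<lambda>y. arctan (y / sqrt c)) \<longlongrightarrow> pi / 2) at_top" "((\<lambda>y. arctan (y / sqrt c)) \<longlongrightarrow> - (pi / 2)) at_bot"
        by simp_all
    qed
    note tendsto_divide[OF tendsto_sin[OF this(1)] tendsto_const, of c]
      tendsto_divide[OF tendsto_sin[OF this(2)] tendsto_const, of c]
    then show "(F \<longlongrightarrow> 1 / c) at_top" "(F \<longlongrightarrow> - 1 / c) at_bot"
      using c by (simp_all add: F_def)
  qed
  then show ?thesis by simp
qed

text \<open>Iterated integration takes the place of polar coordinates: the inner integral is
  \<open>2 / (1 + x^2)\<close>, and an arctangent finishes.\<close>

lemma nn_integral_poisson:
  "(\<integral>\<^sup>+x. ennreal (1 / sqrt (1 + (norm x)\<^sup>2) ^ 3) \<partial>(lborel :: (real^2) measure)) = ennreal (2 * pi)"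
proof -
  have "(\<integral>\<^sup>+x. ennreal (1 / sqrt (1 + (norm x)\<^sup>2) ^ 3) \<partial>(lborel :: (real^2) measure)) =
    (\<integral>\<^sup>+x. \<integral>\<^sup>+y. ennreal (1 / sqrt ((1 + x\<^sup>2) + y\<^sup>2) ^ 3) \<partial>lborel \<partial>lborel)"
    by (subst nn_integral_mk2) (auto simp: norm_mk2 add.assoc)
  also have "\<dots> = (\<integral>\<^sup>+x. ennreal (2 / (1 + x\<^sup>2)) \<partial>lborel)"
    by (subst nn_integral_poisson_inner) (auto simp: add_pos_nonneg)
  also have "\<dots> = ennreal (pi - (- pi))"
  proof (rule nn_integral_FTC_UNIV[where F = "\<lambda>x. 2 * arctan x"])
    fix x :: real
    show "((\<lambda>x. 2 * arctan x) has_real_derivative 2 / (1 + x\<^sup>2)) (at x)"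
      by (auto intro!: derivative_eq_intros simp: divide_inverse)
    show "0 \<le> 2 / (1 + x\<^sup>2)" by simp
  next
    have "1 + x\<^sup>2 \<noteq> 0" for x :: real using zero_le_power2[of x] by linarith
    then show "continuous_on UNIV (\<lambda>x::real. 2 / (1 + x\<^sup>2))" by (intro continuous_intros) auto
    show "((\<lambda>x. 2 * arctan x) \<longlongrightarrow> - pi) at_bot" "((\<lambda>x. 2 * arctan x) \<longlongrightarrow> pi) at_top"
      using tendsto_mult[OF tendsto_const[of "2::real"] tendsto_arctan_at_bot] tendsto_mult[OF tendsto_const[of "2::real"] tendsto_arctan_at_top]
      by simp_all
  qed
  finally show ?thesis by simp
qed

lemma poisson_integral:
  "integrable (lborel :: (real^2) measure) (\<lambda>x. 1 / sqrt (1 + (norm x)\<^sup>2) ^ 3)"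
  "integral\<^sup>L (lborel :: (real^2) measure) (\<lambda>x. 1 / sqrt (1 + (norm x)\<^sup>2) ^ 3) = 2 * pi"
proof -
  show i: "integrable (lborel :: (real^2) measure) (\<lambda>x. 1 / sqrt (1 + (norm x)\<^sup>2) ^ 3)"
    by (rule integrableI_nn_integral_finite[where x = "2 * pi"]) (auto simp: nn_integral_poisson)
  have "ennreal (integral\<^sup>L (lborel :: (real^2) measure) (\<lambda>x. 1 / sqrt (1 + (norm x)\<^sup>2) ^ 3)) = ennreal (2 * pi)"
    using nn_integral_eq_integral[OF i] nn_integral_poisson by simp
  then show "integral\<^sup>L (lborel :: (real^2) measure) (\<lambda>x. 1 / sqrt (1 + (norm x)\<^sup>2) ^ 3) = 2 * pi"
    by (subst (asm) ennreal_inj) (auto intro!: integral_nonneg_AE)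
qed

section \<open>The area formula in a chart\<close>

text \<open>The triple product expansion of \<open>cross3 m (cross3 a b)\<close> vanishes term by
  term, and a vector with zero cross product with the unit vector \<open>m\<close> is a multiple of
  it.\<close>

lemma cross_parallel_normal:
  fixes a b m :: "real^3"
  assumes m: "norm m = 1" and ab: "a \<bullet> m = 0" "b \<bullet> m = 0"
  shows "cross3 a b = (cross3 a b \<bullet> m) *\<^sub>R m" "\<bar>cross3 a b \<bullet> m\<bar> = norm (cross3 a b)"
proof -
  define X where "X = cross3 a b"
  have "cross3 m X = 0"
    using ab by (simp add: X_def Lagrange inner_commute)
  then have "(m \<bullet> X)\<^sup>2 = (norm X)\<^sup>2" using norm_cross_dot[of m X] m by simp
  then have 1: "(X \<bullet> m)\<^sup>2 = (norm X)\<^sup>2" by (simp add: inner_commute)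
  then have 2: "\<bar>X \<bullet> m\<bar> = norm X" by (metis abs_norm_cancel power2_eq_iff_nonneg abs_ge_zero power2_abs)
  have "(norm (X - (X \<bullet> m) *\<^sub>R m))\<^sup>2 = (norm X)\<^sup>2 - 2 * (X \<bullet> m)\<^sup>2 + (X \<bullet> m)\<^sup>2 * (m \<bullet> m)"
    unfolding power2_norm_eq_inner
    by (simp add: inner_diff_left inner_diff_right inner_commute power2_eq_square algebra_simps)
  also have "\<dots> = 0" using 1 m by (simp add: norm_eq_1)
  finally have "X = (X \<bullet> m) *\<^sub>R m" by simp
  then show "cross3 a b = (cross3 a b \<bullet> m) *\<^sub>R m" "\<bar>cross3 a b \<bullet> m\<bar> = norm (cross3 a b)"
    using 2 unfolding X_def by auto
qed

text \<open>The determinant is the inner product of \<open>cross3 a b\<close> with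
  \<open>cross3 e1 e2\<close>. The latter is \<open>n\<close> up to sign, the frame not being
  oriented; hence the absolute value. This is the relation of the surface element to the area
  element of the tangent plane.\<close>

lemma (in frame) det_proj_eq:
  assumes m: "norm m = 1" "0 < m \<bullet> n" and ab: "a \<bullet> m = 0" "b \<bullet> m = 0"
  shows "\<bar>(a \<bullet> e1) * (b \<bullet> e2) - (b \<bullet> e1) * (a \<bullet> e2)\<bar> = norm (cross3 a b) * (m \<bullet> n)"
proof -
  define c where "c = cross3 e1 e2 \<bullet> n"
  have "cross3 e1 e2 \<bullet> e1 = 0" "cross3 e1 e2 \<bullet> e2 = 0"
    using dot_cross_self[of e1 e2] by (simp_all add: inner_commute)
  then have c: "cross3 e1 e2 = c *\<^sub>R n" using expand[of "cross3 e1 e2"] by (simp add: c_def)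
  have "(norm (cross3 e1 e2))\<^sup>2 = 1"
    using norm_cross_dot[of e1 e2] unit orth by (simp add: norm_eq_sqrt_inner)
  then have c1: "\<bar>c\<bar> = 1" unfolding c by (simp add: power2_eq_1_iff abs_if split: if_splits)
  have "(a \<bullet> e1) * (b \<bullet> e2) - (b \<bullet> e1) * (a \<bullet> e2) = cross3 a b \<bullet> cross3 e1 e2"
    by (simp add: dot_cross inner_commute mult.commute)
  also have "\<dots> = c * (cross3 a b \<bullet> n)" unfolding c by simp
  also have "cross3 a b \<bullet> n = (cross3 a b \<bullet> m) * (m \<bullet> n)"
    by (subst cross_parallel_normal(1)[OF m(1) ab]) simp
  finally show ?thesis
    using c1 cross_parallel_normal(2)[OF m(1) ab] m(2) by (simp add: abs_mult)
qed

lemma set_integrable_lebesgue_lborel: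
  fixes f :: "'a::euclidean_space \<Rightarrow> real"
  assumes "(\<lambda>x. indicator S x * f x) \<in> borel_measurable borel"
  shows "f absolutely_integrable_on S \<longleftrightarrow> set_integrable lborel S f"
    and "f absolutely_integrable_on S \<Longrightarrow> integral S f = set_lebesgue_integral lborel S f"
proof -
  have m: "(\<lambda>x. indicator S x *\<^sub>R f x) \<in> borel_measurable lborel" using assms by simp
  show *: "f absolutely_integrable_on S \<longleftrightarrow> set_integrable lborel S f"
    unfolding set_integrable_def by (rule integrable_completion[OF m])
  assume f: "f absolutely_integrable_on S"
  have "integral S f = set_lebesgue_integral lebesgue S f"
    by (rule set_lebesgue_integral_eq_integral(2)[OF f, symmetric])
  also have "\<dots> = set_lebesgue_integral lborel S f"
    unfolding set_lebesgue_integral_def by (rule integral_completion[OF m])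
  finally show "integral S f = set_lebesgue_integral lborel S f" .
qed

lemma change_of_variables_real:
  fixes f :: "real^2 \<Rightarrow> real" and g :: "real^2 \<Rightarrow> real^2"
  assumes S: "S \<in> sets lebesgue"
    and der_g: "\<And>x. x \<in> S \<Longrightarrow> (g has_derivative g' x) (at x within S)"
    and inj: "inj_on g S"
  shows "(\<lambda>x. \<bar>det (matrix (g' x))\<bar> * f (g x)) absolutely_integrable_on S \<and>
           integral S (\<lambda>x. \<bar>det (matrix (g' x))\<bar> * f (g x)) = b
     \<longleftrightarrow> f absolutely_integrable_on (g ` S) \<and> integral (g ` S) f = b"
proof -
  have "(\<lambda>x. \<bar>det (matrix (g' x))\<bar> *\<^sub>R vec (f (g x)) :: real^1) absolutely_integrable_on S \<and>
           integral S (\<lambda>x. \<bar>det (matrix (g' x))\<bar> *\<^sub>R vec (f (g x))) = (vec b :: real^1)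
         \<longleftrightarrow> (\<lambda>x. vec (f x) :: real^1) absolutely_integrable_on (g ` S) \<and>
           integral (g ` S) (\<lambda>x. vec (f x)) = (vec b :: real^1)"
    by (rule has_absolute_integral_change_of_variables[OF S der_g inj])
  then show ?thesis by (simp add: absolutely_integrable_on_1_iff integral_on_1_eq)
qed

lemma set_integral_mk2:
  fixes F :: "real \<times> real \<Rightarrow> real"
  assumes m: "(\<lambda>p. indicator T p * F p) \<in> borel_measurable borel"
  defines "T2 \<equiv> {x::real^2. (x$1, x$2) \<in> T}"
  shows "(\<lambda>x::real^2. indicator T2 x * F (x$1, x$2)) \<in> borel_measurable borel"
    and "set_integrable lborel T2 (\<lambda>x::real^2. F (x$1, x$2)) \<longleftrightarrow> set_integrable lborel T F"
    and "set_lebesgue_integral lborel T2 (\<lambda>x::real^2. F (x$1, x$2)) = set_lebesgue_integral lborel T F"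
proof -
  define H where "H = (\<lambda>x::real^2. indicator T2 x * F (x$1, x$2))"
  have H: "H x = (\<lambda>p. indicator T p * F p) (x$1, x$2)" for x by (simp add: H_def T2_def indicator_def)
  have pr: "(\<lambda>x::real^2. (x$1, x$2)) \<in> borel_measurable borel"
    by (intro borel_measurable_continuous_onI continuous_intros)
  have Hm: "H \<in> borel_measurable borel"
    unfolding H[abs_def] using measurable_compose[OF pr m] by simp
  then show "(\<lambda>x::real^2. indicator T2 x * F (x$1, x$2)) \<in> borel_measurable borel" by (simp add: H_def)
  have Hk: "H (mk2 p) = indicator T p * F p" for p by (simp add: H_def T2_def indicator_def)
  have k: "mk2 \<in> measurable lborel borel" using mk2_measurable by simp
  have "integrable lborel H \<longleftrightarrow> integrable lborel (\<lambda>p. H (mk2 p))"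
    by (subst distr_mk2[symmetric]) (rule integrable_distr_eq[OF k Hm])
  then show "set_integrable lborel T2 (\<lambda>x::real^2. F (x$1, x$2)) \<longleftrightarrow> set_integrable lborel T F"
    unfolding Hk by (simp add: set_integrable_def H_def)
  have "integral\<^sup>L lborel H = integral\<^sup>L lborel (\<lambda>p. H (mk2 p))"
    by (subst distr_mk2[symmetric]) (rule integral_distr[OF k Hm])
  then show "set_lebesgue_integral lborel T2 (\<lambda>x::real^2. F (x$1, x$2)) = set_lebesgue_integral lborel T F"
    unfolding Hk by (simp add: set_lebesgue_integral_def H_def)
qed

context chart
begin

text \<open>Change of variables by \<open>proj\<close> after the parametrization: its Jacobian
  absorbs the density \<open>1 / (\<nu> (gam u) \<bullet> n)\<close> of the graph. Where the partial
  derivatives are parallel, the Jacobian and the surface element vanish together. The equivalence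
  lets integrability over the parameters be inherited from the disc.\<close>

lemma area_formula:
  fixes r rs rt :: "real \<Rightarrow> real \<Rightarrow> real^3" and f :: "real^3 \<Rightarrow> real"
  assumes T: "T \<in> sets borel"
    and inj: "inj_on (\<lambda>(a, b). r a b) T"
    and im: "(\<lambda>(a, b). r a b) ` T = gam ` ball 0 \<delta>"
    and der: "\<And>a b. (a, b) \<in> T \<Longrightarrow> ((\<lambda>(a, b). r a b) has_derivative (\<lambda>(x, y). x *\<^sub>R rs a b + y *\<^sub>R rt a b)) (at (a, b) within T)"
    and tang: "\<And>a b. (a, b) \<in> T \<Longrightarrow> rs a b \<bullet> \<nu> (r a b) = 0" "\<And>a b. (a, b) \<in> T \<Longrightarrow> rt a b \<bullet> \<nu> (r a b) = 0"
    and m1: "(\<lambda>p. indicator T p * (case p of (a, b) \<Rightarrow> f (r a b) * norm (cross3 (rs a b) (rt a b)))) \<in> borel_measurable borel"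
    and m2: "(\<lambda>u. indicator (ball 0 \<delta>) u * (f (gam u) / (\<nu> (gam u) \<bullet> n))) \<in> borel_measurable borel"
  shows "set_integrable lborel T (\<lambda>(a, b). f (r a b) * norm (cross3 (rs a b) (rt a b))) \<longleftrightarrow>
      set_integrable lborel (ball 0 \<delta>) (\<lambda>u. f (gam u) / (\<nu> (gam u) \<bullet> n))"
    and "set_integrable lborel (ball 0 \<delta>) (\<lambda>u. f (gam u) / (\<nu> (gam u) \<bullet> n)) \<Longrightarrow>
      set_lebesgue_integral lborel T (\<lambda>(a, b). f (r a b) * norm (cross3 (rs a b) (rt a b))) =
      set_lebesgue_integral lborel (ball 0 \<delta>) (\<lambda>u. f (gam u) / (\<nu> (gam u) \<bullet> n))"
proof -
  define T2 where "T2 = {x::real^2. (x$1, x$2) \<in> T}"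
  define F where "F = (\<lambda>(a, b). f (r a b) * norm (cross3 (rs a b) (rt a b)))"
  define h where "h = (\<lambda>u. f (gam u) / (\<nu> (gam u) \<bullet> n))"
  define g where "g = (\<lambda>x::real^2. proj (r (x$1) (x$2)))"
  define pl where "pl = (\<lambda>w. (\<chi> i. if i = 1 then w \<bullet> e1 else w \<bullet> e2) :: real^2)"
  define g' where "g' = (\<lambda>(x::real^2) (v::real^2). pl (v$1 *\<^sub>R rs (x$1) (x$2) + v$2 *\<^sub>R rt (x$1) (x$2)))"
  have pr: "(\<lambda>x::real^2. (x$1, x$2)) \<in> borel_measurable borel"
    by (intro borel_measurable_continuous_onI continuous_intros)
  have T2: "T2 \<in> sets borel"
    using measurable_sets[OF pr T] by (simp add: T2_def vimage_def)
  have T2T: "(\<lambda>x::real^2. (x$1, x$2)) ` T2 = T"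
  proof (intro equalityI subsetI)
    fix p assume "p \<in> T"
    then have "mk2 p \<in> T2" "p = (mk2 p $ 1, mk2 p $ 2)" by (auto simp: T2_def)
    then show "p \<in> (\<lambda>x::real^2. (x$1, x$2)) ` T2" by blast
  qed (auto simp: T2_def)
  have r_gam: "r a b = gam (proj (r a b)) \<and> proj (r a b) \<in> ball 0 \<delta>" if "(a, b) \<in> T" for a b
  proof -
    have "r a b \<in> gam ` ball 0 \<delta>" using im that by blast
    then show ?thesis by auto
  qed
  have inj_g: "inj_on g T2"
  proof (rule inj_onI)
    fix x y :: "real^2" assume xy: "x \<in> T2" "y \<in> T2" "g x = g y"
    then have "r (x$1) (x$2) = r (y$1) (y$2)"
      using r_gam[of "x$1" "x$2"] r_gam[of "y$1" "y$2"] by (simp add: g_def T2_def)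
    then have "(x$1, x$2) = (y$1, y$2)" using inj_onD[OF inj, of "(x$1, x$2)" "(y$1, y$2)"] xy by (simp add: T2_def)
    then show "x = y" by (simp add: vec_eq_iff forall_2)
  qed
  have g_im: "g ` T2 = ball 0 \<delta>"
  proof -
    have "g ` T2 = proj ` ((\<lambda>(a, b). r a b) ` ((\<lambda>x::real^2. (x$1, x$2)) ` T2))"
      by (simp only: image_image g_def split)
    also have "\<dots> = proj ` gam ` ball 0 \<delta>" unfolding T2T im ..
    also have "\<dots> = ball 0 \<delta>" by (simp add: image_image)
    finally show ?thesis .
  qed
  have blp: "bounded_linear pl"
  proof (rule linear_conv_bounded_linear[THEN iffD1], rule linearI)
    fix x y :: "real^3" and c :: real
    show "pl (x + y) = pl x + pl y" by (simp add: pl_def vec_eq_iff inner_add_left)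
    show "pl (c *\<^sub>R x) = c *\<^sub>R pl x" by (simp add: pl_def vec_eq_iff)
  qed
  have proj_pl: "proj Q = pl Q - pl N" for Q
    by (simp add: vec_eq_iff forall_2 proj_nth pl_def inner_diff_left)
  have der_g: "(g has_derivative g' x) (at x within T2)" if x: "x \<in> T2" for x
  proof -
    have d0: "((\<lambda>x::real^2. (x$1, x$2)) has_derivative (\<lambda>v::real^2. (v$1, v$2))) (at x within T2)"
      by (intro has_derivative_Pair bounded_linear.has_derivative[OF bounded_linear_vec_nth] has_derivative_ident)
    have "(\<lambda>x::real^2. (x$1, x$2)) ` T2 \<subseteq> T" using T2T by simp
    then have d1: "((\<lambda>(a, b). r a b) has_derivative (\<lambda>(s, t). s *\<^sub>R rs (x$1) (x$2) + t *\<^sub>R rt (x$1) (x$2))) (at (x$1, x$2) within (\<lambda>x::real^2. (x$1, x$2)) ` T2)"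
      using der[of "x$1" "x$2"] x by (intro has_derivative_subset[OF _ \<open>_ \<subseteq> T\<close>]) (simp add: T2_def)
    have "((\<lambda>x::real^2. r (x$1) (x$2)) has_derivative (\<lambda>v::real^2. v$1 *\<^sub>R rs (x$1) (x$2) + v$2 *\<^sub>R rt (x$1) (x$2))) (at x within T2)"
      using diff_chain_within[OF d0 d1] by (simp add: o_def)
    from bounded_linear.has_derivative[OF blp this]
    have "((\<lambda>x::real^2. pl (r (x$1) (x$2)) - pl N) has_derivative g' x) (at x within T2)"
      unfolding g'_def by (auto intro!: derivative_eq_intros)
    then show ?thesis by (simp add: g_def proj_pl)
  qed
  have det: "\<bar>det (matrix (g' x))\<bar> * h (g x) = F (x$1, x$2)" if x: "x \<in> T2" for x
  proof -
    define a b where "a = rs (x$1) (x$2)" and "b = rt (x$1) (x$2)"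
    have xT: "(x$1, x$2) \<in> T" using x by (simp add: T2_def)
    have gx: "gam (g x) = r (x$1) (x$2)" "g x \<in> ball 0 \<delta>" using r_gam[OF xT] by (simp_all add: g_def)
    have nn: "0 < \<nu> (r (x$1) (x$2)) \<bullet> n" "norm (\<nu> (r (x$1) (x$2))) = 1"
      using normal_n_gam[OF gx(2)] unit_normal_gam[OF gx(2)] gx(1) by auto
    have "det (matrix (g' x)) = (a \<bullet> e1) * (b \<bullet> e2) - (b \<bullet> e1) * (a \<bullet> e2)"
      by (simp add: det_2 matrix_def g'_def pl_def axis_def a_def b_def)
    then have "\<bar>det (matrix (g' x))\<bar> = norm (cross3 a b) * (\<nu> (r (x$1) (x$2)) \<bullet> n)"
      using det_proj_eq[OF nn(2,1)] tang[OF xT] by (simp add: a_def b_def)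
    then show ?thesis using nn gx(1) by (simp add: h_def F_def a_def b_def)
  qed
  have S2: "T2 \<in> sets lebesgue" using T2 by simp
  have cong1: "(\<lambda>x::real^2. \<bar>det (matrix (g' x))\<bar> * h (g x)) absolutely_integrable_on T2 \<longleftrightarrow> (\<lambda>x::real^2. F (x$1, x$2)) absolutely_integrable_on T2"
    by (rule set_integrable_cong) (auto simp: det)
  have cong2: "integral T2 (\<lambda>x::real^2. \<bar>det (matrix (g' x))\<bar> * h (g x)) = integral T2 (\<lambda>x::real^2. F (x$1, x$2))"
    by (rule integral_cong) (auto simp: det)
  have cv: "(\<lambda>x::real^2. F (x$1, x$2)) absolutely_integrable_on T2 \<and> integral T2 (\<lambda>x::real^2. F (x$1, x$2)) = c
     \<longleftrightarrow> h absolutely_integrable_on (ball 0 \<delta>) \<and> integral (ball 0 \<delta>) h = c" for c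
    using change_of_variables_real[OF S2 der_g inj_g, of h c] unfolding cong1 cong2 g_im .
  have m1': "(\<lambda>p. indicator T p * F p) \<in> borel_measurable borel" using m1 by (simp add: F_def)
  note mk = set_integral_mk2[OF m1', folded T2_def]
  have m2': "(\<lambda>u. indicator (ball 0 \<delta>) u * h u) \<in> borel_measurable borel" using m2 by (simp add: h_def)
  have I: "(\<lambda>x::real^2. F (x$1, x$2)) absolutely_integrable_on T2 \<longleftrightarrow> h absolutely_integrable_on (ball 0 \<delta>)"
    using cv by blast
  show "set_integrable lborel T (\<lambda>(a, b). f (r a b) * norm (cross3 (rs a b) (rt a b))) \<longleftrightarrow>
      set_integrable lborel (ball 0 \<delta>) (\<lambda>u. f (gam u) / (\<nu> (gam u) \<bullet> n))"
    using I mk(2) set_integrable_lebesgue_lborel(1)[OF mk(1)] set_integrable_lebesgue_lborel(1)[OF m2']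
    unfolding F_def[symmetric] h_def[symmetric] by blast
  assume "set_integrable lborel (ball 0 \<delta>) (\<lambda>u. f (gam u) / (\<nu> (gam u) \<bullet> n))"
  then have hi: "h absolutely_integrable_on (ball 0 \<delta>)"
    using set_integrable_lebesgue_lborel(1)[OF m2'] by (simp add: h_def)
  then have Fi: "(\<lambda>x::real^2. F (x$1, x$2)) absolutely_integrable_on T2" "integral T2 (\<lambda>x::real^2. F (x$1, x$2)) = integral (ball 0 \<delta>) h"
    using cv by blast+
  show "set_lebesgue_integral lborel T (\<lambda>(a, b). f (r a b) * norm (cross3 (rs a b) (rt a b))) =
      set_lebesgue_integral lborel (ball 0 \<delta>) (\<lambda>u. f (gam u) / (\<nu> (gam u) \<bullet> n))"
    using mk(3) set_integrable_lebesgue_lborel(2)[OF mk(1) Fi(1)] set_integrable_lebesgue_lborel(2)[OF m2' hi] Fi(2)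
    unfolding F_def[symmetric] h_def[symmetric] by simp
qed

end

section \<open>Limits of the local potential\<close>

lemma integral_shift:
  fixes f :: "'a::euclidean_space \<Rightarrow> real"
  assumes f: "f \<in> borel_measurable borel"
  shows "integral\<^sup>L lborel (\<lambda>v. f (p + v)) = integral\<^sup>L lborel f"
proof -
  have "integral\<^sup>L lborel f = integral\<^sup>L (distr lborel borel ((+) p)) f"
    by (simp add: lborel_distr_plus)
  also have "\<dots> = integral\<^sup>L lborel (\<lambda>v. f (p + v))"
    by (rule integral_distr) (use f in auto)
  finally show ?thesis ..
qed

lemma integral_scale:
  fixes f :: "real^2 \<Rightarrow> real"
  assumes f: "f \<in> borel_measurable borel" and c: "0 < c"
  shows "integral\<^sup>L lborel (\<lambda>v. c\<^sup>2 * f (p + c *\<^sub>R v)) = integral\<^sup>L lborel f"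
proof -
  have m: "(\<lambda>v. p + c *\<^sub>R v) \<in> borel_measurable borel"
    by (intro borel_measurable_continuous_onI continuous_intros)
  have "integral\<^sup>L lborel f = integral\<^sup>L (density (distr lborel borel (\<lambda>v. p + c *\<^sub>R v)) (\<lambda>_. ennreal (\<bar>c\<bar> ^ DIM(real^2)))) f"
    using lborel_affine[of c p] c by simp
  also have "\<dots> = integral\<^sup>L (distr lborel borel (\<lambda>v. p + c *\<^sub>R v)) (\<lambda>x. c\<^sup>2 *\<^sub>R f x)"
    using f c by (subst integral_density) auto
  also have "\<dots> = integral\<^sup>L lborel (\<lambda>v. c\<^sup>2 *\<^sub>R f (p + c *\<^sub>R v))"
    by (rule integral_distr) (use f m in auto)
  finally show ?thesis by simp
qed

lemma AE_lborel_not_sphere: "AE x in lborel. norm (x :: real^2) \<noteq> d"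
proof (rule AE_I')
  have "negligible (sphere (0 :: real^2) d)" by (rule negligible_sphere)
  then show "sphere (0 :: real^2) d \<in> null_sets lborel"
    by (simp add: negligible_iff_null_sets null_sets_completion_iff)
qed auto

text \<open>\<open>f\<close> is the density of the potential.\<close>

locale jump_chart = chart +
  fixes e B M :: real and f :: "real^3 \<Rightarrow> real"
  assumes e: "0 < e" and N_pos: "0 < N$1" and S_pos: "\<And>Q :: real^3. Q \<in> S \<Longrightarrow> 0 < Q$1"
    and f_cont: "continuous_on (ball 0 \<delta>) (\<lambda>u. f (gam u))"
    and f_bound: "\<And>u. u \<in> ball 0 \<delta> \<Longrightarrow> \<bar>f (gam u)\<bar> \<le> M"
    and B: "0 < B" "\<And>P Q :: real^3. N$1 / 2 \<le> P$1 \<Longrightarrow> P$1 \<le> 2 * N$1 \<Longrightarrow> 0 < Q$1 \<Longrightarrow> P \<noteq> Q \<Longrightarrow>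
      \<bar>kernel_sing e P Q\<bar> \<le> B \<and> norm (kernel_reg e P Q) \<le> B / norm (Q - P)"
begin

text \<open>The slab keeps \<open>P\<close> away from the plane \<open>x = 0\<close>, so that one
  constant \<open>B\<close> bounds the kernels.\<close>

definition near :: "(real^3) set" where
  "near = {P :: real^3. P \<in> cylinder \<and> N$1 / 2 \<le> P$1 \<and> P$1 \<le> 2 * N$1}"

lemma N_near: "N \<in> near"
  using N_in_cylinder N_pos by (simp add: near_def)

lemma gam_pos: "u \<in> ball 0 \<delta> \<Longrightarrow> 0 < gam u $ 1"
  using S_pos[OF graph_in_gam] .

lemma M_nonneg: "0 \<le> M"
  using f_bound[of 0] pos by (meson abs_ge_zero centre_in_ball order_trans)

definition weak :: "real^3 \<Rightarrow> real^2 \<Rightarrow> real" where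
  "weak P u = f (gam u) / (\<nu> (gam u) \<bullet> n) *
     (kernel_sing e P (gam u) * ((gam (proj P) - gam u) \<bullet> \<nu> (gam u)) / norm (gam u - P) ^ 3
      + kernel_reg e P (gam u) \<bullet> \<nu> (gam u))"

definition height :: "real^3 \<Rightarrow> real" where "height P = ht P - \<phi> (proj P)"

definition poisson :: "real^3 \<Rightarrow> real^2 \<Rightarrow> real" where
  "poisson P u = f (gam u) * kernel_sing e P (gam u) * height P / norm (gam u - P) ^ 3"

lemma point_height: "P = gam (proj P) + height P *\<^sub>R n"
  using decomp[of P] by (simp add: gam_def height_def algebra_simps)

text \<open>The vertical part of \<open>P - gam u\<close> contributes
  \<open>height P * (\<nu> (gam u) \<bullet> n)\<close>, whose second factor cancels the density of
  the surface element exactly. Thus \<open>poisson\<close> contains no normal at all.\<close>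

lemma density_split:
  assumes u: "u \<in> ball 0 \<delta>"
  shows "f (gam u) * (kernel_sing e P (gam u) * ((P - gam u) \<bullet> \<nu> (gam u)) / norm (gam u - P) ^ 3 + kernel_reg e P (gam u) \<bullet> \<nu> (gam u))
     / (\<nu> (gam u) \<bullet> n) = weak P u + poisson P u"
proof -
  have c: "\<nu> (gam u) \<bullet> n \<noteq> 0" using normal_n_gam[OF u] by auto
  have "(P - gam u) \<bullet> \<nu> (gam u) = (gam (proj P) + height P *\<^sub>R n - gam u) \<bullet> \<nu> (gam u)"
    using point_height[of P] by simp
  also have "\<dots> = (gam (proj P) - gam u) \<bullet> \<nu> (gam u) + height P * (\<nu> (gam u) \<bullet> n)"
    by (simp add: inner_add_left inner_diff_left inner_commute[of n])
  finally have 1: "(P - gam u) \<bullet> \<nu> (gam u) = (gam (proj P) - gam u) \<bullet> \<nu> (gam u) + height P * (\<nu> (gam u) \<bullet> n)" .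
  have alg: "F * (k * (t + h * c) / d + g) / c = F / c * (k * t / d + g) + F * k * h / d" if "c \<noteq> 0" for F k t h c d g :: real
  proof -
    have "F * (k * (t + h * c) / d + g) / c = F / c * (k * t / d + g) + F * k * h / d * (c / c)"
      by (simp add: algebra_simps add_divide_distrib)
    then show ?thesis using that by simp
  qed
  show ?thesis unfolding 1 weak_def poisson_def using alg[OF c] .
qed

lemma isCont_gam: "u \<in> ball 0 \<delta> \<Longrightarrow> isCont gam u"
  using continuous_on_gam by (simp add: continuous_on_eq_continuous_at)

lemma tendsto_weak:
  fixes p :: "real^3"
  assumes P: "(P \<longlongrightarrow> p) F" and U: "(U \<longlongrightarrow> u) F" and p: "0 < p$1" "p \<in> cylinder"
    and u: "u \<in> ball 0 \<delta>" "proj p \<noteq> u"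
  shows "((\<lambda>x. weak (P x) (U x)) \<longlongrightarrow> weak p u) F"
    "((\<lambda>x. poisson (P x) (U x)) \<longlongrightarrow> poisson p u) F"
proof -
  have ne: "p \<noteq> gam u" using u(2) by auto
  have G: "((\<lambda>x. gam (U x)) \<longlongrightarrow> gam u) F" by (rule isCont_tendsto_compose[OF isCont_gam[OF u(1)] U])
  have "isCont (\<lambda>u. f (gam u)) u" "isCont (\<lambda>u. \<nu> (gam u)) u"
    using f_cont continuous_on_normal_gam u(1) by (simp_all add: continuous_on_eq_continuous_at)
  note fc = isCont_tendsto_compose[OF this(1) U] isCont_tendsto_compose[OF this(2) U]
  have pc: "((\<lambda>x. proj (P x)) \<longlongrightarrow> proj p) F"
  proof (rule isCont_tendsto_compose[OF _ P])
    show "isCont proj p" using continuous_on_proj[OF continuous_on_id, of UNIV] by (simp add: continuous_on_eq_continuous_at)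
  qed
  have hc: "((\<lambda>x. ht (P x)) \<longlongrightarrow> ht p) F"
    unfolding ht_def by (intro tendsto_intros P)
  have pb: "proj p \<in> ball 0 \<delta>" using p by (simp add: cylinder_def)
  have gp: "((\<lambda>x. gam (proj (P x))) \<longlongrightarrow> gam (proj p)) F" by (rule isCont_tendsto_compose[OF isCont_gam[OF pb] pc])
  have "isCont \<phi> (proj p)" using continuous_on_\<phi> pb by (simp add: continuous_on_eq_continuous_at)
  note \<phi>c = isCont_tendsto_compose[OF this pc]
  have ks: "((\<lambda>x. kernel_sing e (P x) (gam (U x))) \<longlongrightarrow> kernel_sing e p (gam u)) F"
    and kr: "((\<lambda>x. kernel_reg e (P x) (gam (U x))) \<longlongrightarrow> kernel_reg e p (gam u)) F"
    by (rule tendsto_kernel_sing[OF e P G p(1) gam_pos[OF u(1)] ne] tendsto_kernel_reg[OF e P G p(1) gam_pos[OF u(1)] ne])+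
  have c: "\<nu> (gam u) \<bullet> n \<noteq> 0" using normal_n_gam[OF u(1)] by auto
  show "((\<lambda>x. weak (P x) (U x)) \<longlongrightarrow> weak p u) F"
    unfolding weak_def using c ne by (intro tendsto_intros fc ks kr gp G P) auto
  show "((\<lambda>x. poisson (P x) (U x)) \<longlongrightarrow> poisson p u) F"
    unfolding poisson_def height_def using ne by (intro tendsto_intros fc ks G P hc \<phi>c) auto
qed

text \<open>Without the foot point both parts are continuous in \<open>u\<close> for every
  \<open>P\<close> in \<open>near\<close>, including \<open>P\<close> on the surface.\<close>

definition punctured :: "real^3 \<Rightarrow> (real^2) set" where
  "punctured P = ball 0 \<delta> - {proj P}"

lemma measurable_weak:
  assumes P: "P \<in> near"
  shows "(\<lambda>u. indicator (punctured P) u * weak P u) \<in> borel_measurable borel"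
    "(\<lambda>u. indicator (punctured P) u * poisson P u) \<in> borel_measurable borel"
proof -
  have P': "0 < P$1" "P \<in> cylinder" using P N_pos by (auto simp: near_def)
  have m: "punctured P \<in> sets borel" by (simp add: punctured_def)
  have "continuous_on (punctured P) (weak P)" "continuous_on (punctured P) (poisson P)"
    unfolding continuous_on_def
    by (intro ballI tendsto_weak[OF tendsto_const tendsto_ident_at P']; force simp: punctured_def)+
  from this[THEN borel_measurable_continuous_on_indicator[OF m]]
  show "(\<lambda>u. indicator (punctured P) u * weak P u) \<in> borel_measurable borel"
    "(\<lambda>u. indicator (punctured P) u * poisson P u) \<in> borel_measurable borel" by simp_all
qed

section \<open>The weakly singular part\<close>

definition weak_const :: real where
  "weak_const = 2 * M * B * (3 * A * 3 powr l + (2 * \<delta>) powr (1 - l))"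

text \<open>The distance of \<open>gam u\<close> from \<open>P\<close> is at least
  \<open>norm (u - proj P)\<close>, whatever the height of \<open>P\<close>, so the bound is uniform
  in \<open>P\<close>. In the constant, \<open>2 * M\<close> bounds density over
  \<open>\<nu> (gam u) \<bullet> n\<close>, the term with \<open>A\<close> comes from
  \<open>tangential_bound\<close>, and \<open>(2 * \<delta>) powr (1 - l)\<close> turns the order -1
  of the regular kernel into the order \<open>l - 2\<close> of the other one.\<close>

lemma weak_bound:
  assumes P: "P \<in> near" and u: "u \<in> punctured P"
  shows "\<bar>weak P u\<bar> \<le> weak_const * norm (u - proj P) powr (- (2 - l))"
proof -
  define x where "x = norm (u - proj P)"
  define R where "R = norm (gam u - P)"
  have u': "u \<in> ball 0 \<delta>" "u \<noteq> proj P" using u by (auto simp: punctured_def)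
  have pb: "proj P \<in> ball 0 \<delta>" using P by (simp add: near_def cylinder_def)
  have x: "0 < x" using u' by (simp add: x_def)
  have xR: "x \<le> R" using norm_proj_diff_le[of "gam u" P] by (simp add: x_def R_def)
  have x2: "x \<le> 2 * \<delta>" using norm_triangle_ineq4[of u "proj P"] u' pb by (simp add: x_def)
  have ne: "P \<noteq> gam u" using u'(2) by auto
  have K: "\<bar>kernel_sing e P (gam u)\<bar> \<le> B" "norm (kernel_reg e P (gam u)) \<le> B / R"
    using B(2)[of P "gam u"] P gam_pos[OF u'(1)] ne by (auto simp: near_def R_def)
  have T: "\<bar>(gam (proj P) - gam u) \<bullet> \<nu> (gam u)\<bar> \<le> 3 * A * (3 * x) powr l * x"
  proof -
    have "(gam (proj P) - gam u) \<bullet> \<nu> (gam u) = - ((gam u - gam (proj P)) \<bullet> \<nu> (gam u))"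
      by (simp add: inner_diff_left)
    then show ?thesis using tangential_bound[OF u'(1) pb] by (simp add: x_def)
  qed
  have p3: "x powr l * x / x ^ 3 = x powr (- (2 - l))"
  proof -
    have "x powr (- (2 - l)) = x powr l / x powr 2" by (simp flip: powr_diff)
    also have "\<dots> = x powr l / x\<^sup>2" using x by simp
    finally show ?thesis using x by (simp add: power2_eq_square power3_eq_cube)
  qed
  have p1: "1 / x \<le> (2 * \<delta>) powr (1 - l) * x powr (- (2 - l))"
  proof -
    have "1 / x = x powr (1 - l) * x powr (- (2 - l))"
      using x by (simp add: powr_minus_divide flip: powr_add)
    also have "\<dots> \<le> (2 * \<delta>) powr (1 - l) * x powr (- (2 - l))"
      using x x2 pos by (intro mult_right_mono powr_mono2) auto
    finally show ?thesis .
  qed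
  have 1: "\<bar>kernel_sing e P (gam u) * ((gam (proj P) - gam u) \<bullet> \<nu> (gam u)) / R ^ 3\<bar> \<le> B * (3 * A * 3 powr l) * x powr (- (2 - l))"
  proof -
    have "\<bar>kernel_sing e P (gam u) * ((gam (proj P) - gam u) \<bullet> \<nu> (gam u)) / R ^ 3\<bar> \<le> B * (3 * A * (3 * x) powr l * x) / x ^ 3"
      unfolding abs_divide abs_mult using K T x xR B(1) pos
      by (intro frac_le mult_mono) (auto intro: power_mono)
    also have "\<dots> = B * (3 * A * 3 powr l) * (x powr l * x / x ^ 3)"
      using x by (simp add: powr_mult)
    finally show ?thesis unfolding p3 .
  qed
  have 2: "\<bar>kernel_reg e P (gam u) \<bullet> \<nu> (gam u)\<bar> \<le> B * ((2 * \<delta>) powr (1 - l)) * x powr (- (2 - l))"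
  proof -
    have "\<bar>kernel_reg e P (gam u) \<bullet> \<nu> (gam u)\<bar> \<le> B / R"
      using Cauchy_Schwarz_ineq2[of "kernel_reg e P (gam u)" "\<nu> (gam u)"] unit_normal_gam[OF u'(1)] K(2) by simp
    also have "\<dots> \<le> B * (1 / x)" using x xR B(1) by (simp add: frac_le)
    also have "\<dots> \<le> B * ((2 * \<delta>) powr (1 - l) * x powr (- (2 - l)))" using p1 B(1) by (intro mult_left_mono) auto
    finally show ?thesis by simp
  qed
  have 3: "\<bar>f (gam u) / (\<nu> (gam u) \<bullet> n)\<bar> \<le> 2 * M"
  proof -
    have "\<bar>f (gam u) / (\<nu> (gam u) \<bullet> n)\<bar> \<le> M / (1 / 2)"
      unfolding abs_divide using f_bound[OF u'(1)] normal_n_gam[OF u'(1)] by (intro frac_le) auto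
    then show ?thesis by simp
  qed
  have "\<bar>weak P u\<bar> \<le> (2 * M) * (B * (3 * A * 3 powr l) * x powr (- (2 - l)) + B * ((2 * \<delta>) powr (1 - l)) * x powr (- (2 - l)))"
    unfolding weak_def R_def[symmetric] abs_mult
    using 3 1 2 abs_triangle_ineq[of "kernel_sing e P (gam u) * ((gam (proj P) - gam u) \<bullet> \<nu> (gam u)) / R ^ 3" "kernel_reg e P (gam u) \<bullet> \<nu> (gam u)"]
    by (intro mult_mono) (auto simp: M_nonneg)
  also have "\<dots> = weak_const * x powr (- (2 - l))" by (simp add: weak_const_def algebra_simps)
  finally show ?thesis by (simp add: x_def)
qed

lemma weak_const_nonneg: "0 \<le> weak_const"
  unfolding weak_const_def using M_nonneg B(1) pos by auto

text \<open>With the foot point moved to 0 the bound no longer depends on \<open>P\<close>; the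
  difference of two points of the disc has length below \<open>2 * \<delta>\<close>.\<close>

lemma weak_shift_bound:
  assumes P: "P \<in> near"
  shows "\<bar>indicator (punctured P) (proj P + v) * weak P (proj P + v)\<bar> \<le> weak_const * (norm v powr (- (2 - l)) * indicator (ball 0 (2 * \<delta>)) v)"
proof (cases "proj P + v \<in> punctured P")
  case True
  have "norm (proj P) < \<delta>" "norm (proj P + v) < \<delta>" using P True by (auto simp: near_def cylinder_def punctured_def)
  then have "norm v < 2 * \<delta>" using norm_triangle_ineq4[of "proj P + v" "proj P"] by simp
  then show ?thesis using weak_bound[OF P True] True by simp
next
  case False
  then show ?thesis using weak_const_nonneg by simp
qed

lemma weak_dominator: "integrable (lborel :: (real^2) measure) (\<lambda>v. weak_const * (norm v powr (- (2 - l)) * indicator (ball 0 (2 * \<delta>)) v))"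
  by (intro integrable_mult_right integrable_norm_powr) (use pos in auto)

text \<open>Unshifted, the integrands have singularities at moving points and no evident common
  majorant; in the variable \<open>v = u - proj (P i)\<close> dominated convergence applies.\<close>

lemma weak_limit:
  assumes P: "\<And>i. P i \<in> near" and lim: "P \<longlonglongrightarrow> N"
  shows "(\<lambda>i. integral\<^sup>L lborel (\<lambda>u. indicator (punctured (P i)) u * weak (P i) u))
     \<longlonglongrightarrow> integral\<^sup>L lborel (\<lambda>u. indicator (punctured N) u * weak N u)"
proof -
  define s where "s = (\<lambda>i v. indicator (punctured (P i)) (proj (P i) + v) * weak (P i) (proj (P i) + v))"
  have eq: "integral\<^sup>L lborel (\<lambda>u. indicator (punctured (P i)) u * weak (P i) u) = integral\<^sup>L lborel (s i)" for i
    unfolding s_def by (rule integral_shift[OF measurable_weak(1)[OF P], symmetric])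
  have add: "(\<lambda>v. p + v) \<in> borel_measurable borel" for p :: "real^2" by simp
  have pl: "(\<lambda>i. proj (P i)) \<longlonglongrightarrow> 0"
  proof -
    have "isCont proj N" using continuous_on_proj[OF continuous_on_id, of UNIV] by (simp add: continuous_on_eq_continuous_at)
    from isCont_tendsto_compose[OF this lim] show ?thesis by simp
  qed
  have "(\<lambda>i. integral\<^sup>L lborel (s i)) \<longlonglongrightarrow> integral\<^sup>L lborel (\<lambda>u. indicator (punctured N) u * weak N u)"
  proof (rule integral_dominated_convergence[OF _ _ weak_dominator])
    show "(\<lambda>u. indicator (punctured N) u * weak N u) \<in> borel_measurable lborel"
      using measurable_weak(1)[OF N_near] by simp
    show "s i \<in> borel_measurable lborel" for i
      unfolding s_def using measurable_compose[OF add measurable_weak(1)[OF P[of i]]] by simp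
    show "AE v in lborel. norm (s i v) \<le> weak_const * (norm v powr (- (2 - l)) * indicator (ball 0 (2 * \<delta>)) v)" for i
      unfolding s_def using weak_shift_bound[OF P[of i]] by simp
    \<comment> \<open>Two null sets are left out: the singular point, and the circle of radius
      \<open>\<delta>\<close>, on which the indicators of the shifted discs need not
      converge.\<close>
    have "AE v::real^2 in lborel. v \<noteq> 0" by (rule AE_lborel_singleton)
    then show "AE v in lborel. (\<lambda>i. s i v) \<longlonglongrightarrow> indicator (punctured N) v * weak N v"
      using AE_lborel_not_sphere[of \<delta>]
    proof eventually_elim
      case (elim v)
      have U: "(\<lambda>i. proj (P i) + v) \<longlonglongrightarrow> v" using tendsto_add[OF pl tendsto_const, of v] by simp
      show ?case
      proof (cases "norm v < \<delta>")
        case True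
        then have v: "v \<in> ball 0 \<delta>" "v \<in> punctured N" using elim by (auto simp: punctured_def)
        have "\<forall>\<^sub>F i in sequentially. proj (P i) + v \<in> ball 0 \<delta>"
          using topological_tendstoD[OF U open_ball v(1)] .
        then have ev: "\<forall>\<^sub>F i in sequentially. weak (P i) (proj (P i) + v) = s i v"
          by eventually_elim (use elim in \<open>auto simp: s_def punctured_def\<close>)
        have "(\<lambda>i. weak (P i) (proj (P i) + v)) \<longlonglongrightarrow> weak N v"
          by (rule tendsto_weak(1)[OF lim U N_pos N_in_cylinder v(1)]) (use elim in auto)
        then show ?thesis using Lim_transform_eventually[OF _ ev] v by simp
      next
        case False
        then have nv: "\<delta> < norm v" using elim by simp
        have "(\<lambda>i. norm (proj (P i) + v)) \<longlonglongrightarrow> norm v" by (intro tendsto_intros U)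
        then have "\<forall>\<^sub>F i in sequentially. \<delta> < norm (proj (P i) + v)" using nv by (rule order_tendstoD(1))
        then have "\<forall>\<^sub>F i in sequentially. s i v = 0"
          by eventually_elim (auto simp: s_def punctured_def)
        then show ?thesis using nv by (simp add: punctured_def tendsto_eventually)
      qed
    qed
  qed
  then show ?thesis unfolding eq .
qed

lemma weak_integrable:
  assumes P: "P \<in> near"
  shows "integrable lborel (\<lambda>u. indicator (punctured P) u * weak P u)"
proof -
  have add: "(\<lambda>v. p + v) \<in> borel_measurable borel" for p :: "real^2" by simp
  have "integrable lborel (\<lambda>v. indicator (punctured P) (proj P + v) * weak P (proj P + v))"
  proof (rule Bochner_Integration.integrable_bound[OF weak_dominator])
    show "(\<lambda>v. indicator (punctured P) (proj P + v) * weak P (proj P + v)) \<in> borel_measurable lborel"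
      using measurable_compose[OF add measurable_weak(1)[OF P]] by simp
    show "AE v in lborel. norm (indicator (punctured P) (proj P + v) * weak P (proj P + v))
       \<le> norm (weak_const * (norm v powr (- (2 - l)) * indicator (ball 0 (2 * \<delta>)) v))"
      using weak_shift_bound[OF P] by (auto intro!: AE_I2 order_trans[OF _ abs_ge_self])
  qed
  then have "integrable (distr lborel borel ((+) (proj P))) (\<lambda>u. indicator (punctured P) u * weak P u)"
    by (subst integrable_distr_eq) (use measurable_weak(1)[OF P] in auto)
  then show ?thesis by (simp add: lborel_distr_plus)
qed

text \<open>\<open>\<sigma>\<close> is the side of the surface on which \<open>P\<close> lies; the plane is rescaled by the height \<open>c\<close> of \<open>P\<close>.\<close>

lemma poisson_distance:
  assumes P: "P \<in> near" and h: "height P = \<sigma> * c" "0 < c" "\<bar>\<sigma>\<bar> = 1"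
    and u: "proj P + c *\<^sub>R w \<in> ball 0 \<delta>"
  defines "\<psi> \<equiv> (\<phi> (proj P + c *\<^sub>R w) - \<phi> (proj P)) / c"
  shows "norm (gam (proj P + c *\<^sub>R w) - P) = c * sqrt ((norm w)\<^sup>2 + (\<psi> - \<sigma>)\<^sup>2)"
    and "(1 + (norm w)\<^sup>2) / 17 \<le> (norm w)\<^sup>2 + (\<psi> - \<sigma>)\<^sup>2"
proof -
  have pb: "proj P \<in> ball 0 \<delta>" using P by (simp add: near_def cylinder_def)
  have dd: "ht (gam (proj P + c *\<^sub>R w)) - ht P = c * (\<psi> - \<sigma>)"
    using h by (simp add: \<psi>_def height_def field_simps)
  have "(norm (gam (proj P + c *\<^sub>R w) - P))\<^sup>2 = c\<^sup>2 * ((norm w)\<^sup>2 + (\<psi> - \<sigma>)\<^sup>2)"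
    unfolding norm_diff[of "gam (proj P + c *\<^sub>R w)" P] dd using h(2)
    by (simp add: power_mult_distrib distrib_left)
  then have "norm (gam (proj P + c *\<^sub>R w) - P) = sqrt (c\<^sup>2 * ((norm w)\<^sup>2 + (\<psi> - \<sigma>)\<^sup>2))"
    by (metis norm_ge_zero real_sqrt_unique)
  then show "norm (gam (proj P + c *\<^sub>R w) - P) = c * sqrt ((norm w)\<^sup>2 + (\<psi> - \<sigma>)\<^sup>2)"
    using h(2) by (simp add: real_sqrt_mult)
  have "\<bar>\<phi> (proj P + c *\<^sub>R w) - \<phi> (proj P)\<bar> \<le> 2 * (c * norm w)"
    using \<phi>_Lipschitz2[OF u pb] h(2) by simp
  then have psi: "\<bar>\<psi>\<bar> \<le> 2 * norm w" using h(2) by (simp add: \<psi>_def field_simps)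
  \<comment> \<open>Since \<open>\<bar>\<psi>\<bar> \<le> 2 * norm w\<close>, either
    \<open>norm w \<le> 1 / 4\<close> and \<open>\<psi>\<close> stays at distance 1/2 from
    \<open>\<sigma>\<close>, or \<open>(norm w)^2\<close> alone exceeds 1/16; the number 17 is 1 +
    16.\<close>
  show "(1 + (norm w)\<^sup>2) / 17 \<le> (norm w)\<^sup>2 + (\<psi> - \<sigma>)\<^sup>2"
  proof (cases "norm w \<le> 1 / 4")
    case True
    then have "1 / 2 \<le> \<bar>\<psi> - \<sigma>\<bar>" using psi h(3) by linarith
    then have "(1 / 2)\<^sup>2 \<le> (\<psi> - \<sigma>)\<^sup>2" by (metis abs_ge_zero power2_abs power_mono zero_le_divide_1_iff zero_le_numeral)
    then have "1 / 4 \<le> (\<psi> - \<sigma>)\<^sup>2" by (simp add: power_divide)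
    moreover have "(norm w)\<^sup>2 \<le> (1 / 4)\<^sup>2" using True by (intro power_mono) auto
    then have "(norm w)\<^sup>2 \<le> 1 / 16" by (simp add: power_divide)
    moreover have "0 \<le> (norm w)\<^sup>2" by simp
    moreover have "1 / 4 \<le> Y \<Longrightarrow> W \<le> 1 / 16 \<Longrightarrow> 0 \<le> W \<Longrightarrow> (1 + W) / 17 \<le> W + Y" for W Y :: real
      by simp
    ultimately show ?thesis by blast
  next
    case False
    then have "(1 / 4)\<^sup>2 \<le> (norm w)\<^sup>2" by (intro power_mono) auto
    then have "1 / 16 \<le> (norm w)\<^sup>2" by (simp add: power_divide)
    moreover have "0 \<le> (\<psi> - \<sigma>)\<^sup>2" by simp
    moreover have "1 / 16 \<le> W \<Longrightarrow> 0 \<le> Y \<Longrightarrow> (1 + W) / 17 \<le> W + Y" for W Y :: real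
      by simp
    ultimately show ?thesis by blast
  qed
qed

text \<open>The Jacobian \<open>c^2\<close> and the height \<open>c\<close> together cancel the cube
  of the distance, so the rescaled integrand keeps a nontrivial limit as \<open>c\<close> tends to
  0.\<close>

lemma poisson_scaled:
  assumes P: "P \<in> near" and h: "height P = \<sigma> * c" "0 < c" "\<bar>\<sigma>\<bar> = 1"
    and u: "proj P + c *\<^sub>R w \<in> ball 0 \<delta>"
  defines "\<psi> \<equiv> (\<phi> (proj P + c *\<^sub>R w) - \<phi> (proj P)) / c"
  shows "c\<^sup>2 * poisson P (proj P + c *\<^sub>R w) =
    f (gam (proj P + c *\<^sub>R w)) * kernel_sing e P (gam (proj P + c *\<^sub>R w)) * (\<sigma> / sqrt ((norm w)\<^sup>2 + (\<psi> - \<sigma>)\<^sup>2) ^ 3)"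
proof -
  have alg: "c\<^sup>2 * (F * K * (\<sigma> * c) / (c * s) ^ 3) = F * K * (\<sigma> / s ^ 3)" for F K s :: real
    using h(2) by (simp add: power_mult_distrib power2_eq_square power3_eq_cube)
  show ?thesis
    unfolding poisson_def poisson_distance(1)[OF P h u, folded \<psi>_def] h(1) by (rule alg)
qed

text \<open>Neither \<open>P\<close> nor \<open>c\<close> occurs on the right, so the same function
  dominates in the limit and proves integrability for a fixed \<open>P\<close>.\<close>

lemma poisson_bound:
  assumes P: "P \<in> near" and h: "height P = \<sigma> * c" "0 < c" "\<bar>\<sigma>\<bar> = 1"
  shows "\<bar>c\<^sup>2 * (indicator (punctured P) (proj P + c *\<^sub>R w) * poisson P (proj P + c *\<^sub>R w))\<bar>
    \<le> M * B * sqrt 17 ^ 3 * (1 / sqrt (1 + (norm w)\<^sup>2) ^ 3)"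
proof (cases "proj P + c *\<^sub>R w \<in> punctured P")
  case True
  then have u: "proj P + c *\<^sub>R w \<in> ball 0 \<delta>" by (simp add: punctured_def)
  define u where "u = proj P + c *\<^sub>R w"
  define X where "X = (norm w)\<^sup>2 + ((\<phi> u - \<phi> (proj P)) / c - \<sigma>)\<^sup>2"
  have X: "(1 + (norm w)\<^sup>2) / 17 \<le> X" using poisson_distance(2)[OF P h u] by (simp add: X_def u_def)
  have p1: "0 < 1 + (norm w)\<^sup>2" by (simp add: add_pos_nonneg)
  have "u \<noteq> proj P" using True unfolding u_def punctured_def by blast
  then have ne: "P \<noteq> gam u" by auto
  have K: "\<bar>kernel_sing e P (gam u)\<bar> \<le> B"
    using B(2)[of P "gam u"] P gam_pos[OF u] ne by (auto simp: near_def u_def)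
  have F: "\<bar>f (gam u)\<bar> \<le> M" using f_bound[OF u] by (simp add: u_def)
  have "sqrt (1 + (norm w)\<^sup>2) / sqrt 17 \<le> sqrt X" using X by (metis real_sqrt_divide real_sqrt_le_iff)
  moreover have "0 < X" using less_le_trans[OF _ X] p1 by simp
  ultimately have "1 / sqrt X ^ 3 \<le> 1 / (sqrt (1 + (norm w)\<^sup>2) / sqrt 17) ^ 3"
    using p1 by (intro divide_left_mono power_mono mult_pos_pos zero_less_power) auto
  also have "\<dots> = sqrt 17 ^ 3 * (1 / sqrt (1 + (norm w)\<^sup>2) ^ 3)" by (simp add: power_divide)
  finally have 1: "1 / sqrt X ^ 3 \<le> sqrt 17 ^ 3 * (1 / sqrt (1 + (norm w)\<^sup>2) ^ 3)" .
  have X0: "0 \<le> sqrt X" using X p1 by simp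
  have "\<bar>c\<^sup>2 * poisson P u\<bar> = \<bar>f (gam u)\<bar> * \<bar>kernel_sing e P (gam u)\<bar> * (1 / sqrt X ^ 3)"
    unfolding u_def poisson_scaled[OF P h u] X_def abs_mult abs_divide h(3)
    using X0 by (simp add: X_def u_def)
  also have "\<dots> \<le> M * B * (sqrt 17 ^ 3 * (1 / sqrt (1 + (norm w)\<^sup>2) ^ 3))"
    using F K 1 X0 M_nonneg B(1) by (intro mult_mono) auto
  finally show ?thesis using True by (simp add: u_def)
next
  case False
  then show ?thesis using M_nonneg B(1) by simp
qed

lemma poisson_dominator: "integrable (lborel :: (real^2) measure) (\<lambda>w. M * B * sqrt 17 ^ 3 * (1 / sqrt (1 + (norm w)\<^sup>2) ^ 3))"
  by (rule integrable_mult_right[OF poisson_integral(1)])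

lemma poisson_measurable_scaled:
  assumes P: "P \<in> near"
  shows "(\<lambda>w. c\<^sup>2 * (indicator (punctured P) (proj P + c *\<^sub>R w) * poisson P (proj P + c *\<^sub>R w))) \<in> borel_measurable borel"
proof -
  have m: "(\<lambda>w. proj P + c *\<^sub>R w) \<in> borel_measurable borel"
    by (intro borel_measurable_continuous_onI continuous_intros)
  have "(\<lambda>w. indicator (punctured P) (proj P + c *\<^sub>R w) * poisson P (proj P + c *\<^sub>R w)) \<in> borel_measurable borel"
    using measurable_compose[OF m measurable_weak(2)[OF P]] by simp
  from borel_measurable_times[OF borel_measurable_const this] show ?thesis .
qed

lemma height_tendsto:
  assumes lim: "P \<longlonglongrightarrow> N"
  shows "(\<lambda>i. proj (P i)) \<longlonglongrightarrow> 0" "(\<lambda>i. height (P i)) \<longlonglongrightarrow> 0"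
proof -
  have "isCont proj N" using continuous_on_proj[OF continuous_on_id, of UNIV] by (simp add: continuous_on_eq_continuous_at)
  from isCont_tendsto_compose[OF this lim] show pl: "(\<lambda>i. proj (P i)) \<longlonglongrightarrow> 0" by simp
  have "isCont \<phi> 0" using continuous_on_\<phi> pos by (simp add: continuous_on_eq_continuous_at)
  from isCont_tendsto_compose[OF this pl] have 1: "(\<lambda>i. \<phi> (proj (P i))) \<longlonglongrightarrow> 0" by (simp add: \<phi>_0)
  have "(\<lambda>i. ht (P i)) \<longlonglongrightarrow> ht N" unfolding ht_def by (intro tendsto_intros lim)
  then show "(\<lambda>i. height (P i)) \<longlonglongrightarrow> 0" using tendsto_diff[OF _ 1] unfolding height_def by fastforce
qed

text \<open>The gradient of \<open>\<phi>\<close> vanishes at 0, but the base points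
  \<open>p i\<close> move, so differentiability at 0 alone does not control these quotients.
  Continuity of the normal makes the Lipschitz constant of \<open>\<phi>\<close> arbitrarily small
  on a small disc, which does.\<close>

lemma slope_tendsto:
  assumes p: "p \<longlonglongrightarrow> 0" and c: "c \<longlonglongrightarrow> 0" "\<And>i::nat. 0 < c i"
  shows "(\<lambda>i. (\<phi> (p i + c i *\<^sub>R w) - \<phi> (p i)) / c i) \<longlonglongrightarrow> 0"
proof (rule LIMSEQ_I)
  fix \<epsilon> :: real assume \<epsilon>: "0 < \<epsilon>"
  \<comment> \<open>Chosen so that \<open>2 * \<kappa> * (norm w + 1)\<close> is
    \<open>\<epsilon> / 2\<close>, which leaves room for the strict inequality; the summand 1 covers
    \<open>w = 0\<close>.\<close>
  define \<kappa> where "\<kappa> = \<epsilon> / (2 * (norm w + 1)) / 2"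
  have \<kappa>: "0 < \<kappa>" using \<epsilon> by (simp add: \<kappa>_def add_nonneg_pos)
  have "isCont (\<lambda>u. \<nu> (gam u)) 0" using continuous_on_normal_gam pos by (simp add: continuous_on_eq_continuous_at)
  then have "((\<lambda>u. \<nu> (gam u)) \<longlongrightarrow> n) (at 0)" unfolding isCont_def gam_0 n_eq[symmetric] .
  then have "((\<lambda>u. norm (\<nu> (gam u) - n)) \<longlongrightarrow> norm (n - n)) (at 0)" by (intro tendsto_intros)
  then have "\<forall>\<^sub>F u in at 0. norm (\<nu> (gam u) - n) < \<kappa>" using \<kappa> by (intro order_tendstoD(2)) auto
  then obtain \<rho>0 where \<rho>0: "0 < \<rho>0" "\<And>u. u \<noteq> 0 \<Longrightarrow> dist u 0 < \<rho>0 \<Longrightarrow> norm (\<nu> (gam u) - n) < \<kappa>"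
    unfolding eventually_at by auto
  define \<rho> where "\<rho> = min \<rho>0 \<delta>"
  have \<rho>: "0 < \<rho>" "\<rho> \<le> \<delta>" using \<rho>0 pos by (auto simp: \<rho>_def)
  have close: "norm (\<nu> (gam u) - n) \<le> \<kappa>" if "u \<in> ball 0 \<rho>" for u
  proof (cases "u = 0")
    case True then show ?thesis using \<kappa> by (simp add: n_eq[symmetric])
  next
    case False then show ?thesis using \<rho>0(2)[of u] that by (simp add: \<rho>_def)
  qed
  have "(\<lambda>i. p i + c i *\<^sub>R w) \<longlonglongrightarrow> 0 + 0 *\<^sub>R w" by (intro tendsto_intros p c)
  then have "(\<lambda>i. p i + c i *\<^sub>R w) \<longlonglongrightarrow> 0" by simp
  from tendstoD[OF this \<rho>(1)] tendstoD[OF p \<rho>(1)]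
  have ev: "\<forall>\<^sub>F i in sequentially. p i + c i *\<^sub>R w \<in> ball 0 \<rho>" "\<forall>\<^sub>F i in sequentially. p i \<in> ball 0 \<rho>"
    by (simp_all only: mem_ball dist_commute)
  then have "\<forall>\<^sub>F i in sequentially. norm ((\<phi> (p i + c i *\<^sub>R w) - \<phi> (p i)) / c i - 0) < \<epsilon>"
  proof eventually_elim
    case (elim i)
    have "\<bar>\<phi> (p i + c i *\<^sub>R w) - \<phi> (p i)\<bar> \<le> 2 * \<kappa> * (c i * norm w)"
      using \<phi>_Lipschitz[OF \<rho>(2) close elim] c(2)[of i] by simp
    then have "\<bar>(\<phi> (p i + c i *\<^sub>R w) - \<phi> (p i)) / c i\<bar> \<le> 2 * \<kappa> * norm w"
      using c(2)[of i] by (simp add: field_simps)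
    also have "\<dots> \<le> 2 * \<kappa> * (norm w + 1)" using \<kappa> by simp
    also have "\<dots> = \<epsilon> / 2" by (simp add: \<kappa>_def field_simps add_nonneg_eq_0_iff)
    finally have "\<bar>(\<phi> (p i + c i *\<^sub>R w) - \<phi> (p i)) / c i\<bar> \<le> \<epsilon> / 2" .
    moreover have "\<epsilon> / 2 < \<epsilon>" using \<epsilon> by simp
    ultimately show ?case unfolding real_norm_def diff_zero by (rule le_less_trans)
  qed
  then show "\<exists>no. \<forall>i\<ge>no. norm ((\<phi> (p i + c i *\<^sub>R w) - \<phi> (p i)) / c i - 0) < \<epsilon>"
    by (simp add: eventually_sequentially)
qed

lemma poisson_limit:
  assumes P: "\<And>i. P i \<in> near" and lim: "P \<longlonglongrightarrow> N" and \<sigma>: "\<bar>\<sigma>\<bar> = 1"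
    and h: "\<And>i::nat. 0 < \<sigma> * height (P i)"
  shows "(\<lambda>i. integral\<^sup>L lborel (\<lambda>u. indicator (punctured (P i)) u * poisson (P i) u)) \<longlonglongrightarrow> \<sigma> * f N / 2"
proof -
  define c where "c = (\<lambda>i. \<sigma> * height (P i))"
  have \<sigma>\<sigma>: "\<sigma> * \<sigma> = 1" using \<sigma> by (metis abs_mult_self_eq mult_1)
  have c: "0 < c i" for i using h by (simp add: c_def)
  have hc: "height (P i) = \<sigma> * c i" for i using \<sigma>\<sigma> by (simp add: c_def mult.assoc[symmetric])
  have p0: "(\<lambda>i. proj (P i)) \<longlonglongrightarrow> 0" by (rule height_tendsto(1)[OF lim])
  have c0: "c \<longlonglongrightarrow> 0" unfolding c_def using tendsto_mult[OF tendsto_const height_tendsto(2)[OF lim], of \<sigma>] by simp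
  define s where "s = (\<lambda>i w. (c i)\<^sup>2 * (indicator (punctured (P i)) (proj (P i) + c i *\<^sub>R w) * poisson (P i) (proj (P i) + c i *\<^sub>R w)))"
  define L where "L = (\<lambda>w::real^2. \<sigma> * f N / (4 * pi) * (1 / sqrt (1 + (norm w)\<^sup>2) ^ 3))"
  have eq: "integral\<^sup>L lborel (\<lambda>u. indicator (punctured (P i)) u * poisson (P i) u) = integral\<^sup>L lborel (s i)" for i
    unfolding s_def by (rule integral_scale[OF measurable_weak(2)[OF P] c, symmetric])
  have "(\<lambda>i. integral\<^sup>L lborel (s i)) \<longlonglongrightarrow> integral\<^sup>L lborel L"
  proof (rule integral_dominated_convergence[OF _ _ poisson_dominator])
    have "integrable lborel L" unfolding L_def by (rule integrable_mult_right[OF poisson_integral(1)])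
    then show "L \<in> borel_measurable lborel" by (rule borel_measurable_integrable)
    show "s i \<in> borel_measurable lborel" for i
      unfolding s_def using poisson_measurable_scaled[OF P[of i]] by simp
    show "AE w in lborel. norm (s i w) \<le> M * B * sqrt 17 ^ 3 * (1 / sqrt (1 + (norm w)\<^sup>2) ^ 3)" for i
      unfolding s_def real_norm_def by (intro AE_I2 poisson_bound[OF P hc c \<sigma>])
    \<comment> \<open>The value \<open>w = 0\<close> is the removed foot point.\<close>
    have "AE w::real^2 in lborel. w \<noteq> 0" by (rule AE_lborel_singleton)
    then show "AE w in lborel. (\<lambda>i. s i w) \<longlonglongrightarrow> L w"
    proof eventually_elim
      case (elim w)
      define u where "u = (\<lambda>i. proj (P i) + c i *\<^sub>R w)"
      have "u \<longlonglongrightarrow> 0 + 0 *\<^sub>R w" unfolding u_def by (intro tendsto_intros p0 c0)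
      then have u0: "u \<longlonglongrightarrow> 0" by simp
      define \<psi> where "\<psi> = (\<lambda>i. (\<phi> (u i) - \<phi> (proj (P i))) / c i)"
      have \<psi>: "\<psi> \<longlonglongrightarrow> 0" unfolding \<psi>_def u_def by (rule slope_tendsto[OF p0 c0 c])
      have "\<forall>\<^sub>F i in sequentially. u i \<in> ball 0 \<delta>" using u0 pos by (intro topological_tendstoD) auto
      then have ev: "\<forall>\<^sub>F i in sequentially. f (gam (u i)) * kernel_sing e (P i) (gam (u i)) * (\<sigma> / sqrt ((norm w)\<^sup>2 + (\<psi> i - \<sigma>)\<^sup>2) ^ 3) = s i w"
      proof eventually_elim
        case (elim i)
        have "u i \<in> punctured (P i)" using elim c[of i] \<open>w \<noteq> 0\<close> by (simp add: punctured_def u_def)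
        then show ?case
          using poisson_scaled[OF P hc c \<sigma> elim[unfolded u_def]] by (simp add: s_def u_def \<psi>_def)
      qed
      have "isCont (\<lambda>u. f (gam u)) 0" "isCont gam 0"
        using f_cont isCont_gam pos by (simp_all add: continuous_on_eq_continuous_at)
      note fl = isCont_tendsto_compose[OF this(1) u0] and gl = isCont_tendsto_compose[OF this(2) u0]
      have kl: "(\<lambda>i. kernel_sing e (P i) (gam (u i))) \<longlonglongrightarrow> 1 / (4 * pi)"
      proof (rule tendsto_kernel_sing_diag[OF e lim _ N_pos])
        show "(\<lambda>i. gam (u i)) \<longlonglongrightarrow> N" using gl by simp
        have "proj (P i) \<noteq> proj (gam (u i))" for i using c[of i] elim by (simp add: u_def)
        then have "P i \<noteq> gam (u i)" for i by metis
        then show "\<forall>\<^sub>F i in sequentially. P i \<noteq> gam (u i)" by simp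
      qed
      have \<sigma>2: "(0 - \<sigma>)\<^sup>2 = 1" using \<sigma>\<sigma> by (simp add: power2_eq_square)
      have "0 < (norm w)\<^sup>2 + (0 - \<sigma>)\<^sup>2" unfolding \<sigma>2 by (simp add: add_nonneg_pos)
      then have "(\<lambda>i. f (gam (u i)) * kernel_sing e (P i) (gam (u i)) * (\<sigma> / sqrt ((norm w)\<^sup>2 + (\<psi> i - \<sigma>)\<^sup>2) ^ 3))
        \<longlonglongrightarrow> f (gam 0) * (1 / (4 * pi)) * (\<sigma> / sqrt ((norm w)\<^sup>2 + (0 - \<sigma>)\<^sup>2) ^ 3)"
        by (intro tendsto_intros fl kl \<psi>) auto
      also have "f (gam 0) * (1 / (4 * pi)) * (\<sigma> / sqrt ((norm w)\<^sup>2 + (0 - \<sigma>)\<^sup>2) ^ 3) = L w"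
        unfolding L_def \<sigma>2 gam_0 by (simp add: add.commute)
      finally show ?case using ev by (rule Lim_transform_eventually)
    qed
  qed
  also have "integral\<^sup>L lborel L = \<sigma> * f N / 2"
  proof -
    have "integral\<^sup>L lborel L = \<sigma> * f N / (4 * pi) * (2 * pi)"
      unfolding L_def by (subst integral_mult_right_zero) (simp only: poisson_integral(2))
    then show ?thesis by simp
  qed
  finally show ?thesis unfolding eq .
qed

lemma poisson_integrable:
  assumes P: "P \<in> near"
  shows "integrable lborel (\<lambda>u. indicator (punctured P) u * poisson P u)"
proof (cases "height P = 0")
  case True
  then show ?thesis by (simp add: poisson_def)
next
  case False
  define c where "c = \<bar>height P\<bar>"
  have h: "height P = sgn (height P) * c" "0 < c" "\<bar>sgn (height P)\<bar> = 1"
    using False by (auto simp: c_def sgn_mult_abs abs_sgn_eq)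
  have "integrable lborel (\<lambda>w. c\<^sup>2 * (indicator (punctured P) (proj P + c *\<^sub>R w) * poisson P (proj P + c *\<^sub>R w)))"
  proof (rule Bochner_Integration.integrable_bound[OF poisson_dominator])
    show "(\<lambda>w. c\<^sup>2 * (indicator (punctured P) (proj P + c *\<^sub>R w) * poisson P (proj P + c *\<^sub>R w))) \<in> borel_measurable lborel"
      using poisson_measurable_scaled[OF P] by simp
    show "AE w in lborel. norm (c\<^sup>2 * (indicator (punctured P) (proj P + c *\<^sub>R w) * poisson P (proj P + c *\<^sub>R w)))
       \<le> norm (M * B * sqrt 17 ^ 3 * (1 / sqrt (1 + (norm w)\<^sup>2) ^ 3))"
      unfolding real_norm_def by (intro AE_I2 order_trans[OF poisson_bound[OF P h] abs_ge_self])
  qed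
  then have 1: "integrable lborel (\<lambda>w. indicator (punctured P) (proj P + c *\<^sub>R w) * poisson P (proj P + c *\<^sub>R w))"
    using h(2) by simp
  have m: "(\<lambda>w. proj P + c *\<^sub>R w) \<in> measurable lborel borel"
    using borel_measurable_continuous_onI[of "\<lambda>w. proj P + c *\<^sub>R w"] by (simp add: continuous_intros)
  have "integrable (density (distr lborel borel (\<lambda>w. proj P + c *\<^sub>R w)) (\<lambda>_. ennreal (\<bar>c\<bar> ^ DIM(real^2)))) (\<lambda>u. indicator (punctured P) u * poisson P u)"
    using 1 h(2) measurable_weak(2)[OF P] m
    by (subst integrable_density) (auto simp: integrable_distr_eq)
  then show ?thesis using lborel_affine[of c "proj P"] h(2) by simp
qed

end

section \<open>The parametrized surface\<close>

text \<open>Along the curve the normal component of the increment is of smaller order than the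
  increment, hence than \<open>y - x\<close>. The derivative within the interval covers the end
  points, where it is one-sided.\<close>

lemma tangent_vector:
  fixes c :: "real \<Rightarrow> real^3"
  assumes normal: "unit_normal_at S (c x) n" and ab: "a < b" "x \<in> {a..b}"
    and c: "(c has_vector_derivative c') (at x within {a..b})"
    and S: "\<forall>\<^sub>F y in at x within {a..b}. c y \<in> S"
  shows "c' \<bullet> n = 0"
proof -
  define F where "F = at x within {a..b}"
  have nb: "F \<noteq> bot" unfolding F_def using ab by (simp add: trivial_limit_within islimpt_Icc)
  have n1: "norm n = 1" using normal by (simp add: unit_normal_at_def)
  \<comment> \<open>At \<open>Q = c x\<close> the quotient is 0 by the convention for division by
    zero, so \<open>m\<close> is continuous there and the curve may return to \<open>c x\<close> at
    nearby parameters.\<close>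
  define m where "m = (\<lambda>Q. ((Q - c x) \<bullet> n) / norm (Q - c x))"
  have "continuous (at (c x) within S) m"
    using normal by (simp add: unit_normal_at_def m_def continuous_within)
  moreover have "(c \<longlongrightarrow> c x) F"
    using has_vector_derivative_continuous[OF c] by (simp add: continuous_within F_def)
  ultimately have m0: "((\<lambda>y. m (c y)) \<longlongrightarrow> 0) F"
    using S continuous_within_tendsto_compose[of "c x" S m c F] by (simp add: F_def m_def)
  define E where "E = (\<lambda>y. (1 / norm (y - x)) *\<^sub>R (c y - (c x + (y - x) *\<^sub>R c')))"
  have E: "(E \<longlongrightarrow> 0) F"
    using c by (simp add: has_vector_derivative_def has_derivative_within E_def F_def)
  have "((\<lambda>y. \<bar>m (c y)\<bar> * (norm (E y) + norm c') + norm (E y)) \<longlongrightarrow> \<bar>0\<bar> * (norm (0::real^3) + norm c') + norm (0::real^3)) F"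
    by (intro tendsto_intros m0 E)
  then have lim: "((\<lambda>y. \<bar>m (c y)\<bar> * (norm (E y) + norm c') + norm (E y)) \<longlongrightarrow> 0) F" by simp
  have "\<forall>\<^sub>F y in F. y \<noteq> x" by (simp add: F_def eventually_at_filter)
  then have "\<forall>\<^sub>F y in F. \<bar>c' \<bullet> n\<bar> \<le> \<bar>m (c y)\<bar> * (norm (E y) + norm c') + norm (E y)"
  proof eventually_elim
    case (elim y)
    define d where "d = \<bar>y - x\<bar>"
    have d: "0 < d" using elim by (simp add: d_def)
    have Ey: "d *\<^sub>R E y = c y - c x - (y - x) *\<^sub>R c'" using d by (simp add: E_def d_def algebra_simps)
    have "norm (c y - c x) = norm (d *\<^sub>R E y + (y - x) *\<^sub>R c')" unfolding Ey by simp
    also have "\<dots> \<le> d * (norm (E y) + norm c')"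
      using norm_triangle_ineq[of "d *\<^sub>R E y" "(y - x) *\<^sub>R c'"] d
      unfolding norm_scaleR d_def[symmetric] by (simp add: distrib_left)
    finally have 1: "norm (c y - c x) \<le> d * (norm (E y) + norm c')" .
    have "(c y - c x) \<bullet> n = m (c y) * norm (c y - c x)" by (simp add: m_def)
    then have 2: "\<bar>(c y - c x) \<bullet> n\<bar> \<le> \<bar>m (c y)\<bar> * (d * (norm (E y) + norm c'))"
      using 1 by (simp add: abs_mult mult_left_mono)
    have "(y - x) * (c' \<bullet> n) = (c y - c x) \<bullet> n - d * (E y \<bullet> n)"
      using arg_cong[OF Ey, of "\<lambda>w. w \<bullet> n"] by (simp add: inner_diff_left)
    then have "d * \<bar>c' \<bullet> n\<bar> = \<bar>(c y - c x) \<bullet> n - d * (E y \<bullet> n)\<bar>" by (metis abs_mult d_def)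
    also have "\<dots> \<le> \<bar>(c y - c x) \<bullet> n\<bar> + d * \<bar>E y \<bullet> n\<bar>"
      using abs_triangle_ineq4[of "(c y - c x) \<bullet> n" "d * (E y \<bullet> n)"] d by (simp add: abs_mult)
    also have "\<dots> \<le> \<bar>m (c y)\<bar> * (d * (norm (E y) + norm c')) + d * norm (E y)"
      using 2 mult_left_mono[OF Cauchy_Schwarz_ineq2[of "E y" n], of d] d n1 by (intro add_mono) auto
    also have "\<dots> = d * (\<bar>m (c y)\<bar> * (norm (E y) + norm c') + norm (E y))" by (simp add: algebra_simps)
    finally show ?case using d by simp
  qed
  from tendsto_le[OF nb lim tendsto_const this] show ?thesis by simp
qed

text \<open>The kernel at \<open>Q = P\<close> is a derivative that need not exist, hence an unspecified value.\<close>

lemma measurable_indicator_remove_point: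
  fixes h :: "'a::euclidean_space \<Rightarrow> real"
  assumes "(\<lambda>p. indicator (A - {z}) p * h p) \<in> borel_measurable borel"
  shows "(\<lambda>p. indicator A p * h p) \<in> borel_measurable borel"
proof -
  have "(\<lambda>p. indicator A p * h p) = (\<lambda>p. indicator (A - {z}) p * h p + indicator {z} p * (indicator A z * h z))"
    by (rule ext) (auto simp: indicator_def)
  moreover have "(\<lambda>p. indicator {z} p * (indicator A z * h z)) \<in> borel_measurable borel"
    by (intro borel_measurable_times borel_measurable_indicator) auto
  ultimately show ?thesis using borel_measurable_add[OF assms] by simp
qed

locale double_layer =
  fixes \<alpha> s1 s2 t1 t2 :: real and \<Gamma> :: "(real^3) set" and \<nu> :: "real^3 \<Rightarrow> real^3"
    and r rs rt :: "real \<Rightarrow> real \<Rightarrow> real^3" and \<mu> :: "real^3 \<Rightarrow> real" and R :: "(real \<times> real) set"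
  defines "R \<equiv> {s1..s2} \<times> {t1..t2}"
  assumes alpha: "0 < 2 * \<alpha>" "2 * \<alpha> < 1"
    and Gamma: "\<Gamma> \<subseteq> {P. 0 < P$1}" "lyapunov_surface \<Gamma> \<nu>"
    and edge: "closure \<Gamma> - \<Gamma> \<subseteq> {P. P$1 = 0}"
    and rectangle: "s1 < s2" "t1 < t2"
    and param: "(\<lambda>(s, t). r s t) ` R = closure \<Gamma>"
    and deriv_s: "\<And>s t. (s, t) \<in> R \<Longrightarrow>
          ((\<lambda>a. r a t) has_vector_derivative rs s t) (at s within {s1..s2})"
    and deriv_t: "\<And>s t. (s, t) \<in> R \<Longrightarrow>
          ((\<lambda>b. r s b) has_vector_derivative rt s t) (at t within {t1..t2})"
    and cont_deriv: "continuous_on R (\<lambda>(s, t). rs s t)" "continuous_on R (\<lambda>(s, t). rt s t)"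
    and mu: "continuous_on (closure \<Gamma>) \<mu>"
begin

definition rr :: "real \<times> real \<Rightarrow> real^3" where "rr p = r (fst p) (snd p)"

definition jac :: "real \<times> real \<Rightarrow> real" where
  "jac p = norm (cross3 (rs (fst p) (snd p)) (rt (fst p) (snd p)))"

lemma rr_case: "(\<lambda>(a, b). r a b) = rr"
  by (auto simp: rr_def)

lemma rr_deriv:
  assumes "(a, b) \<in> R"
  shows "(rr has_derivative (\<lambda>(x, y). x *\<^sub>R rs a b + y *\<^sub>R rt a b)) (at (a, b) within R)"
proof -
  have ab: "a \<in> {s1..s2}" "b \<in> {t1..t2}" using assms by (auto simp: R_def)
  have "((\<lambda>(x, y). r x y) has_derivative (\<lambda>(tx, ty). tx *\<^sub>R rs a b + blinfun_scaleR_left (rt a b) ty)) (at (a, b) within {s1..s2} \<times> {t1..t2})"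
  proof (rule has_derivative_partialsI)
    show "((\<lambda>x. r x b) has_derivative (\<lambda>tx. tx *\<^sub>R rs a b)) (at a within {s1..s2})"
      using deriv_s[OF assms] by (simp add: has_vector_derivative_def)
    show "((\<lambda>y. r x y) has_derivative blinfun_apply (blinfun_scaleR_left (rt x y))) (at y within {t1..t2})"
      if "x \<in> {s1..s2}" "y \<in> {t1..t2}" for x y
      using deriv_t[of x y] that by (simp add: has_vector_derivative_def R_def)
    have "continuous_on R (\<lambda>p. blinfun_scaleR_left (case p of (s, t) \<Rightarrow> rt s t))"
      by (rule bounded_linear.continuous_on[OF bounded_linear_blinfun_scaleR_left cont_deriv(2)])
    then show "continuous (at (a, b) within {s1..s2} \<times> {t1..t2}) (\<lambda>(x, y). blinfun_scaleR_left (rt x y))"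
      using assms by (simp add: continuous_on_eq_continuous_within R_def case_prod_beta')
  qed (use ab in auto)
  then show ?thesis by (simp add: rr_case R_def)
qed

lemma continuous_on_rr: "continuous_on R rr"
  unfolding continuous_on_eq_continuous_within
proof
  fix p assume "p \<in> R"
  then show "continuous (at p within R) rr"
    by (cases p) (auto intro: has_derivative_continuous[OF rr_deriv])
qed

lemma compact_R: "compact R"
  unfolding R_def by (intro compact_Times compact_Icc)

lemma R_borel: "R \<in> sets borel"
  using compact_R by (simp add: borel_compact)

lemma rr_image: "rr ` R = closure \<Gamma>" using param by (simp add: rr_case)

text \<open>Closing the surface adds only points of the plane \<open>x = 0\<close>, so membership in
  \<open>\<Gamma>\<close> becomes an open condition on the parameters.\<close>

lemma rr_in_Gamma: "p \<in> R \<Longrightarrow> rr p \<in> \<Gamma> \<longleftrightarrow> 0 < rr p $ 1"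
  using rr_image edge Gamma(1) by fastforce

lemma vimage_borel: "open B \<Longrightarrow> R \<inter> rr -` B \<in> sets borel"
proof -
  assume "open B"
  then obtain A where "open A" "A \<inter> R = rr -` B \<inter> R"
    using continuous_on_rr unfolding continuous_on_open_invariant by blast
  then show ?thesis using R_borel by (metis Int_commute borel_open sets.Int)
qed

lemma jac_continuous: "continuous_on R jac"
proof -
  have "continuous_on R (\<lambda>p. rs (fst p) (snd p))" "continuous_on R (\<lambda>p. rt (fst p) (snd p))"
    using cont_deriv by (simp_all add: split_beta)
  then show ?thesis unfolding jac_def[abs_def] by (intro continuous_on_norm continuous_on_cross)
qed

section \<open>One parameter for each surface point\<close>

definition reps :: "(real \<times> real) set" where "reps = param_reps r R \<Gamma>"

definition lex_less :: "real \<times> real \<Rightarrow> real \<times> real \<Rightarrow> bool" where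
  "lex_less p q \<longleftrightarrow> fst p < fst q \<or> (fst p = fst q \<and> snd p < snd q)"

lemma reps_iff: "p \<in> reps \<longleftrightarrow> p \<in> R \<and> 0 < rr p $ 1 \<and> (\<forall>q\<in>R. rr q = rr p \<longrightarrow> \<not> lex_less q p)"
proof -
  have "p \<in> reps \<longleftrightarrow> p \<in> R \<and> rr p \<in> \<Gamma> \<and> (\<forall>q\<in>R. rr q = rr p \<longrightarrow> \<not> lex_less q p)"
    by (cases p) (auto simp: reps_def param_reps_def rr_def lex_less_def not_less order_le_less Ball_def)
  then show ?thesis using rr_in_Gamma by blast
qed

lemma reps_inj: "inj_on rr reps"
proof (rule inj_onI)
  fix p q assume "p \<in> reps" "q \<in> reps" "rr p = rr q"
  then have "\<not> lex_less p q" "\<not> lex_less q p" unfolding reps_iff by auto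
  then show "p = q" by (auto simp: lex_less_def prod_eq_iff)
qed

text \<open>The fibre over a point is compact: its first coordinate attains a minimum, and on the
  slice where it does, so does the second.\<close>

lemma reps_image: "rr ` reps = \<Gamma>"
proof (intro equalityI subsetI)
  fix Q assume Q: "Q \<in> \<Gamma>"
  define F where "F = {p \<in> R. rr p = Q}"
  have "closedin (top_of_set R) F"
    unfolding F_def using continuous_closedin_preimage_constant[OF continuous_on_rr, of Q] by simp
  then have F: "compact F" using compact_R closedin_compact by blast
  have "Q \<in> rr ` R" using Q closure_subset rr_image by blast
  then have "F \<noteq> {}" by (auto simp: F_def)
  then obtain p where p: "p \<in> F" "\<forall>q\<in>F. fst p \<le> fst q"
    using continuous_attains_inf[OF F _ continuous_on_fst[OF continuous_on_id]] by blast
  define G where "G = F \<inter> {q. fst q = fst p}"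
  have "closed {q :: real \<times> real. fst q = fst p}"
    by (intro closed_Collect_eq continuous_intros)
  then have G: "compact G" unfolding G_def using F by (intro compact_Int_closed)
  have "G \<noteq> {}" using p by (auto simp: G_def)
  then obtain q where q: "q \<in> G" "\<forall>q'\<in>G. snd q \<le> snd q'"
    using continuous_attains_inf[OF G _ continuous_on_snd[OF continuous_on_id]] by blast
  have "\<not> lex_less q' q" if "q' \<in> F" for q'
  proof
    assume "lex_less q' q"
    then have "fst q' = fst q" "snd q' < snd q" using p(2) that q(1) by (force simp: lex_less_def G_def)+
    then show False using q(2) that q(1) by (force simp: G_def)
  qed
  then have "q \<in> reps" unfolding reps_iff using q(1) Q Gamma(1) by (auto simp: G_def F_def)
  moreover have "rr q = Q" using q by (simp add: G_def F_def)
  ultimately show "Q \<in> rr ` reps" by blast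
next
  fix Q assume "Q \<in> rr ` reps"
  then show "Q \<in> \<Gamma>" using rr_in_Gamma by (auto simp: reps_iff)
qed

text \<open>The parameters that are not least for their point form a countable union of projections of compact sets.\<close>

lemma reps_borel: "reps \<in> sets borel"
proof -
  \<comment> \<open>Strict lexicographic order is not closed; demanding a gap of at least
    \<open>1 / Suc n\<close> makes it so, and every strict inequality has such a gap for some
    \<open>n\<close>.\<close>
  define K where "K = (\<lambda>n::nat. {z \<in> R \<times> R. rr (fst z) = rr (snd z) \<and>
     (fst (snd z) \<le> fst (fst z) - 1 / Suc n \<or> (fst (snd z) = fst (fst z) \<and> snd (snd z) \<le> snd (fst z) - 1 / Suc n))})"
  have "compact (K n)" for n
  proof -
    have c1: "continuous_on (R \<times> R) (\<lambda>z. rr (fst z))" "continuous_on (R \<times> R) (\<lambda>z. rr (snd z))"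
      by (rule continuous_on_compose2[OF continuous_on_rr]; auto intro!: continuous_intros)+
    have 1: "closedin (top_of_set (R \<times> R)) {z \<in> R \<times> R. rr (fst z) - rr (snd z) = 0}"
      by (intro continuous_closedin_preimage_constant continuous_intros c1)
    have 2: "closed {z :: (real \<times> real) \<times> (real \<times> real). fst (snd z) \<le> fst (fst z) - 1 / Suc n \<or> (fst (snd z) = fst (fst z) \<and> snd (snd z) \<le> snd (fst z) - 1 / Suc n)}"
      by (intro closed_Collect_disj closed_Collect_conj closed_Collect_le closed_Collect_eq continuous_intros)
    have "compact {z \<in> R \<times> R. rr (fst z) - rr (snd z) = 0}"
      using 1 compact_Times[OF compact_R compact_R] closedin_compact by blast
    from compact_Int_closed[OF this 2] show ?thesis
      by (rule back_subst[of compact]) (auto simp: K_def)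
  qed
  then have "compact (fst ` K n)" for n
    by (intro compact_continuous_image continuous_intros)
  then have "(\<Union>n. fst ` K n) \<in> sets borel" by (intro sets.countable_UN) (auto intro: borel_compact)
  moreover have "reps = (R \<inter> rr -` {P. 0 < P $ 1}) - (\<Union>n. fst ` K n)"
  proof -
    have K_iff: "p \<in> (\<Union>n. fst ` K n) \<longleftrightarrow> (\<exists>q\<in>R. rr q = rr p \<and> lex_less q p)" if p: "p \<in> R" for p
    proof
      assume "p \<in> (\<Union>n. fst ` K n)"
      then obtain n z where z: "z \<in> K n" "p = fst z" by auto
      have lt: "x < y" if "x \<le> y - 1 / (1 + real n)" for x y :: real
      proof -
        have "0 < 1 / (1 + real n)" by simp
        then show ?thesis using that by linarith
      qed
      have "lex_less (snd z) p" using z by (auto simp: K_def lex_less_def dest!: lt)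
      then show "\<exists>q\<in>R. rr q = rr p \<and> lex_less q p" using z by (auto simp: K_def)
    next
      assume "\<exists>q\<in>R. rr q = rr p \<and> lex_less q p"
      then obtain q where q: "q \<in> R" "rr q = rr p" "lex_less q p" by auto
      define d where "d = (if fst q < fst p then fst p - fst q else snd p - snd q)"
      have "0 < d" using q(3) by (auto simp: d_def lex_less_def)
      then obtain n where "1 / real (Suc n) < d" using nat_approx_posE by blast
      then have "(p, q) \<in> K n" using q p by (auto simp: K_def d_def lex_less_def split: if_splits)
      then show "p \<in> (\<Union>n. fst ` K n)" by (force intro: image_eqI[of _ fst "(p, q)"])
    qed
    show ?thesis
    proof (rule set_eqI)
      fix p
      show "p \<in> reps \<longleftrightarrow> p \<in> (R \<inter> rr -` {P. 0 < P $ 1}) - (\<Union>n. fst ` K n)"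
        using K_iff[of p] unfolding reps_iff Diff_iff Int_iff vimage_eq mem_Collect_eq by blast
    qed
  qed
  moreover have "R \<inter> rr -` {P. 0 < P $ 1} \<in> sets borel"
    by (rule vimage_borel) (intro open_Collect_less continuous_intros)
  ultimately show ?thesis by (simp add: sets.Diff)
qed

lemma reps_sub: "reps \<subseteq> R" by (auto simp: reps_iff)

lemma reps_Gamma: "p \<in> reps \<Longrightarrow> rr p \<in> \<Gamma>" using reps_image by blast

lemma unit_normal_Gamma: "Q \<in> \<Gamma> \<Longrightarrow> unit_normal_at \<Gamma> Q (\<nu> Q)"
  using Gamma(2) by (simp add: lyapunov_surface_def)

lemma norm_normal: "Q \<in> \<Gamma> \<Longrightarrow> norm (\<nu> Q) = 1"
  using unit_normal_Gamma by (simp add: unit_normal_at_def)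

text \<open>On each coordinate line the first coordinate stays positive near the point, so the curve
  remains in \<open>\<Gamma>\<close>, as \<open>tangent_vector\<close> requires.\<close>

lemma tangent:
  assumes p: "(a, b) \<in> R" "r a b \<in> \<Gamma>"
  shows "rs a b \<bullet> \<nu> (r a b) = 0" "rt a b \<bullet> \<nu> (r a b) = 0"
proof -
  have ab: "a \<in> {s1..s2}" "b \<in> {t1..t2}" using p by (auto simp: R_def)
  have pos: "0 < r a b $ 1" using p Gamma by auto
  have "((\<lambda>x. r x b) \<longlongrightarrow> r a b) (at a within {s1..s2})" "((\<lambda>y. r a y) \<longlongrightarrow> r a b) (at b within {t1..t2})"
    using has_vector_derivative_continuous[OF deriv_s[OF p(1)]] has_vector_derivative_continuous[OF deriv_t[OF p(1)]]
    by (simp_all add: continuous_within)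
  note lims = this
  have "((\<lambda>x. r x b $ 1) \<longlongrightarrow> r a b $ 1) (at a within {s1..s2})" "((\<lambda>y. r a y $ 1) \<longlongrightarrow> r a b $ 1) (at b within {t1..t2})"
    by (rule tendsto_vec_nth[OF lims(1)] tendsto_vec_nth[OF lims(2)])+
  from order_tendstoD(1)[OF this(1) pos] order_tendstoD(1)[OF this(2) pos]
  have ev: "\<forall>\<^sub>F x in at a within {s1..s2}. 0 < r x b $ 1" "\<forall>\<^sub>F y in at b within {t1..t2}. 0 < r a y $ 1" .
  have in1: "\<forall>\<^sub>F x in at a within {s1..s2}. x \<in> {s1..s2}" "\<forall>\<^sub>F y in at b within {t1..t2}. y \<in> {t1..t2}"
    by (simp_all add: eventually_at_filter)
  have "\<forall>\<^sub>F x in at a within {s1..s2}. r x b \<in> \<Gamma>"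
    using ev(1) in1(1) by eventually_elim (use rr_in_Gamma[of "(_, b)"] ab in \<open>auto simp: R_def rr_def\<close>)
  then show "rs a b \<bullet> \<nu> (r a b) = 0"
    using tangent_vector[OF _ rectangle(1) ab(1) deriv_s[OF p(1)]] unit_normal_Gamma[OF p(2)] by blast
  have "\<forall>\<^sub>F y in at b within {t1..t2}. r a y \<in> \<Gamma>"
    using ev(2) in1(2) by eventually_elim (use rr_in_Gamma[of "(a, _)"] ab in \<open>auto simp: R_def rr_def\<close>)
  then show "rt a b \<bullet> \<nu> (r a b) = 0"
    using tangent_vector[OF _ rectangle(2) ab(2) deriv_t[OF p(1)]] unit_normal_Gamma[OF p(2)] by blast
qed

lemma continuous_on_normal: "continuous_on \<Gamma> \<nu>"
  unfolding continuous_on_def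
proof
  fix Q assume Q: "Q \<in> \<Gamma>"
  obtain A l where A: "0 < A" "0 < l" "l \<le> 1"
    and ang: "\<And>P Q. P \<in> \<Gamma> \<Longrightarrow> Q \<in> \<Gamma> \<Longrightarrow> vec_angle (\<nu> P) (\<nu> Q) \<le> A * dist P Q powr l"
    using Gamma(2) unfolding lyapunov_surface_def by meson
  have Hoelder: "norm (\<nu> P - \<nu> Q) \<le> A * dist P Q powr l" if "P \<in> \<Gamma>" for P
    using norm_diff_le_angle[OF norm_normal[OF that] norm_normal[OF Q]] ang[OF that Q] by linarith
  have "((\<lambda>P. dist P Q) \<longlongrightarrow> dist Q Q) (at Q within \<Gamma>)" by (intro tendsto_intros)
  then have "((\<lambda>P. A * dist P Q powr l) \<longlongrightarrow> A * (0 powr l)) (at Q within \<Gamma>)"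
    using A by (intro tendsto_intros tendsto_powr') auto
  then have "((\<lambda>P. A * dist P Q powr l) \<longlongrightarrow> 0) (at Q within \<Gamma>)" by simp
  then have "((\<lambda>P. \<nu> P - \<nu> Q) \<longlongrightarrow> 0) (at Q within \<Gamma>)"
  proof (rule Lim_null_comparison[rotated])
    have "\<forall>\<^sub>F P in at Q within \<Gamma>. P \<in> \<Gamma>" by (simp add: eventually_at_filter)
    then show "\<forall>\<^sub>F P in at Q within \<Gamma>. norm (\<nu> P - \<nu> Q) \<le> A * dist P Q powr l"
      by eventually_elim (rule Hoelder)
  qed
  then show "(\<nu> \<longlongrightarrow> \<nu> Q) (at Q within \<Gamma>)" by (simp add: LIM_zero_iff)
qed

section \<open>The integrand in parameters: continuity, measurability, bounds\<close>

lemma exponent_pos: "0 < 1 - 2 * \<alpha>" using alpha by simp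

definition dlk :: "real^3 \<Rightarrow> real^3 \<Rightarrow> real" where
  "dlk P Q = conormal_deriv \<alpha> (\<nu> Q) (\<lambda>Q. q2 \<alpha> Q P) Q"

lemma Gamma_pos: "Q \<in> \<Gamma> \<Longrightarrow> 0 < Q $ 1" using Gamma(1) by auto

lemma dlk_eq:
  fixes P Q :: "real^3"
  assumes "0 < P $ 1" "Q \<in> \<Gamma>" "P \<noteq> Q"
  shows "dlk P Q = kernel_sing (1 - 2 * \<alpha>) P Q * ((P - Q) \<bullet> \<nu> Q) / norm (Q - P) ^ 3 + kernel_reg (1 - 2 * \<alpha>) P Q \<bullet> \<nu> Q"
  unfolding dlk_def by (rule conormal_deriv_q2[OF alpha assms(1) Gamma_pos assms(3)]) (rule assms)

lemma dlk_tendsto: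
  fixes p q :: "real^3"
  assumes P: "(P \<longlongrightarrow> p) F" and Q: "(Q \<longlongrightarrow> q) F" and ev: "\<forall>\<^sub>F x in F. Q x \<in> \<Gamma>"
    and pq: "0 < p $ 1" "q \<in> \<Gamma>" "p \<noteq> q"
  shows "((\<lambda>x. dlk (P x) (Q x)) \<longlongrightarrow> dlk p q) F"
proof -
  have "((\<lambda>x. P x $ 1) \<longlongrightarrow> p $ 1) F" by (intro tendsto_intros P)
  then have ev1: "\<forall>\<^sub>F x in F. 0 < P x $ 1" using pq(1) by (rule order_tendstoD(1))
  have "((\<lambda>x. norm (P x - Q x)) \<longlongrightarrow> norm (p - q)) F" by (intro tendsto_intros P Q)
  moreover have "0 < norm (p - q)" using pq(3) by simp
  ultimately have "\<forall>\<^sub>F x in F. 0 < norm (P x - Q x)" by (rule order_tendstoD(1))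
  with ev1 ev have eq: "\<forall>\<^sub>F x in F. kernel_sing (1 - 2 * \<alpha>) (P x) (Q x) * ((P x - Q x) \<bullet> \<nu> (Q x)) / norm (Q x - P x) ^ 3
     + kernel_reg (1 - 2 * \<alpha>) (P x) (Q x) \<bullet> \<nu> (Q x) = dlk (P x) (Q x)"
  proof eventually_elim
    case (elim x)
    then have "P x \<noteq> Q x" by auto
    then show ?case using dlk_eq elim by simp
  qed
  have n: "((\<lambda>x. \<nu> (Q x)) \<longlongrightarrow> \<nu> q) F"
    using continuous_on_tendsto_compose[OF continuous_on_normal Q pq(2) ev] .
  have "((\<lambda>x. kernel_sing (1 - 2 * \<alpha>) (P x) (Q x) * ((P x - Q x) \<bullet> \<nu> (Q x)) / norm (Q x - P x) ^ 3
     + kernel_reg (1 - 2 * \<alpha>) (P x) (Q x) \<bullet> \<nu> (Q x)) \<longlongrightarrow> kernel_sing (1 - 2 * \<alpha>) p q * ((p - q) \<bullet> \<nu> q) / norm (q - p) ^ 3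
     + kernel_reg (1 - 2 * \<alpha>) p q \<bullet> \<nu> q) F"
    using pq(3) by (intro tendsto_intros P Q n tendsto_kernel_sing[OF exponent_pos P Q pq(1) Gamma_pos[OF pq(2)] pq(3)]
        tendsto_kernel_reg[OF exponent_pos P Q pq(1) Gamma_pos[OF pq(2)] pq(3)]) auto
  then show ?thesis unfolding dlk_eq[OF pq] by (rule Lim_transform_eventually[OF _ eq])
qed

definition G :: "real^3 \<Rightarrow> real \<times> real \<Rightarrow> real" where
  "G P p = \<mu> (rr p) * dlk P (rr p) * jac p"

text \<open>By injectivity on \<open>reps\<close> at most one parameter is mapped to
  \<open>P\<close>; away from it the integrand is continuous.\<close>

lemma G_measurable:
  fixes P :: "real^3"
  assumes P: "0 < P $ 1" and Y: "Y \<in> sets borel" "Y \<subseteq> reps"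
  shows "(\<lambda>p. indicator Y p * G P p) \<in> borel_measurable borel"
proof -
  define X where "X = {p \<in> R. 0 < rr p $ 1 \<and> rr p \<noteq> P}"
  have "X = R \<inter> rr -` ({Q. 0 < Q $ 1} - {P})" by (auto simp: X_def)
  moreover have "open ({Q :: real^3. 0 < Q $ 1} - {P})"
    by (intro open_Diff closed_singleton open_Collect_less continuous_intros)
  ultimately have XB: "X \<in> sets borel" using vimage_borel by simp
  have XR: "X \<subseteq> R" by (auto simp: X_def)
  have X\<Gamma>: "rr p \<in> \<Gamma>" if "p \<in> X" for p using that rr_in_Gamma by (auto simp: X_def)
  have "continuous_on X (\<lambda>p. dlk P (rr p))"
    unfolding continuous_on_def
  proof
    fix p assume p: "p \<in> X"
    show "((\<lambda>p. dlk P (rr p)) \<longlongrightarrow> dlk P (rr p)) (at p within X)"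
    proof (rule dlk_tendsto[OF tendsto_const _ _ P X\<Gamma>[OF p]])
      show "(rr \<longlongrightarrow> rr p) (at p within X)"
        using continuous_on_subset[OF continuous_on_rr XR] p by (simp add: continuous_on_def)
      have "\<forall>\<^sub>F q in at p within X. q \<in> X" by (simp add: eventually_at_filter)
      then show "\<forall>\<^sub>F q in at p within X. rr q \<in> \<Gamma>" by eventually_elim (rule X\<Gamma>)
    qed (use p in \<open>auto simp: X_def\<close>)
  qed
  moreover have "continuous_on X (\<lambda>p. \<mu> (rr p))"
    by (rule continuous_on_compose2[OF mu continuous_on_subset[OF continuous_on_rr XR]])
       (use X\<Gamma> closure_subset in blast)
  moreover have "continuous_on X jac" by (rule continuous_on_subset[OF jac_continuous XR])
  ultimately have "continuous_on X (G P)" unfolding G_def[abs_def] by (intro continuous_on_mult)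
  from borel_measurable_continuous_on_indicator[OF XB this]
  have m: "(\<lambda>p. indicator X p * G P p) \<in> borel_measurable borel" by simp
  have "\<exists>z. Y - {z} \<subseteq> X"
  proof (cases "\<exists>z\<in>Y. rr z = P")
    case True
    then obtain z where z: "z \<in> Y" "rr z = P" by blast
    have "Y - {z} \<subseteq> X"
    proof
      fix p assume p: "p \<in> Y - {z}"
      then have "rr p \<noteq> rr z" using reps_inj z Y(2) by (auto dest: inj_onD)
      then show "p \<in> X" using p Y(2) z by (auto simp: X_def reps_iff)
    qed
    then show ?thesis ..
  next
    case False
    then have "Y \<subseteq> X" using Y(2) by (auto simp: X_def reps_iff)
    then show ?thesis by blast
  qed
  then obtain z where z: "Y - {z} \<subseteq> X" ..
  have "(\<lambda>p. indicator (Y - {z}) p * G P p) = (\<lambda>p. indicator (Y - {z}) p * (indicator X p * G P p))"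
  proof
    fix p
    show "indicator (Y - {z}) p * G P p = indicator (Y - {z}) p * (indicator X p * G P p)"
      using z by (cases "p \<in> Y - {z}") auto
  qed
  moreover have "(\<lambda>p. indicator (Y - {z}) p * (indicator X p * G P p)) \<in> borel_measurable borel"
    by (intro borel_measurable_times borel_measurable_indicator m) (use Y in auto)
  ultimately show ?thesis by (intro measurable_indicator_remove_point[of Y z]) simp
qed

lemma compact_closure: "compact (closure \<Gamma>)"
  using compact_continuous_image[OF continuous_on_rr compact_R] by (simp add: rr_image)

lemma mu_bound: "\<exists>M. \<forall>Q\<in>closure \<Gamma>. \<bar>\<mu> Q\<bar> \<le> M"
proof -
  have "bounded (\<mu> ` closure \<Gamma>)" by (intro compact_imp_bounded compact_continuous_image mu compact_closure)
  then show ?thesis by (auto simp: bounded_iff)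
qed

lemma jac_bound: "\<exists>C. \<forall>p\<in>R. jac p \<le> C"
proof -
  have "bounded (jac ` R)" by (intro compact_imp_bounded compact_continuous_image jac_continuous compact_R)
  then show ?thesis by (auto simp: bounded_iff abs_le_iff)
qed

lemma jac_nonneg: "0 \<le> jac p" by (simp add: jac_def)

lemma dlk_bound:
  fixes P Q :: "real^3"
  assumes P: "0 < P $ 1" and Q: "Q \<in> \<Gamma>" and d: "0 < d" "d \<le> norm (Q - P)"
    and B: "0 < B" "\<bar>kernel_sing (1 - 2 * \<alpha>) P Q\<bar> \<le> B" "norm (kernel_reg (1 - 2 * \<alpha>) P Q) \<le> B / norm (Q - P)"
  shows "\<bar>dlk P Q\<bar> \<le> B / d\<^sup>2 + B / d"
proof -
  define n where "n = norm (Q - P)"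
  have n: "0 < n" "d \<le> n" using d by (auto simp: n_def)
  have "P \<noteq> Q" using n by (auto simp: n_def)
  note eq = dlk_eq[OF P Q this]
  have "\<bar>(P - Q) \<bullet> \<nu> Q\<bar> \<le> n"
    using Cauchy_Schwarz_ineq2[of "P - Q" "\<nu> Q"] norm_normal[OF Q] by (simp add: n_def norm_minus_commute)
  then have "\<bar>kernel_sing (1 - 2 * \<alpha>) P Q * ((P - Q) \<bullet> \<nu> Q) / n ^ 3\<bar> \<le> B * n / n ^ 3"
    unfolding abs_divide abs_mult using B n by (intro frac_le mult_mono) auto
  also have "\<dots> = B / n\<^sup>2" using n by (simp add: power2_eq_square power3_eq_cube)
  also have "\<dots> \<le> B / d\<^sup>2" using B n d by (intro divide_left_mono power_mono mult_pos_pos) auto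
  finally have 1: "\<bar>kernel_sing (1 - 2 * \<alpha>) P Q * ((P - Q) \<bullet> \<nu> Q) / n ^ 3\<bar> \<le> B / d\<^sup>2" .
  have "\<bar>kernel_reg (1 - 2 * \<alpha>) P Q \<bullet> \<nu> Q\<bar> \<le> B / n"
    using Cauchy_Schwarz_ineq2[of "kernel_reg (1 - 2 * \<alpha>) P Q" "\<nu> Q"] norm_normal[OF Q] B(3) by (simp add: n_def)
  also have "\<dots> \<le> B / d" using B n d by (intro divide_left_mono mult_pos_pos) auto
  finally have 2: "\<bar>kernel_reg (1 - 2 * \<alpha>) P Q \<bullet> \<nu> Q\<bar> \<le> B / d" .
  show ?thesis unfolding eq n_def[symmetric] using 1 2 by linarith
qed

lemma integrable_const_on:
  assumes "Y \<in> sets borel" "Y \<subseteq> R"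
  shows "integrable lborel (\<lambda>p. indicator Y p * (K::real))"
proof -
  have "emeasure lborel Y \<le> emeasure lborel R" using assms R_borel by (intro emeasure_mono) auto
  also have "\<dots> < \<infinity>" by (rule emeasure_compact_finite[OF compact_R])
  finally show ?thesis using assms by (intro integrable_mult_left integrable_real_indicator) auto
qed

lemma G_bound:
  assumes "p \<in> reps" "\<bar>\<mu> (rr p)\<bar> \<le> M" "jac p \<le> C" "\<bar>dlk P (rr p)\<bar> \<le> K"
  shows "\<bar>G P p\<bar> \<le> M * K * C"
  unfolding G_def abs_mult using assms jac_nonneg[of p]
  by (intro mult_mono) (auto intro: order_trans[OF abs_ge_zero] mult_nonneg_nonneg)

lemma far_integrable:
  fixes P :: "real^3"
  assumes P: "0 < P $ 1" and Y: "Y \<in> sets borel" "Y \<subseteq> reps"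
    and d: "0 < d" "\<And>p. p \<in> Y \<Longrightarrow> d \<le> norm (rr p - P)"
  shows "set_integrable lborel Y (G P)"
proof -
  obtain M where M: "\<forall>Q\<in>closure \<Gamma>. \<bar>\<mu> Q\<bar> \<le> M" using mu_bound ..
  obtain C where C: "\<forall>p\<in>R. jac p \<le> C" using jac_bound ..
  \<comment> \<open>For a fixed \<open>P\<close> the slab in \<open>kernel_bounds\<close> shrinks to
    the plane through \<open>P\<close>.\<close>
  obtain B where B: "0 < B" "\<And>P' Q. P$1 \<le> P'$1 \<and> P'$1 \<le> P$1 \<and> 0 < Q$1 \<and> P' \<noteq> Q \<Longrightarrow>
    \<bar>kernel_sing (1 - 2 * \<alpha>) P' Q\<bar> \<le> B \<and> norm (kernel_reg (1 - 2 * \<alpha>) P' Q) \<le> B / norm (Q - P')"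
    using kernel_bounds[OF exponent_pos P, of "P$1"] by meson
  have bound: "\<bar>G P p\<bar> \<le> M * (B / d\<^sup>2 + B / d) * C" if p: "p \<in> Y" for p
  proof (rule G_bound)
    have \<Gamma>: "rr p \<in> \<Gamma>" using p Y reps_Gamma by blast
    show "p \<in> reps" using p Y by blast
    show "\<bar>\<mu> (rr p)\<bar> \<le> M" using M \<Gamma> closure_subset by blast
    show "jac p \<le> C" using C p Y reps_sub by blast
    have "P \<noteq> rr p" using d(2)[OF p] d(1) by auto
    then show "\<bar>dlk P (rr p)\<bar> \<le> B / d\<^sup>2 + B / d"
      using B(2)[of P "rr p"] Gamma_pos[OF \<Gamma>] by (intro dlk_bound[OF P \<Gamma> d(1) d(2)[OF p] B(1)]) auto
  qed
  show ?thesis unfolding set_integrable_def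
  proof (rule Bochner_Integration.integrable_bound[OF integrable_const_on[OF Y(1)]])
    show "Y \<subseteq> R" using Y reps_sub by blast
    show "(\<lambda>p. indicator Y p *\<^sub>R G P p) \<in> borel_measurable lborel" using G_measurable[OF P Y] by simp
    show "AE p in lborel. norm (indicator Y p *\<^sub>R G P p) \<le> norm (indicator Y p * (M * (B / d\<^sup>2 + B / d) * C))"
    proof (rule AE_I2)
      fix p
      show "norm (indicator Y p *\<^sub>R G P p) \<le> norm (indicator Y p * (M * (B / d\<^sup>2 + B / d) * C))"
        using bound[of p] by (cases "p \<in> Y") auto
    qed
  qed
qed

lemma off_surface_integrable:
  fixes P :: "real^3"
  assumes P: "0 < P $ 1" "P \<notin> \<Gamma>"
  shows "set_integrable lborel reps (G P)"
proof -
  have "P \<notin> closure \<Gamma>" using P edge by auto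
  then obtain d where d: "0 < d" "ball P d \<inter> closure \<Gamma> = {}"
    using open_contains_ball[of "- closure \<Gamma>"] by (auto simp: disjoint_eq_subset_Compl)
  show ?thesis
  proof (rule far_integrable[OF P(1) reps_borel subset_refl d(1)])
    fix p assume "p \<in> reps"
    then have "rr p \<notin> ball P d" using reps_Gamma closure_subset d(2) by blast
    then show "d \<le> norm (rr p - P)" by (simp add: dist_norm norm_minus_commute)
  qed
qed

end

section \<open>The jump relation\<close>

lemma set_integral_cong_off_point:
  fixes h k :: "'a::euclidean_space \<Rightarrow> real"
  assumes h: "(\<lambda>u. indicator A u * h u) \<in> borel_measurable borel"
    and k: "integrable lborel k" and eq: "\<And>u. u \<noteq> z \<Longrightarrow> indicator A u * h u = k u"
  shows "set_integrable lborel A h" "set_lebesgue_integral lborel A h = integral\<^sup>L lborel k"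
proof -
  have "AE u in lborel. u \<noteq> z" by (rule AE_lborel_singleton)
  then have ae: "AE u in lborel. indicator A u *\<^sub>R h u = k u"
    by eventually_elim (use eq in simp)
  have m: "(\<lambda>u. indicator A u *\<^sub>R h u) \<in> borel_measurable lborel" using h by simp
  have mk: "k \<in> borel_measurable lborel" by (rule borel_measurable_integrable[OF k])
  show "set_integrable lborel A h"
    unfolding set_integrable_def using integrable_cong_AE[OF m mk ae] k by blast
  show "set_lebesgue_integral lborel A h = integral\<^sup>L lborel k"
    unfolding set_lebesgue_integral_def by (rule integral_cong_AE[OF m mk ae])
qed

context double_layer
begin

text \<open>At \<open>P = N\<close> the height is 0 and the Poisson part vanishes, so the direct
  value consists of the weak and the far part alone. Both are continuous in \<open>P\<close> at
  \<open>N\<close>; the one-sided limits differ from the direct value exactly by the limit of the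
  Poisson part.\<close>

theorem jump_relation:
  assumes N: "N \<in> \<Gamma>"
    and D: "open D" "frontier D \<inter> {P. 0 < P $ 1} \<subseteq> \<Gamma>" "\<Gamma> \<subseteq> frontier D"
    and out: "points_outward D N (\<nu> N)"
  shows "set_integrable lborel reps (G N)"
    and "((\<lambda>P. set_lebesgue_integral lborel reps (G P)) \<longlongrightarrow> - (1 / 2) * \<mu> N + set_lebesgue_integral lborel reps (G N)) (at N within D)"
    and "((\<lambda>P. set_lebesgue_integral lborel reps (G P)) \<longlongrightarrow> 1 / 2 * \<mu> N + set_lebesgue_integral lborel reps (G N)) (at N within - closure D)"
proof -
  have N0: "0 < N $ 1" by (rule Gamma_pos[OF N])
  have "open {P :: real^3. 0 < P $ 1}" by (intro open_Collect_less continuous_intros)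
  from lyapunov_chart[OF Gamma(2) N this] N0 obtain e1 e2 \<phi> \<delta> \<eta> A l
    where ch: "chart N e1 e2 (\<nu> N) \<Gamma> \<nu> \<phi> \<delta> \<eta> A l"
      and W: "\<And>Q. frame.proj N e1 e2 Q \<in> ball 0 \<delta> \<Longrightarrow> \<bar>frame.ht N (\<nu> N) Q\<bar> < \<eta> \<Longrightarrow> Q \<in> {P. 0 < P $ 1}"
    by (simp only: mem_Collect_eq) metis
  interpret chart N e1 e2 "\<nu> N" \<Gamma> \<nu> \<phi> \<delta> \<eta> A l by (rule ch)
  obtain M where M: "\<forall>Q\<in>closure \<Gamma>. \<bar>\<mu> Q\<bar> \<le> M" using mu_bound ..
  obtain C where C: "\<forall>p\<in>R. jac p \<le> C" using jac_bound ..
  obtain B where B: "0 < B" "\<And>P Q :: real^3. N$1 / 2 \<le> P$1 \<and> P$1 \<le> 2 * N$1 \<and> 0 < Q$1 \<and> P \<noteq> Q \<Longrightarrow>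
    \<bar>kernel_sing (1 - 2 * \<alpha>) P Q\<bar> \<le> B \<and> norm (kernel_reg (1 - 2 * \<alpha>) P Q) \<le> B / norm (Q - P)"
    using kernel_bounds[OF exponent_pos, of "N$1 / 2" "2 * N$1"] N0 by auto
  have gam_\<Gamma>: "gam u \<in> \<Gamma>" if "u \<in> ball 0 \<delta>" for u by (rule graph_in_gam[OF that])
  interpret jump_chart N e1 e2 "\<nu> N" \<Gamma> \<nu> \<phi> \<delta> \<eta> A l "1 - 2 * \<alpha>" B M \<mu>
  proof unfold_locales
    show "continuous_on (ball 0 \<delta>) (\<lambda>u. \<mu> (gam u))"
      by (rule continuous_on_compose2[OF mu continuous_on_gam]) (use gam_\<Gamma> closure_subset in blast)
    show "\<bar>\<mu> (gam u)\<bar> \<le> M" if "u \<in> ball 0 \<delta>" for u using M gam_\<Gamma>[OF that] closure_subset by blast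
  qed (use exponent_pos N0 Gamma_pos B in auto)
  define T1 where "T1 = reps \<inter> rr -` cylinder"
  define T2 where "T2 = reps - T1"
  have T1_eq: "T1 = reps \<inter> (R \<inter> rr -` cylinder)" using reps_sub by (auto simp: T1_def)
  have T1: "T1 \<in> sets borel" unfolding T1_eq using reps_borel vimage_borel[OF open_cylinder] by (rule sets.Int)
  have T2: "T2 \<in> sets borel" unfolding T2_def using reps_borel T1 by (rule sets.Diff)
  have sub: "T1 \<subseteq> reps" "T2 \<subseteq> reps" "T1 \<inter> T2 = {}" "T1 \<union> T2 = reps" by (auto simp: T1_def T2_def)
  have im: "rr ` T1 = gam ` ball 0 \<delta>"
  proof -
    have "rr ` T1 = rr ` reps \<inter> cylinder" unfolding T1_def by blast
    also have "\<dots> = \<Gamma> \<inter> cylinder" by (simp only: reps_image)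
    also have "\<dots> = gam ` ball 0 \<delta>"
      using surface_in_cylinder gam_in_cylinder gam_\<Gamma> by (force simp: cylinder_def)
    finally show ?thesis .
  qed
  have near_pos: "0 < P $ 1" if "P \<in> near" for P :: "real^3" using that N0 by (simp add: near_def)
  have near_integral: "set_integrable lborel T1 (G P) \<and> set_lebesgue_integral lborel T1 (G P) =
      integral\<^sup>L lborel (\<lambda>u. indicator (punctured P) u * weak P u) + integral\<^sup>L lborel (\<lambda>u. indicator (punctured P) u * poisson P u)"
    if P: "P \<in> near" for P
  proof -
    define f where "f = (\<lambda>Q. \<mu> Q * dlk P Q)"
    define k where "k = (\<lambda>u. indicator (punctured P) u * weak P u + indicator (punctured P) u * poisson P u)"
    have k: "integrable lborel k" unfolding k_def
      by (intro Bochner_Integration.integrable_add weak_integrable poisson_integrable P)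
    have kI: "integral\<^sup>L lborel k = integral\<^sup>L lborel (\<lambda>u. indicator (punctured P) u * weak P u) + integral\<^sup>L lborel (\<lambda>u. indicator (punctured P) u * poisson P u)"
      unfolding k_def by (intro Bochner_Integration.integral_add weak_integrable poisson_integrable P)
    have dens: "indicator (ball 0 \<delta>) u * (f (gam u) / (\<nu> (gam u) \<bullet> \<nu> N)) = k u" if "u \<noteq> proj P" for u
    proof (cases "u \<in> ball 0 \<delta>")
      case True
      have "P \<noteq> gam u" using that by auto
      have "f (gam u) / (\<nu> (gam u) \<bullet> \<nu> N) = weak P u + poisson P u"
        unfolding f_def dlk_eq[OF near_pos[OF P] gam_\<Gamma>[OF True] \<open>P \<noteq> gam u\<close>] by (rule density_split[OF True])
      then show ?thesis using True that by (simp add: k_def punctured_def)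
    next
      case False
      then show ?thesis by (simp add: k_def punctured_def)
    qed
    have m2: "(\<lambda>u. indicator (ball 0 \<delta>) u * (f (gam u) / (\<nu> (gam u) \<bullet> \<nu> N))) \<in> borel_measurable borel"
    proof (rule measurable_indicator_remove_point[of _ "proj P"])
      have "(\<lambda>u. indicator (ball 0 \<delta> - {proj P}) u * (f (gam u) / (\<nu> (gam u) \<bullet> \<nu> N))) = k"
      proof
        fix u
        show "indicator (ball 0 \<delta> - {proj P}) u * (f (gam u) / (\<nu> (gam u) \<bullet> \<nu> N)) = k u"
          using dens[of u] by (cases "u = proj P") (auto simp: k_def punctured_def indicator_def)
      qed
      then show "(\<lambda>u. indicator (ball 0 \<delta> - {proj P}) u * (f (gam u) / (\<nu> (gam u) \<bullet> \<nu> N))) \<in> borel_measurable borel"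
        using borel_measurable_integrable[OF k] by simp
    qed
    have G_eq: "(\<lambda>(a, b). f (r a b) * norm (cross3 (rs a b) (rt a b))) = G P"
      by (auto simp: f_def G_def rr_def jac_def)
    have m1: "(\<lambda>p. indicator T1 p * (case p of (a, b) \<Rightarrow> f (r a b) * norm (cross3 (rs a b) (rt a b)))) \<in> borel_measurable borel"
      unfolding G_eq by (rule G_measurable[OF near_pos[OF P] T1 sub(1)])
    have der: "((\<lambda>(a, b). r a b) has_derivative (\<lambda>(x, y). x *\<^sub>R rs a b + y *\<^sub>R rt a b)) (at (a, b) within T1)"
      if "(a, b) \<in> T1" for a b
      unfolding rr_case using that sub(1) reps_sub by (intro has_derivative_subset[OF rr_deriv]) auto
    have tan: "rs a b \<bullet> \<nu> (r a b) = 0 \<and> rt a b \<bullet> \<nu> (r a b) = 0" if "(a, b) \<in> T1" for a b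
      using that sub(1) reps_sub reps_Gamma[of "(a, b)"] tangent[of a b] by (auto simp: rr_def)
    have inj: "inj_on (\<lambda>(a, b). r a b) T1" unfolding rr_case by (rule inj_on_subset[OF reps_inj sub(1)])
    have im': "(\<lambda>(a, b). r a b) ` T1 = gam ` ball 0 \<delta>" unfolding rr_case by (rule im)
    note tan1 = tan[THEN conjunct1] and tan2 = tan[THEN conjunct2]
    note ball = set_integral_cong_off_point[OF m2 k dens]
    have "set_integrable lborel T1 (G P) \<longleftrightarrow> set_integrable lborel (ball 0 \<delta>) (\<lambda>u. f (gam u) / (\<nu> (gam u) \<bullet> \<nu> N))"
      unfolding G_eq[symmetric]
      by (rule area_formula(1)[OF T1 inj im' _ _ _ m1 m2]; rule der tan1 tan2; assumption)
    then have a1: "set_integrable lborel T1 (G P)" using ball(1) by blast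
    have "set_lebesgue_integral lborel T1 (G P) = set_lebesgue_integral lborel (ball 0 \<delta>) (\<lambda>u. f (gam u) / (\<nu> (gam u) \<bullet> \<nu> N))"
      unfolding G_eq[symmetric]
      by (rule area_formula(2)[OF T1 inj im' _ _ _ m1 m2]; (rule ball(1) | (rule der tan1 tan2, assumption)))
    then have a2: "set_lebesgue_integral lborel T1 (G P) = integral\<^sup>L lborel k"
      using ball(2) by (rule trans)
    show ?thesis using a1 a2 kI by simp
  qed
  \<comment> \<open>The radius \<open>2 * d\<close> leaves the distance \<open>d\<close> between far
    surface points and any \<open>P\<close> within \<open>d\<close> of \<open>N\<close>.\<close>
  obtain d where d: "0 < d" "ball N (2 * d) \<subseteq> cylinder"
  proof -
    obtain d' where "0 < d'" "ball N d' \<subseteq> cylinder" using open_cylinder N_in_cylinder openE by blast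
    then show ?thesis by (intro that[of "d' / 2"]) auto
  qed
  have far_dist: "d \<le> norm (rr p - P)" if "p \<in> T2" "P \<in> ball N d" for p P
  proof -
    have "rr p \<notin> ball N (2 * d)" using that(1) d(2) by (auto simp: T2_def T1_def)
    then have "2 * d \<le> dist N (rr p)" by simp
    also have "\<dots> \<le> dist N P + dist P (rr p)" by (rule dist_triangle)
    finally show ?thesis using that(2) by (simp add: dist_norm norm_minus_commute)
  qed
  have far_int: "set_integrable lborel T2 (G P)" if "P \<in> near" "P \<in> ball N d" for P
    by (rule far_integrable[OF near_pos[OF that(1)] T2 sub(2) d(1) far_dist[OF _ that(2)]])
  have NB: "N \<in> ball N d" using d by simp
  have far_limit: "(\<lambda>i. set_lebesgue_integral lborel T2 (G (X i))) \<longlonglongrightarrow> set_lebesgue_integral lborel T2 (G N)"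
    if X: "\<And>i. X i \<in> near" "\<And>i. X i \<in> ball N d" "X \<longlonglongrightarrow> N" for X
    unfolding set_lebesgue_integral_def
  proof (rule integral_dominated_convergence)
    let ?K = "M * (B / d\<^sup>2 + B / d) * C"
    show "(\<lambda>p. indicator T2 p *\<^sub>R G N p) \<in> borel_measurable lborel" using G_measurable[OF N0 T2 sub(2)] by simp
    show "(\<lambda>p. indicator T2 p *\<^sub>R G (X i) p) \<in> borel_measurable lborel" for i
      using G_measurable[OF near_pos[OF X(1)] T2 sub(2)] by simp
    show "integrable lborel (\<lambda>p. indicator T2 p * ?K)"
      by (rule integrable_const_on[OF T2]) (use sub(2) reps_sub in blast)
    show "AE p in lborel. norm (indicator T2 p *\<^sub>R G (X i) p) \<le> indicator T2 p * ?K" for i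
    proof (rule AE_I2)
      fix p
      have "\<bar>G (X i) p\<bar> \<le> ?K" if p: "p \<in> T2"
      proof (rule G_bound)
        have \<Gamma>: "rr p \<in> \<Gamma>" using p sub(2) reps_Gamma by blast
        show "p \<in> reps" using p sub(2) by blast
        show "\<bar>\<mu> (rr p)\<bar> \<le> M" using M \<Gamma> closure_subset by blast
        show "jac p \<le> C" using C p sub(2) reps_sub by blast
        have ne: "X i \<noteq> rr p" using far_dist[OF p X(2)[of i]] d(1) by auto
        then have K: "\<bar>kernel_sing (1 - 2 * \<alpha>) (X i) (rr p)\<bar> \<le> B \<and> norm (kernel_reg (1 - 2 * \<alpha>) (X i) (rr p)) \<le> B / norm (rr p - X i)"
          using X(1)[of i] Gamma_pos[OF \<Gamma>] by (intro B(2)) (auto simp: near_def)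
        show "\<bar>dlk (X i) (rr p)\<bar> \<le> B / d\<^sup>2 + B / d"
          by (rule dlk_bound[OF near_pos[OF X(1)] \<Gamma> d(1) far_dist[OF p X(2)] B(1)]) (use K in auto)
      qed
      then show "norm (indicator T2 p *\<^sub>R G (X i) p) \<le> indicator T2 p * ?K" by (cases "p \<in> T2") auto
    qed
    show "AE p in lborel. (\<lambda>i. indicator T2 p *\<^sub>R G (X i) p) \<longlonglongrightarrow> indicator T2 p *\<^sub>R G N p"
    proof (rule AE_I2)
      fix p
      show "(\<lambda>i. indicator T2 p *\<^sub>R G (X i) p) \<longlonglongrightarrow> indicator T2 p *\<^sub>R G N p"
      proof (cases "p \<in> T2")
        case True
        have \<Gamma>: "rr p \<in> \<Gamma>" using True sub(2) reps_Gamma by blast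
        have "N \<noteq> rr p" using far_dist[OF True NB] d(1) by auto
        then have "(\<lambda>i. dlk (X i) (rr p)) \<longlonglongrightarrow> dlk N (rr p)"
          using \<Gamma> N0 by (intro dlk_tendsto[OF X(3) tendsto_const]) auto
        then show ?thesis unfolding G_def by (intro tendsto_intros)
      qed simp
    qed
  qed
  define I where "I = (\<lambda>P. set_lebesgue_integral lborel reps (G P))"
  define I1 where "I1 = (\<lambda>P. integral\<^sup>L lborel (\<lambda>u. indicator (punctured P) u * weak P u))"
  define I2 where "I2 = (\<lambda>P. integral\<^sup>L lborel (\<lambda>u. indicator (punctured P) u * poisson P u))"
  define I3 where "I3 = (\<lambda>P. set_lebesgue_integral lborel T2 (G P))"
  have total: "I P = I1 P + I2 P + I3 P" "set_integrable lborel reps (G P)" if P: "P \<in> near" "P \<in> ball N d" for P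
  proof -
    have "I P = set_lebesgue_integral lborel T1 (G P) + set_lebesgue_integral lborel T2 (G P)"
      unfolding I_def sub(4)[symmetric]
      by (rule set_integral_Un[OF sub(3)]) (use near_integral[OF P(1)] far_int[OF P] in auto)
    then show "I P = I1 P + I2 P + I3 P" using near_integral[OF P(1)] by (simp add: I1_def I2_def I3_def)
    show "set_integrable lborel reps (G P)"
      unfolding sub(4)[symmetric]
      by (rule set_integrable_Un) (use near_integral[OF P(1)] far_int[OF P] T1 T2 in auto)
  qed
  show "set_integrable lborel reps (G N)" by (rule total(2)[OF N_near NB])
  have I2N: "I2 N = 0" by (simp add: I2_def poisson_def height_def \<phi>_0)
  have side: "(I \<longlongrightarrow> \<sigma> * \<mu> N / 2 + I N) (at N within Y)"
    if \<sigma>: "\<bar>\<sigma>\<bar> = 1" and ev: "\<forall>\<^sub>F P in at N within Y. P \<in> near \<and> P \<in> ball N d \<and> 0 < \<sigma> * height P" for \<sigma> Y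
    unfolding tendsto_at_iff_sequentially
  proof (intro allI impI)
    fix X :: "nat \<Rightarrow> real^3" assume X: "\<forall>i. X i \<in> Y - {N}" "X \<longlonglongrightarrow> N"
    have "filterlim X (at N within Y) sequentially" using X by (auto simp: filterlim_at)
    from eventually_compose_filterlim[OF ev this]
    obtain k where k: "\<And>i. k \<le> i \<Longrightarrow> X i \<in> near \<and> X i \<in> ball N d \<and> 0 < \<sigma> * height (X i)"
      by (auto simp: eventually_sequentially)
    \<comment> \<open>The position of \<open>P\<close> is controlled only eventually, while the
      limit lemmas ask for all indices; dropping the first \<open>k\<close> terms reconciles the
      two.\<close>
    define Z where "Z = (\<lambda>i. X (i + k))"
    have Z: "\<And>i. Z i \<in> near" "\<And>i. Z i \<in> ball N d" "\<And>i. 0 < \<sigma> * height (Z i)" using k by (auto simp: Z_def)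
    have ZN: "Z \<longlonglongrightarrow> N" unfolding Z_def by (rule LIMSEQ_ignore_initial_segment[OF X(2)])
    have "(\<lambda>i. I1 (Z i) + I2 (Z i) + I3 (Z i)) \<longlonglongrightarrow> I1 N + \<sigma> * \<mu> N / 2 + I3 N"
      unfolding I1_def I2_def I3_def
      by (intro tendsto_add weak_limit[OF Z(1) ZN] poisson_limit[OF Z(1) ZN \<sigma> Z(3)] far_limit[OF Z(1,2) ZN])
    then have "(\<lambda>i. I (Z i)) \<longlonglongrightarrow> \<sigma> * \<mu> N / 2 + I N"
      using total(1)[OF Z(1,2)] total(1)[OF N_near NB] I2N by (simp add: algebra_simps)
    then show "(I \<circ> X) \<longlonglongrightarrow> \<sigma> * \<mu> N / 2 + I N"
      unfolding Z_def o_def by (rule LIMSEQ_offset)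
  qed
  define U where "U = cylinder \<inter> {P. N$1 / 2 < P$1} \<inter> {P. P$1 < 2 * N$1} \<inter> ball N d"
  have "open U" unfolding U_def
    by (intro open_Int open_cylinder open_ball open_Collect_less continuous_intros)
  moreover have "N \<in> U" using N_in_cylinder N0 d by (simp add: U_def)
  ultimately have evU: "\<forall>\<^sub>F P in at N within Y. P \<in> U" for Y
    using topological_tendstoD[OF tendsto_ident_at] by blast
  have U_near: "P \<in> near \<and> P \<in> ball N d \<and> P \<in> cylinder" if "P \<in> U" for P using that by (auto simp: U_def near_def)
  \<comment> \<open>The cylinder was chosen inside the half-space, so it meets no other part of the
    frontier than \<open>\<Gamma>\<close>.\<close>
  have fr: "frontier D \<inter> cylinder \<subseteq> \<Gamma>" using D(2) W by (auto simp: cylinder_def)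
  note sides = domain_sides_converse[OF D(1) fr D(3) out]
  have "\<forall>\<^sub>F P in at N within D. P \<in> D" by (simp add: eventually_at_filter)
  with evU have "\<forall>\<^sub>F P in at N within D. P \<in> near \<and> P \<in> ball N d \<and> 0 < (- 1) * height P"
    by eventually_elim (use U_near sides(1) in \<open>auto simp: height_def\<close>)
  from side[OF _ this] show "((\<lambda>P. set_lebesgue_integral lborel reps (G P)) \<longlongrightarrow> - (1 / 2) * \<mu> N + set_lebesgue_integral lborel reps (G N)) (at N within D)"
    by (simp add: I_def)
  have "\<forall>\<^sub>F P in at N within - closure D. P \<in> - closure D" by (simp add: eventually_at_filter)
  with evU have "\<forall>\<^sub>F P in at N within - closure D. P \<in> near \<and> P \<in> ball N d \<and> 0 < 1 * height P"
    by eventually_elim (use U_near sides(2) in \<open>auto simp: height_def\<close>)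
  from side[OF _ this] show "((\<lambda>P. set_lebesgue_integral lborel reps (G P)) \<longlongrightarrow> 1 / 2 * \<mu> N + set_lebesgue_integral lborel reps (G N)) (at N within - closure D)"
    by (simp add: I_def)
qed

end

theorem theorem2:
  fixes \<alpha> s1 s2 t1 t2 t0 :: real
    and D X \<Gamma> \<gamma> :: "(real^3) set"
    and \<nu> :: "real^3 \<Rightarrow> real^3"
    and r rs rt :: "real \<Rightarrow> real \<Rightarrow> real^3"
    and \<mu> :: "real^3 \<Rightarrow> real"
    and \<mu>2 :: "real \<Rightarrow> real \<Rightarrow> real"
  defines "R \<equiv> {s1..s2} \<times> {t1..t2}"
  assumes alpha: "0 < 2 * \<alpha>" "2 * \<alpha> < 1"
    and X: "X \<noteq> {}" "X \<subseteq> {P. P$1 = 0}" "openin (top_of_set {P. P$1 = 0}) X" "simply_connected X"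
    and Gamma: "\<Gamma> \<subseteq> {P. 0 < P$1}" "lyapunov_surface \<Gamma> \<nu>"
    and D: "D \<noteq> {}" "open D" "connected D" "bounded D" "D \<subseteq> {P. 0 < P$1}"
           "frontier D = X \<union> \<Gamma> \<union> \<gamma>"
    and gamma: "closure X - X = \<gamma>" "closure \<Gamma> - \<Gamma> = \<gamma>"
    and outer: "\<And>Q. Q \<in> \<Gamma> \<Longrightarrow> points_outward D Q (\<nu> Q)"
    and rectangle: "s1 < s2" "t1 < t2"
    and param: "(\<lambda>(s, t). r s t) ` R = closure \<Gamma>"
    and t0: "t0 \<in> {t1..t2}" "\<And>s. s \<in> {s1..s2} \<Longrightarrow> r s t0 $ 1 = 0"
            "(\<lambda>s. r s t0) ` {s1..s2} = \<gamma>"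
    and deriv_s: "\<And>s t. (s, t) \<in> R \<Longrightarrow>
          ((\<lambda>a. r a t) has_vector_derivative rs s t) (at s within {s1..s2})"
    and deriv_t: "\<And>s t. (s, t) \<in> R \<Longrightarrow>
          ((\<lambda>b. r s b) has_vector_derivative rt s t) (at t within {t1..t2})"
    and cont_deriv: "continuous_on R (\<lambda>(s, t). rs s t)" "continuous_on R (\<lambda>(s, t). rt s t)"
    and regular: "\<And>s t. (s, t) \<in> R \<Longrightarrow> (rs s t $ 1)\<^sup>2 + (rs s t $ 2)\<^sup>2 + (rs s t $ 3)\<^sup>2 \<noteq> 0"
                 "\<And>s t. (s, t) \<in> R \<Longrightarrow> (rt s t $ 1)\<^sup>2 + (rt s t $ 2)\<^sup>2 + (rt s t $ 3)\<^sup>2 \<noteq> 0"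
    and right_angle: "\<And>P. P \<in> \<gamma> \<Longrightarrow>
          ((\<lambda>Q. vec_angle (\<nu> Q) (axis 1 1)) \<longlongrightarrow> pi / 2) (at P within \<Gamma>)"
    and mu: "continuous_on (closure \<Gamma>) \<mu>" "\<And>s t. (s, t) \<in> R \<Longrightarrow> \<mu>2 s t = \<mu> (r s t)"
  defines "w \<equiv> \<lambda>P. surface_integral r rs rt R \<Gamma> (\<lambda>a b. \<mu>2 a b * dl_kernel \<alpha> \<nu> r P a b)"
  shows "(\<forall>P. 0 < P$1 \<and> P \<notin> \<Gamma> \<longrightarrow>
           surface_integrable r rs rt R \<Gamma> (\<lambda>a b. \<mu>2 a b * dl_kernel \<alpha> \<nu> r P a b)) \<and>
         (\<forall>(s, t)\<in>R. r s t \<in> \<Gamma> \<longrightarrow>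
           surface_integrable r rs rt R \<Gamma> (\<lambda>a b. \<mu>2 a b * K2 \<alpha> \<nu> r s t a b) \<and>
           (w \<longlongrightarrow> - (1 / 2) * \<mu>2 s t +
              surface_integral r rs rt R \<Gamma> (\<lambda>a b. \<mu>2 a b * K2 \<alpha> \<nu> r s t a b))
             (at (r s t) within D) \<and>
           (w \<longlongrightarrow> 1 / 2 * \<mu>2 s t +
              surface_integral r rs rt R \<Gamma> (\<lambda>a b. \<mu>2 a b * K2 \<alpha> \<nu> r s t a b))
             (at (r s t) within - closure D))"
proof -
  \<comment> \<open>The boundary curve is the coordinate line \<open>t = t0\<close>, on which the
    first coordinate vanishes.\<close>
  have edge: "closure \<Gamma> - \<Gamma> \<subseteq> {P. P $ 1 = 0}" unfolding gamma(2) t0(3)[symmetric] using t0(2) by auto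
  note mu2 = mu(2)
  interpret double_layer \<alpha> s1 s2 t1 t2 \<Gamma> \<nu> r rs rt \<mu> R
    by unfold_locales (use alpha Gamma edge rectangle param deriv_s deriv_t cont_deriv mu(1) in \<open>simp_all add: R_def\<close>)
  have cong: "(case p of (a, b) \<Rightarrow> \<mu>2 a b * dl_kernel \<alpha> \<nu> r P a b * norm (cross3 (rs a b) (rt a b))) = G P p"
    if "p \<in> reps" for P p
    using that reps_sub mu2 by (cases p) (auto simp: dl_kernel_def dlk_def G_def rr_def jac_def)
  have integrable: "surface_integrable r rs rt R \<Gamma> (\<lambda>a b. \<mu>2 a b * dl_kernel \<alpha> \<nu> r P a b) \<longleftrightarrow> set_integrable lborel reps (G P)" for P
    unfolding surface_integrable_def reps_def[symmetric] by (rule set_integrable_cong) (auto simp: cong)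
  have integral: "surface_integral r rs rt R \<Gamma> (\<lambda>a b. \<mu>2 a b * dl_kernel \<alpha> \<nu> r P a b) = set_lebesgue_integral lborel reps (G P)" for P
    unfolding surface_integral_def reps_def[symmetric] by (rule set_lebesgue_integral_cong) (use reps_borel cong in auto)
  have w: "w = (\<lambda>P. set_lebesgue_integral lborel reps (G P))" by (simp add: w_def integral)
  \<comment> \<open>Both \<open>X\<close> and \<open>\<gamma>\<close> lie in the plane
    \<open>x = 0\<close>, so \<open>\<Gamma>\<close> is all of the frontier in the open
    half-space.\<close>
  have fr: "frontier D \<inter> {P. 0 < P $ 1} \<subseteq> \<Gamma>" "\<Gamma> \<subseteq> frontier D"
    using D(6) X(2) gamma(2) edge by auto
  show ?thesis
  proof (intro conjI allI impI ballI)
    fix P :: "real^3" assume "0 < P $ 1 \<and> P \<notin> \<Gamma>"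
    then show "surface_integrable r rs rt R \<Gamma> (\<lambda>a b. \<mu>2 a b * dl_kernel \<alpha> \<nu> r P a b)"
      unfolding integrable using off_surface_integrable by blast
  next
    fix p assume p: "p \<in> R"
    obtain s t where st: "p = (s, t)" by (cases p)
    have m: "\<mu>2 s t = \<mu> (r s t)" using mu2 p st by simp
    show "case p of (s, t) \<Rightarrow> r s t \<in> \<Gamma> \<longrightarrow>
           surface_integrable r rs rt R \<Gamma> (\<lambda>a b. \<mu>2 a b * K2 \<alpha> \<nu> r s t a b) \<and>
           (w \<longlongrightarrow> - (1 / 2) * \<mu>2 s t +
              surface_integral r rs rt R \<Gamma> (\<lambda>a b. \<mu>2 a b * K2 \<alpha> \<nu> r s t a b))
             (at (r s t) within D) \<and>
           (w \<longlongrightarrow> 1 / 2 * \<mu>2 s t +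
              surface_integral r rs rt R \<Gamma> (\<lambda>a b. \<mu>2 a b * K2 \<alpha> \<nu> r s t a b))
             (at (r s t) within - closure D)"
      unfolding st split K2_def integrable integral w m
      using jump_relation[OF _ D(2) fr outer, of "r s t"] by blast
  qed
qed

end
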